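(* Let $\Sigma\subset H_r$ be a finite nonempty antichain (under diagram containment) of Young diagrams, let $I_\Sigma=\sum_{\sigma\in\Sigma}I_\sigma\subseteq R$, and let $p\leq r$ be a positive integer such that $\gamma_p(\Sigma)>0$. Assume every Rees valuation of $I_\Sigma$ is one of $\gamma_1,\ldots,\gamma_r$. Then the asymptotic resurgence for the graded family $I_\Sigma^{(\bullet)_p}$ relative to $I_\Sigma^\bullet$ is $$\widehat{\rho}(I_\Sigma^{(\bullet)_p},I_\Sigma^\bullet)=\frac{\alpha(I_\Sigma)}{\widehat{\alpha}^p(I_\Sigma)}=\frac{(r-p+1)\gamma_1(\Sigma)}{r\,\gamma_p(\Sigma)}.$$
   Context: $\Bbbk$ is a field of characteristic zero, $X=(x_{ij})$ is a generic $r\times n$ matrix of indeterminates with $r\leq n$, and $R=\Bbbk[X]$ with the standard grading. The group $G=\mathrm{GL}_r(\Bbbk)\times\mathrm{GL}_n(\Bbbk)$ acts on $R$: $(A,B)$ sends $x_{ij}$ to the $(i,j)$ entry of $A^{-1}XB$. A Young diagram is a finite weakly decreasing sequence $\sigma=(\sigma_1,\ldots,\sigma_s)$ of positive integers (row lengths). $H_r$ is the set of Young diagrams with at most $r$ columns. Containment $\mu\subseteq\lambda$ means $\mu_i\leq\lambda_i$ for all $i$ after padding with zeros. $K_\sigma=\prod_{i}[1\,2\ldots\sigma_i\mid 1\,2\ldots\sigma_i]$ is the product of the leading principal minors of $X$ of sizes $\sigma_i$; $I_\sigma$ is the smallest $G$-invariant ideal of $R$ containing $K_\sigma$. $D_j$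 ($1\leq j\leq r$) is the (prime) ideal generated by the $j\times j$ minors of $X$. For a $G$-invariant ideal $I$ and $m\geq1$, $I^{(m)_p}:=I^mR_{D_p}\cap R$; $I^{(\bullet)_p}=\{I^{(m)_p}\}_{m\geq1}$ and $I^\bullet=\{I^m\}_{m\geq1}$. For graded families $\mathbf a_\bullet,\mathbf b_\bullet$ of ideals, $\widehat\rho(\mathbf a_\bullet,\mathbf b_\bullet)=\sup\{u/v : u,v\in\mathbb Z_{>0},\ \mathbf a_{uk}\not\subseteq\mathbf b_{vk}\text{ for }k\gg0\}$. $\alpha(J)$ is the smallest degree of a nonzero homogeneous element of a homogeneous ideal $J$, and $\widehat\alpha^p(I)=\lim_{m\to\infty}\alpha(I^{(m)_p})/m$. The valuation $\gamma_j$ on $\mathrm{Frac}(R)$ is determined by $\gamma_j(f)=\max\{i\geq0: f\in D_j^{(i)}\}$ for $0\neq f\in R$, where $D_j^{(i)}=D_j^iR_{D_j}\cap R$. For $\sigma\in H_r$, $\gamma_j(\sigma)=\sum_i\max\{0,\sigma_i-j+1\}$, and $\gamma_j(\Sigma)=\min\{\gamma_j(\sigma):\sigma\in\Sigma\}$. The Rees valuations of an ideal $I$ are the valuations of the unique minimal finite set of rank one discrete valuation rings $V_1,\ldots,V_s$ with $R\subset V_i\subset\mathrm{Frac}(R)$ and $\overline{I^k}=\bigcap_i(I^kV_i\cap R)$ for all $k\in\mathbb N$, where $\overline{\phantom{I}}$ denotes integral closure. *)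

theory Defs
  imports
    "HOL-Analysis.Analysis"
    "HOL-Library.Poly_Mapping"
    "HOL-Computational_Algebra.Polynomial_Factorial"
    "Jordan_Normal_Form.Determinant"
begin

section \<open>Ideals of a commutative ring\<close>

text \<open>
  An ideal of the ring \<open>'a\<close> is a submodule of \<open>'a\<close> over itself: \<open>ring_mod.subspace I\<close> says that
  \<open>I\<close> is an ideal and \<open>ring_mod.span S\<close> is the ideal generated by \<open>S\<close>.
\<close>

global_interpretation ring_mod: Modules.module "(*) :: 'a \<Rightarrow> 'a \<Rightarrow> 'a::comm_ring_1"
  by unfold_locales (simp_all add: algebra_simps)

definition ideal_mult :: "'a::comm_ring_1 set \<Rightarrow> 'a set \<Rightarrow> 'a set" where
  "ideal_mult I J = ring_mod.span {a * b | a b. a \<in> I \<and> b \<in> J}"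

primrec ideal_power :: "'a::comm_ring_1 set \<Rightarrow> nat \<Rightarrow> 'a set" where
  "ideal_power I 0 = UNIV"
| "ideal_power I (Suc m) = ideal_mult I (ideal_power I m)"

definition integral_closure :: "'a::comm_ring_1 set \<Rightarrow> 'a set" where
  "integral_closure I =
     {f. \<exists>n\<ge>1. \<exists>a. (\<forall>i\<in>{1..n}. a i \<in> ideal_power I i) \<and> f ^ n + (\<Sum>i=1..n. a i * f ^ (n - i)) = 0}"


section \<open>Extension to overrings inside the fraction field\<close>

text \<open>\<open>extension S I\<close> is \<open>I S\<close>, for a ring \<open>S\<close> between the domain and its fraction field.\<close>

definition extension :: "'a::idom fract set \<Rightarrow> 'a set \<Rightarrow> 'a fract set" where
  "extension S I = {\<Sum>a\<in>A. c a * to_fract a | A c. finite A \<and> A \<subseteq> I \<and> c ` A \<subseteq> S}"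

definition ext_contr :: "'a::idom fract set \<Rightarrow> 'a set \<Rightarrow> 'a set" where
  "ext_contr S I = {f. to_fract f \<in> extension S I}"

definition localization :: "'a::idom set \<Rightarrow> 'a fract set" where
  "localization P = {Fract a s | a s. s \<notin> P}"

text \<open>\<open>I\<^sup>m R\<^sub>P \<inter> R\<close>; for \<open>I = P\<close> this is the usual symbolic power of \<open>P\<close>.\<close>

definition symbolic_power_at :: "'a::idom set \<Rightarrow> 'a set \<Rightarrow> nat \<Rightarrow> 'a set" where
  "symbolic_power_at P I m = ext_contr (localization P) (ideal_power I m)"


section \<open>Discrete valuations and Rees valuations\<close>

text \<open>
  Rank one discrete valuation rings with a given fraction field correspond to its normalized
  (surjective onto the integers) discrete valuations. The value at \<open>0\<close>, conventionally infinity,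
  is immaterial; it is fixed to be \<open>0\<close> so that a valuation is determined by its valuation ring.
\<close>

definition discrete_valuation :: "('f::field \<Rightarrow> int) \<Rightarrow> bool" where
  "discrete_valuation v \<longleftrightarrow>
     v 0 = 0 \<and>
     (\<forall>x y. x \<noteq> 0 \<longrightarrow> y \<noteq> 0 \<longrightarrow> v (x * y) = v x + v y) \<and>
     (\<forall>x y. x \<noteq> 0 \<longrightarrow> y \<noteq> 0 \<longrightarrow> x + y \<noteq> 0 \<longrightarrow> min (v x) (v y) \<le> v (x + y)) \<and>
     (\<exists>x. x \<noteq> 0 \<and> v x = 1)"

definition valuation_ring :: "('f::field \<Rightarrow> int) \<Rightarrow> 'f set" where
  "valuation_ring v = {x. x = 0 \<or> 0 \<le> v x}"

definition rees_representation :: "'a::idom set \<Rightarrow> ('a fract \<Rightarrow> int) set \<Rightarrow> bool" where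
  "rees_representation I W \<longleftrightarrow>
     finite W \<and>
     (\<forall>v\<in>W. discrete_valuation v \<and> range to_fract \<subseteq> valuation_ring v) \<and>
     (\<forall>k. integral_closure (ideal_power I k) =
           {f. \<forall>v\<in>W. f \<in> ext_contr (valuation_ring v) (ideal_power I k)})"

text \<open>\<open>W\<close> is the set of Rees valuations of \<open>I\<close>.\<close>

definition is_rees_valuations :: "'a::idom set \<Rightarrow> ('a fract \<Rightarrow> int) set \<Rightarrow> bool" where
  "is_rees_valuations I W \<longleftrightarrow>
     rees_representation I W \<and> (\<forall>W'. W' \<subset> W \<longrightarrow> \<not> rees_representation I W')"


section \<open>The polynomial ring of a generic matrix\<close>

text \<open>
  The rows are indexed by \<open>'r\<close> and the columns by \<open>'n\<close>, so that there are \<open>CARD('r)\<close> rows and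
  \<open>CARD('n)\<close> columns. A monomial is given by its matrix of exponents; nesting the two indices,
  instead of using pairs, makes this ring an integral domain by the type class instances of
  \<^theory>\<open>HOL-Library.Poly_Mapping\<close>.
\<close>

type_synonym ('r, 'n, 'k) matpoly = "('r \<Rightarrow>\<^sub>0 ('n \<Rightarrow>\<^sub>0 nat)) \<Rightarrow>\<^sub>0 'k"

type_synonym ('r, 'n, 'a) matrix =
  "(('a, 'n) Finite_Cartesian_Product.vec, 'r) Finite_Cartesian_Product.vec"

definition const_poly :: "'k \<Rightarrow> ('r, 'n, 'k::field_char_0) matpoly" where
  "const_poly c = Poly_Mapping.single 0 c"

definition generic_matrix ::
  "('r::{finite,linorder}, 'n::{finite,linorder}, ('r, 'n, 'k::field_char_0) matpoly) matrix" where
  "generic_matrix = (\<chi> i j. Poly_Mapping.single (Poly_Mapping.single i (Poly_Mapping.single j 1)) 1)"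

definition mon_deg :: "('r::finite \<Rightarrow>\<^sub>0 ('n::finite \<Rightarrow>\<^sub>0 nat)) \<Rightarrow> nat" where
  "mon_deg m = (\<Sum>i\<in>UNIV. \<Sum>j\<in>UNIV. Poly_Mapping.lookup (Poly_Mapping.lookup m i) j)"

definition homogeneous :: "nat \<Rightarrow> ('r::finite, 'n::finite, 'k::field_char_0) matpoly \<Rightarrow> bool" where
  "homogeneous d f \<longleftrightarrow> (\<forall>m\<in>Poly_Mapping.keys f. mon_deg m = d)"

definition initial_degree :: "('r::finite, 'n::finite, 'k::field_char_0) matpoly set \<Rightarrow> nat" where
  "initial_degree J = (LEAST d. \<exists>f\<in>J. f \<noteq> 0 \<and> homogeneous d f)"

text \<open>\<open>mat_subst Y\<close> is the algebra endomorphism sending the \<open>(i, j)\<close> entry of the generic matrix to that of \<open>Y\<close>.\<close>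

definition mat_subst ::
  "('r::{finite,linorder}, 'n::{finite,linorder}, ('r, 'n, 'k::field_char_0) matpoly) matrix
     \<Rightarrow> ('r, 'n, 'k) matpoly \<Rightarrow> ('r, 'n, 'k) matpoly" where
  "mat_subst Y f =
     (\<Sum>m\<in>Poly_Mapping.keys f. const_poly (Poly_Mapping.lookup f m) *
        (\<Prod>i\<in>UNIV. \<Prod>j\<in>UNIV. vec_nth (vec_nth Y i) j ^ Poly_Mapping.lookup (Poly_Mapping.lookup m i) j))"

definition GL_action ::
  "('r, 'r, 'k) matrix \<Rightarrow> ('n, 'n, 'k) matrix
     \<Rightarrow> ('r::{finite,linorder}, 'n::{finite,linorder}, 'k::field_char_0) matpoly \<Rightarrow> ('r, 'n, 'k) matpoly" where
  "GL_action A B = mat_subst (map_matrix const_poly (matrix_inv A) ** generic_matrix ** map_matrix const_poly B)"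

definition GL_invariant ::
  "('r::{finite,linorder}, 'n::{finite,linorder}, 'k::field_char_0) matpoly set \<Rightarrow> bool" where
  "GL_invariant I \<longleftrightarrow>
     (\<forall>A B. invertible A \<longrightarrow> invertible B \<longrightarrow> (\<forall>f\<in>I. GL_action A B f \<in> I))"


section \<open>Minors and determinantal ideals\<close>

text \<open>The minor of the generic matrix on the given lists (of equal length) of rows and columns.\<close>

definition minor ::
  "'r list \<Rightarrow> 'n list \<Rightarrow> ('r::{finite,linorder}, 'n::{finite,linorder}, 'k::field_char_0) matpoly" where
  "minor rs cs =
     Determinant.det (Matrix.mat (length rs) (length cs) (\<lambda>(a, b). vec_nth (vec_nth generic_matrix (rs ! a)) (cs ! b)))"

definition leading_minor ::
  "nat \<Rightarrow> ('r::{finite,linorder}, 'n::{finite,linorder}, 'k::field_char_0) matpoly" where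
  "leading_minor t = minor (take t (sorted_list_of_set UNIV)) (take t (sorted_list_of_set UNIV))"

definition det_ideal ::
  "nat \<Rightarrow> ('r::{finite,linorder}, 'n::{finite,linorder}, 'k::field_char_0) matpoly set" where
  "det_ideal j = ring_mod.span
     {minor rs cs | rs cs. length rs = j \<and> length cs = j \<and> sorted_wrt (<) rs \<and> sorted_wrt (<) cs}"

definition gamma ::
  "nat \<Rightarrow> ('r::{finite,linorder}, 'n::{finite,linorder}, 'k::field_char_0) matpoly \<Rightarrow> nat" where
  "gamma j f = Max {i. f \<in> symbolic_power_at (det_ideal j) (det_ideal j) i}"

text \<open>
  \<open>v\<close> is the valuation \<open>\<gamma>\<^sub>j\<close> of the fraction field: a valuation is determined by its values on
  the nonzero elements of the ring.
\<close>

definition is_gamma_valuation ::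
  "nat \<Rightarrow> (('r::{finite,linorder}, 'n::{finite,linorder}, 'k::field_char_0) matpoly fract \<Rightarrow> int) \<Rightarrow> bool" where
  "is_gamma_valuation j v \<longleftrightarrow>
     discrete_valuation v \<and> (\<forall>f. f \<noteq> 0 \<longrightarrow> v (to_fract f) = int (gamma j f))"


section \<open>Young diagrams and their invariant ideals\<close>

text \<open>Diagrams are lists of row lengths; the number of columns is the largest row length.\<close>

definition young_diagram :: "nat list \<Rightarrow> bool" where
  "young_diagram \<sigma> \<longleftrightarrow> sorted_wrt (\<ge>) \<sigma> \<and> (\<forall>s\<in>set \<sigma>. 0 < s)"

definition diagrams :: "nat \<Rightarrow> nat list set" where
  "diagrams r = {\<sigma>. young_diagram \<sigma> \<and> (\<forall>s\<in>set \<sigma>. s \<le> r)}"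

definition row_length :: "nat list \<Rightarrow> nat \<Rightarrow> nat" where
  "row_length \<sigma> i = (if i < length \<sigma> then \<sigma> ! i else 0)"

definition diagram_le :: "nat list \<Rightarrow> nat list \<Rightarrow> bool" where
  "diagram_le \<mu> \<nu> \<longleftrightarrow> (\<forall>i. row_length \<mu> i \<le> row_length \<nu> i)"

definition K_diagram ::
  "nat list \<Rightarrow> ('r::{finite,linorder}, 'n::{finite,linorder}, 'k::field_char_0) matpoly" where
  "K_diagram \<sigma> = prod_list (map leading_minor \<sigma>)"

definition inv_ideal ::
  "nat list \<Rightarrow> ('r::{finite,linorder}, 'n::{finite,linorder}, 'k::field_char_0) matpoly set" where
  "inv_ideal \<sigma> = \<Inter>{J. ring_mod.subspace J \<and> GL_invariant J \<and> K_diagram \<sigma> \<in> J}"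

definition inv_ideal_sum ::
  "nat list set \<Rightarrow> ('r::{finite,linorder}, 'n::{finite,linorder}, 'k::field_char_0) matpoly set" where
  "inv_ideal_sum \<Sigma> = {\<Sum>\<sigma>\<in>\<Sigma>. g \<sigma> | g. \<forall>\<sigma>\<in>\<Sigma>. g \<sigma> \<in> inv_ideal \<sigma>}"

text \<open>Natural number subtraction truncates, so the summand is \<open>max {0, s - j + 1}\<close>.\<close>

definition gamma_diagram :: "nat \<Rightarrow> nat list \<Rightarrow> nat" where
  "gamma_diagram j \<sigma> = (\<Sum>s\<leftarrow>\<sigma>. s + 1 - j)"

definition gamma_diagrams :: "nat \<Rightarrow> nat list set \<Rightarrow> nat" where
  "gamma_diagrams j \<Sigma> = Min (gamma_diagram j ` \<Sigma>)"


section \<open>Asymptotic invariants\<close>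

definition sym_power ::
  "nat \<Rightarrow> ('r::{finite,linorder}, 'n::{finite,linorder}, 'k::field_char_0) matpoly set \<Rightarrow> nat
     \<Rightarrow> ('r, 'n, 'k) matpoly set" where
  "sym_power p I m = symbolic_power_at (det_ideal p) I m"

definition asymptotic_initial_degree ::
  "nat \<Rightarrow> ('r::{finite,linorder}, 'n::{finite,linorder}, 'k::field_char_0) matpoly set \<Rightarrow> real" where
  "asymptotic_initial_degree p I = lim (\<lambda>m. real (initial_degree (sym_power p I m)) / real m)"

definition asymptotic_resurgence :: "(nat \<Rightarrow> 'a set) \<Rightarrow> (nat \<Rightarrow> 'a set) \<Rightarrow> ereal" where
  "asymptotic_resurgence a b =
     Sup {ereal (real u / real v) | u v.
            0 < u \<and> 0 < v \<and> (\<forall>\<^sub>F k in sequentially. \<not> a (u * k) \<subseteq> b (v * k))}"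

end

theory Submission
  imports Defs
begin

text \<open>
  Let \<open>r\<close> be the number of rows, let \<open>\<Delta>\<^sub>t\<close> be the leading principal \<open>t\<close>-minor, and for an exponent
  vector \<open>e\<close> let \<open>K\<^sup>e = \<Prod>\<^sub>t \<Delta>\<^sub>t\<^bsup>e t\<^esup>\<close> (\<open>Kprod e\<close>) and \<open>\<gamma>\<^sub>j(e) = \<Sum>\<^sub>t e t \<cdot> max {0, t - j + 1}\<close>
  (\<open>gamma_exp\<close>). The proof reduces every question about ideals to the question which \<open>K\<^sup>e\<close> they
  contain, and every such question to linear inequalities between the numbers \<open>\<gamma>\<^sub>j(e)\<close>.

  The reduction rests on characteristic zero. The ring is a multiplicity free representation of
  \<open>G\<close> whose highest weight vectors are the \<open>K\<^sup>e\<close>, so a \<open>G\<close>-stable subspace is determined by the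
  \<open>K\<^sup>e\<close> in it (\<open>stable_subset_if_Kprods\<close>). The stability that is used is stability under the
  polarization operators \<open>E\<^sub>a\<^sub>b\<close>, the action of the Lie algebra; as these are derivations, it passes
  from an ideal to its powers and to their contractions from a localization. Complete reducibility
  is replaced by the apolar form: if \<open>N \<subseteq> A\<close> are stable, the part of \<open>A\<close> orthogonal to \<open>N\<close> is stable
  again, hence if it is nonzero it contains some \<open>K\<^sup>e\<close>; when all \<open>K\<^sup>e\<close> in \<open>A\<close> are in \<open>N\<close>, this \<open>K\<^sup>e\<close> is
  orthogonal to itself, which its integer coefficients exclude.

  The upper bounds for ideals come from orders of vanishing: a minor of size \<open>t\<close> vanishes to order
  \<open>t - q\<close> along the matrices of rank at most \<open>q\<close>, the elements of \<open>I\<^sub>\<Sigma>\<^sup>m\<close> therefore vanish there to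
  order \<open>m \<gamma>\<^sub>q\<^sub>+\<^sub>1(\<Sigma>)\<close>, and at a general such matrix \<open>K\<^sup>e\<close> vanishes to order exactly \<open>\<gamma>\<^sub>q\<^sub>+\<^sub>1(e)\<close>
  (\<open>order_ideal_Kprod_bound\<close>). Together with the reduction this also shows that \<open>D\<^sub>p\<close> consists of
  all polynomials vanishing on the matrices of rank less than \<open>p\<close>; in particular it is prime, and
  if \<open>K\<^sup>e\<close> lies in the contraction \<open>I\<^sub>\<Sigma>\<^bsup>(m)\<^esup>\<close> of \<open>I\<^sub>\<Sigma>\<^sup>m\<close> from the local ring at \<open>D\<^sub>p\<close>, then
  \<open>\<gamma>\<^sub>j(e) \<ge> m \<gamma>\<^sub>j(\<Sigma>)\<close> for all \<open>j \<ge> p\<close> (\<open>Kprod_mem_sym_power_bound\<close>).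

  The hypothesis on the Rees valuations gives the converse for ordinary powers up to a constant: if
  \<open>\<gamma>\<^sub>j(e) \<ge> m \<gamma>\<^sub>j(\<Sigma>)\<close> for all \<open>j\<close>, then \<open>K\<^sup>e\<close> is in the integral closure of \<open>I\<^sub>\<Sigma>\<^sup>m\<close>, and since the
  pairs \<open>(e, m)\<close> of this kind form a finitely generated monoid, \<open>K\<^sup>e \<in> I\<^sub>\<Sigma>\<^bsup>m - c\<^esup>\<close> with a constant \<open>c\<close>
  that depends on neither \<open>e\<close> nor \<open>m\<close> (\<open>Kprod_mem_power\<close>).

  What remains is arithmetic. As \<open>(t - j + 1) / (r - j + 1)\<close> decreases with \<open>j\<close> for \<open>t \<le> r\<close>, so do
  \<open>\<gamma>\<^sub>j(e) / (r - j + 1)\<close> and \<open>\<gamma>\<^sub>j(\<Sigma>) / (r - j + 1)\<close>. Hence \<open>K\<^sup>e \<in> I\<^sub>\<Sigma>\<^bsup>(m)\<^esup>\<close> has degree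
  \<open>\<gamma>\<^sub>1(e) \<ge> m r \<gamma>\<^sub>p(\<Sigma>) / (r - p + 1)\<close>, and up to a bounded error this is attained by a power of
  \<open>\<Delta>\<^sub>r\<close>, because \<open>\<Delta>\<^sub>p\<^sub>-\<^sub>1\<close> is invertible in the local ring at \<open>D\<^sub>p\<close> and can be used to repair the
  inequalities for \<open>j < p\<close>. Comparing degrees bounds the resurgence from below; the same convexity
  turns the inequalities \<open>\<gamma>\<^sub>j(e) \<ge> u k \<gamma>\<^sub>j(\<Sigma>)\<close> for \<open>j \<ge> p\<close> into \<open>\<gamma>\<^sub>j(e) \<ge> (v k + c) \<gamma>\<^sub>j(\<Sigma>)\<close> for all
  \<open>j\<close> as soon as \<open>u / v\<close> exceeds the asserted value and \<open>k\<close> is large, which bounds it from above.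
\<close>

(* Scaling is multiplication here, so this rule and associativity would rewrite in a circle. *)
declare ring_mod.scale_scale [simp del]

section \<open>Evaluation homomorphisms\<close>

abbreviation mexp :: "('r \<Rightarrow>\<^sub>0 ('n \<Rightarrow>\<^sub>0 nat)) \<Rightarrow> 'r \<Rightarrow> 'n \<Rightarrow> nat" where
  "mexp m i j \<equiv> Poly_Mapping.lookup (Poly_Mapping.lookup m i) j"

abbreviation msupp :: "('m \<Rightarrow>\<^sub>0 'k::zero) \<Rightarrow> 'm set" where
  "msupp \<equiv> Poly_Mapping.keys"

abbreviation coef :: "('m \<Rightarrow>\<^sub>0 'k::zero) \<Rightarrow> 'm \<Rightarrow> 'k" where
  "coef \<equiv> Poly_Mapping.lookup"

definition var :: "'r \<Rightarrow> 'n \<Rightarrow> ('r::{finite,linorder}, 'n::{finite,linorder}, 'k::field_char_0) matpoly" where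
  "var i j = Poly_Mapping.single (Poly_Mapping.single i (Poly_Mapping.single j 1)) 1"

definition mono_val :: "('r \<Rightarrow> 'n \<Rightarrow> 'b::comm_ring_1) \<Rightarrow> ('r::finite \<Rightarrow>\<^sub>0 ('n::finite \<Rightarrow>\<^sub>0 nat)) \<Rightarrow> 'b" where
  "mono_val Y m = (\<Prod>i\<in>UNIV. \<Prod>j\<in>UNIV. Y i j ^ mexp m i j)"

text \<open>
  Substitutions with values in several rings are needed: in the ring itself for the group action, in
  univariate polynomials over it for derivatives, and in \<open>k[\<tau>][x]\<close> for orders of vanishing.
\<close>

definition peval :: "('k \<Rightarrow> 'b) \<Rightarrow> ('r \<Rightarrow> 'n \<Rightarrow> 'b::comm_ring_1)
    \<Rightarrow> ('r::{finite,linorder}, 'n::{finite,linorder}, 'k::field_char_0) matpoly \<Rightarrow> 'b" where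
  "peval h Y f = (\<Sum>m\<in>msupp f. h (coef f m) * mono_val Y m)"

lemma mexp_eqI: "(\<And>i j. mexp m i j = mexp m' i j) \<Longrightarrow> m = m'"
  by (intro poly_mapping_eqI) auto

lemma mono_val_0 [simp]: "mono_val Y 0 = 1"
  by (simp add: mono_val_def)

lemma mono_val_add: "mono_val Y (m + m') = mono_val Y m * mono_val Y m'"
  by (simp add: mono_val_def lookup_add power_add prod.distrib)

lemma mono_val_single:
  "mono_val Y (Poly_Mapping.single i (Poly_Mapping.single j 1)) = Y i j"
proof -
  have *: "Y a b ^ mexp (Poly_Mapping.single i (Poly_Mapping.single j 1)) a b
      = (if a = i then if b = j then Y i j else 1 else 1)" for a b
    by (auto simp: lookup_single when_def)
  show ?thesis
  proof -
    have "(\<Prod>b\<in>UNIV. if a = i then if b = j then Y i j else 1 else 1) = (if a = i then Y i j else 1)" for a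
      by (cases "a = i") simp_all
    then show ?thesis unfolding mono_val_def * by simp
  qed
qed

lemma matpoly_decompose: "f = (\<Sum>m\<in>msupp f. Poly_Mapping.single m (coef f m))"
  by (rule poly_mapping_eqI)
     (auto simp: lookup_sum lookup_single when_def sum.delta in_keys_iff)

lemma single_eq_const: "Poly_Mapping.single m c = const_poly c * Poly_Mapping.single m 1"
  by (simp add: const_poly_def mult_single)

lemma const_poly_hom: "comm_ring_hom const_poly"
  by unfold_locales (simp_all add: const_poly_def single_add mult_single)

interpretation cp: comm_ring_hom const_poly
  by (rule const_poly_hom)

lemma coef_const_mult: "coef (const_poly c * f) m = c * coef f m"
proof -
  have "const_poly c * f = Poly_Mapping.map ((*) c) f"
    unfolding const_poly_def by (rule mult_map_scale_conv_mult[symmetric])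
  then show ?thesis by (simp add: Poly_Mapping.map.rep_eq when_def)
qed

lemma const_poly_eq_iff [simp]: "const_poly c = const_poly d \<longleftrightarrow> c = d"
  unfolding const_poly_def by (metis lookup_single_eq)

lemma peval_superset:
  assumes "comm_ring_hom h" "finite S" "msupp f \<subseteq> S"
  shows "peval h Y f = (\<Sum>m\<in>S. h (coef f m) * mono_val Y m)"
proof -
  interpret h: comm_ring_hom h by fact
  show ?thesis unfolding peval_def
    by (rule sum.mono_neutral_left) (use assms in \<open>auto simp: in_keys_iff\<close>)
qed

lemma peval_add:
  assumes "comm_ring_hom h"
  shows "peval h Y (f + g) = peval h Y f + peval h Y g"
proof -
  interpret h: comm_ring_hom h by fact
  let ?S = "msupp f \<union> msupp g"
  have "msupp (f + g) \<subseteq> ?S" by (rule keys_add)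
  then show ?thesis
    using assms by (simp add: peval_superset[where S = ?S] lookup_add h.hom_add algebra_simps sum.distrib)
qed

lemma peval_0 [simp]: "peval h Y 0 = 0"
  by (simp add: peval_def)

lemma peval_sum:
  assumes "comm_ring_hom h"
  shows "peval h Y (sum f A) = (\<Sum>a\<in>A. peval h Y (f a))"
  by (induction A rule: infinite_finite_induct) (auto simp: peval_add[OF assms])

lemma peval_single:
  assumes "comm_ring_hom h"
  shows "peval h Y (Poly_Mapping.single m c) = h c * mono_val Y m"
proof -
  interpret h: comm_ring_hom h by fact
  show ?thesis using assms by (subst peval_superset[where S = "{m}"]) auto
qed

lemma peval_mult:
  assumes "comm_ring_hom h"
  shows "peval h Y (f * g) = peval h Y f * peval h Y g"
proof -
  interpret h: comm_ring_hom h by fact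
  have "f * g = (\<Sum>m\<in>msupp f. Poly_Mapping.single m (coef f m))
      * (\<Sum>m'\<in>msupp g. Poly_Mapping.single m' (coef g m'))"
    by (simp only: matpoly_decompose[symmetric])
  also have "\<dots> = (\<Sum>m\<in>msupp f. \<Sum>m'\<in>msupp g.
      Poly_Mapping.single (m + m') (coef f m * coef g m'))"
    by (simp only: sum_product mult_single)
  finally have "peval h Y (f * g) = (\<Sum>m\<in>msupp f. \<Sum>m'\<in>msupp g.
      h (coef f m) * mono_val Y m * (h (coef g m') * mono_val Y m'))"
    by (simp only: peval_sum[OF assms] peval_single[OF assms] h.hom_mult mono_val_add mult.assoc mult.left_commute)
  also have "\<dots> = peval h Y f * peval h Y g"
    by (simp only: peval_def sum_product)
  finally show ?thesis .
qed

lemma peval_hom: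
  assumes "comm_ring_hom h"
  shows "comm_ring_hom (peval h Y)"
proof -
  interpret h: comm_ring_hom h by fact
  show ?thesis
    by unfold_locales
      (use peval_single[OF assms, of Y 0 1] in \<open>auto simp: peval_add[OF assms] peval_mult[OF assms]\<close>)
qed

lemma peval_const: "comm_ring_hom h \<Longrightarrow> peval h Y (const_poly c) = h c"
  by (simp add: const_poly_def peval_single)

lemma peval_var: "comm_ring_hom h \<Longrightarrow> peval h Y (var i j) = Y i j"
proof -
  assume h: "comm_ring_hom h"
  interpret h: comm_ring_hom h by fact
  show ?thesis unfolding var_def by (simp only: peval_single[OF h] mono_val_single h.hom_one mult_1)
qed

lemma single_eq_mono_val: "Poly_Mapping.single m (1::'k::field_char_0) = mono_val var m"
proof -
  have *: "(\<Prod>a\<in>A. Poly_Mapping.single (g a) (1::'k)) = Poly_Mapping.single (\<Sum>a\<in>A. g a) 1"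
    for g :: "'x \<Rightarrow> 'y::comm_monoid_add" and A
    by (induction A rule: infinite_finite_induct) (auto simp: mult_single)
  have pw: "Poly_Mapping.single x (1::'k) ^ k = Poly_Mapping.single (\<Sum>i<k. x) 1"
    for x :: "'y::comm_monoid_add" and k
    by (induction k) (auto simp: mult_single algebra_simps)
  have lk: "mexp (\<Sum>i<k. Poly_Mapping.single a (Poly_Mapping.single b (1::nat))) i j
      = (if a = i then if b = j then k else 0 else 0)" for k :: nat and a :: 'a and b :: 'b and i j
    by (simp add: lookup_sum lookup_single when_def)
  have m: "m = (\<Sum>i\<in>UNIV. \<Sum>j\<in>UNIV. \<Sum>_<mexp m i j. Poly_Mapping.single i (Poly_Mapping.single j 1))"
  proof (rule mexp_eqI)
    fix i j
    have "mexp (\<Sum>i\<in>UNIV. \<Sum>j\<in>UNIV. \<Sum>_<mexp m i j. Poly_Mapping.single i (Poly_Mapping.single j 1)) i j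
      = (\<Sum>a\<in>UNIV. \<Sum>b\<in>UNIV. if a = i then if b = j then mexp m a b else 0 else 0)"
      by (simp only: lookup_sum[of _ UNIV] lk)
    also have "\<dots> = (\<Sum>a\<in>UNIV. if a = i then mexp m a j else 0)"
      by (intro sum.cong refl) simp
    finally show "mexp m i j = mexp (\<Sum>i\<in>UNIV. \<Sum>j\<in>UNIV. \<Sum>_<mexp m i j.
        Poly_Mapping.single i (Poly_Mapping.single j 1)) i j" by simp
  qed
  show ?thesis
    unfolding mono_val_def var_def pw * by (subst m) (rule refl)
qed

lemma matpoly_induct [case_names const var add mult]:
  assumes "\<And>c. P (const_poly c)" and "\<And>i j. P (var i j)"
    and "\<And>f g. P f \<Longrightarrow> P g \<Longrightarrow> P (f + g)" and "\<And>f g. P f \<Longrightarrow> P g \<Longrightarrow> P (f * g)"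
  shows "P f"
proof -
  have one: "P 1" using assms(1)[of 1] by simp
  have zero: "P 0" using assms(1)[of 0] by simp
  have pw: "P g \<Longrightarrow> P (g ^ k)" for g k
    by (induction k) (auto simp: one assms(4))
  have pr: "(\<And>a. P (g a)) \<Longrightarrow> P (\<Prod>a\<in>A. g a)" for g :: "'x \<Rightarrow> _" and A
    by (induction A rule: infinite_finite_induct) (auto simp: one assms(4))
  have sm: "(\<And>a. P (g a)) \<Longrightarrow> P (\<Sum>a\<in>A. g a)" for g :: "'x \<Rightarrow> _" and A
    by (induction A rule: infinite_finite_induct) (auto simp: zero assms(3))
  have "P (Poly_Mapping.single m c)" for m c
    by (subst single_eq_const, subst single_eq_mono_val, unfold mono_val_def)
       (intro assms(4) assms(1) pr pw assms(2))
  then show ?thesis by (subst matpoly_decompose) (rule sm)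
qed

lemma peval_unique:
  assumes "comm_ring_hom \<phi>" and "\<And>c. \<phi> (const_poly c) = h c" and "\<And>i j. \<phi> (var i j) = Y i j"
    and h: "comm_ring_hom h"
  shows "\<phi> f = peval h Y f"
proof -
  interpret p: comm_ring_hom \<phi> by fact
  show ?thesis
    by (induction f rule: matpoly_induct)
       (simp_all add: assms peval_const peval_var peval_add peval_mult p.hom_add p.hom_mult)
qed

lemma hom_peval:
  assumes "comm_ring_hom \<phi>" and h: "comm_ring_hom h"
  shows "\<phi> (peval h Y f) = peval (\<lambda>c. \<phi> (h c)) (\<lambda>i j. \<phi> (Y i j)) f"
proof -
  interpret p: comm_ring_hom \<phi> by fact
  interpret h: comm_ring_hom h by fact
  show ?thesis unfolding peval_def mono_val_def
    by (simp add: p.hom_sum p.hom_mult p.hom_prod p.hom_power)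
qed

lemma hom_comp: "comm_ring_hom f \<Longrightarrow> comm_ring_hom g \<Longrightarrow> comm_ring_hom (\<lambda>x. f (g x))"
proof -
  assume "comm_ring_hom f" "comm_ring_hom g"
  then interpret f: comm_ring_hom f + g: comm_ring_hom g by auto
  show ?thesis by unfold_locales (auto simp: f.hom_add g.hom_add f.hom_mult g.hom_mult)
qed

lemma mat_subst_peval: "mat_subst Y f = peval const_poly (\<lambda>i j. vec_nth (vec_nth Y i) j) f"
  by (simp add: mat_subst_def peval_def mono_val_def)

lemma generic_matrix_nth: "vec_nth (vec_nth generic_matrix i) j = var i j"
  by (simp add: generic_matrix_def var_def)

lemma peval_var_id: "peval const_poly var f = f"
proof -
  have "comm_ring_hom (\<lambda>x::('a,'b,'c) matpoly. x)" by unfold_locales auto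
  from peval_unique[OF this, where h = const_poly and Y = var, symmetric] show ?thesis
    by (simp add: const_poly_hom)
qed

lemma peval_generic_minor:
  assumes "comm_ring_hom h" "length rs = length cs"
  shows "peval h Y (minor rs cs)
    = Determinant.det (Matrix.mat (length cs) (length cs) (\<lambda>(a, b). Y (rs ! a) (cs ! b)))"
proof -
  interpret p: comm_ring_hom "peval h Y" by (rule peval_hom) fact
  show ?thesis unfolding minor_def
    unfolding p.hom_det[symmetric] assms(2)
    by (rule arg_cong[where f = Determinant.det], rule eq_matI)
       (simp_all add: generic_matrix_nth peval_var assms)
qed

section \<open>Polarization operators\<close>

text \<open>
  This is \<open>f(X + t Z)\<close> as a polynomial in \<open>t\<close>. Its linear coefficient is a derivation because
  \<open>dirshift Z\<close> is a ring homomorphism, and its values at scalars \<open>t\<close> relate it to the group action.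
\<close>

definition dirshift :: "('r \<Rightarrow> 'n \<Rightarrow> ('r, 'n, 'k) matpoly) \<Rightarrow> ('r::{finite,linorder}, 'n::{finite,linorder}, 'k::field_char_0) matpoly
    \<Rightarrow> ('r, 'n, 'k) matpoly poly" where
  "dirshift Z f = peval (\<lambda>c. [:const_poly c:]) (\<lambda>i j. [:var i j, Z i j:]) f"

definition dirderiv :: "('r \<Rightarrow> 'n \<Rightarrow> ('r, 'n, 'k) matpoly) \<Rightarrow> ('r::{finite,linorder}, 'n::{finite,linorder}, 'k::field_char_0) matpoly
    \<Rightarrow> ('r, 'n, 'k) matpoly" where
  "dirderiv Z f = poly.coeff (dirshift Z f) 1"

text \<open>
  The action of the elementary matrix \<open>E\<^sub>a\<^sub>b\<close> of the Lie algebra: \<open>\<Sum>\<^sub>j x\<^sub>a\<^sub>j \<partial>/\<partial>x\<^sub>b\<^sub>j\<close>.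
\<close>

definition rowpol :: "'r \<Rightarrow> 'r \<Rightarrow> ('r::{finite,linorder}, 'n::{finite,linorder}, 'k::field_char_0) matpoly \<Rightarrow> ('r, 'n, 'k) matpoly" where
  "rowpol a b = dirderiv (\<lambda>i j. if i = b then var a j else 0)"

definition colpol :: "'n \<Rightarrow> 'n \<Rightarrow> ('r::{finite,linorder}, 'n::{finite,linorder}, 'k::field_char_0) matpoly \<Rightarrow> ('r, 'n, 'k) matpoly" where
  "colpol a b = dirderiv (\<lambda>i j. if j = b then var i a else 0)"

definition partial :: "'r \<Rightarrow> 'n \<Rightarrow> ('r::{finite,linorder}, 'n::{finite,linorder}, 'k::field_char_0) matpoly \<Rightarrow> ('r, 'n, 'k) matpoly" where
  "partial a b = dirderiv (\<lambda>i j. if i = a \<and> j = b then 1 else 0)"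

lemma pCons_const_hom: "comm_ring_hom (\<lambda>c::'a::comm_ring_1. [:c:])"
  by unfold_locales (simp_all add: one_pCons)

lemma poly_at_hom: "comm_ring_hom (\<lambda>p. poly p (x::'a::comm_ring_1))"
  by unfold_locales simp_all

lemma lin_const_hom: "comm_ring_hom (\<lambda>c. [:const_poly c:])"
  by (rule hom_comp[OF pCons_const_hom const_poly_hom])

lemma dirshift_at: "poly (dirshift Z f) x = peval const_poly (\<lambda>i j. var i j + x * Z i j) f"
  unfolding dirshift_def
  by (subst hom_peval[OF poly_at_hom lin_const_hom]) (simp add: algebra_simps)

lemma coeff_dirshift_0: "poly.coeff (dirshift Z f) 0 = f"
  using dirshift_at[of Z f 0] by (simp add: poly_0_coeff_0 peval_var_id)

interpretation lin: comm_ring_hom "\<lambda>c. [:const_poly c:]"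
  by (rule lin_const_hom)

lemma dirderiv_const [simp]: "dirderiv Z (const_poly c) = 0"
  by (simp add: dirderiv_def dirshift_def peval_const[OF lin_const_hom])

lemma dirderiv_0 [simp]: "dirderiv Z 0 = 0"
  by (simp add: dirderiv_def dirshift_def)

lemma dirderiv_1 [simp]: "dirderiv Z 1 = 0"
  using dirderiv_const[of Z 1] by simp

lemma dirderiv_var [simp]: "dirderiv Z (var i j) = Z i j"
  by (simp add: dirderiv_def dirshift_def peval_var[OF lin_const_hom])

lemma dirderiv_add: "dirderiv Z (f + g) = dirderiv Z f + dirderiv Z g"
  by (simp add: dirderiv_def dirshift_def peval_add[OF lin_const_hom])

lemma dirderiv_mult: "dirderiv Z (f * g) = f * dirderiv Z g + dirderiv Z f * g"
proof -
  have "dirshift Z (f * g) = dirshift Z f * dirshift Z g"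
    by (simp add: dirshift_def peval_mult[OF lin_const_hom])
  then show ?thesis
    by (simp add: dirderiv_def coeff_mult coeff_dirshift_0)
qed

lemma dirderiv_cmult: "dirderiv Z (const_poly c * f) = const_poly c * dirderiv Z f"
  by (simp add: dirderiv_mult)

lemma dirderiv_sum: "dirderiv Z (sum f A) = (\<Sum>a\<in>A. dirderiv Z (f a))"
  by (induction A rule: infinite_finite_induct) (simp_all add: dirderiv_add)

lemma sum_mult_delta: "(\<Sum>b\<in>UNIV. g b * (if j = b then 1 else 0)) = (g (j::'x::finite) :: 'b::comm_ring_1)"
proof -
  have "g b * (if j = b then 1 else 0) = (if j = b then g b else 0)" for b by simp
  then show ?thesis by simp
qed

lemma ring_rearrange: "z * (f * a + b * g) = f * (z * a) + z * b * (g::'b::comm_ring_1)"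
  by (simp add: algebra_simps)

lemma dirderiv_eq_partials: "dirderiv Z f = (\<Sum>i\<in>UNIV. \<Sum>j\<in>UNIV. Z i j * partial i j f)"
proof (induction f rule: matpoly_induct)
  case (const c)
  then show ?case by (simp add: partial_def)
next
  case (var i j)
  have *: "(\<Sum>b\<in>UNIV. Z a b * (if i = a \<and> j = b then 1 else 0)) = (if i = a then Z i j else 0)" for a
    using sum_mult_delta[of "Z a" j] by (cases "i = a") simp_all
  show ?case unfolding partial_def dirderiv_var * by simp
next
  case (add f g)
  then show ?case by (simp only: partial_def dirderiv_add distrib_left sum.distrib)
next
  case (mult f g)
  have "Z i j * partial i j (f * g) = f * (Z i j * partial i j g) + Z i j * partial i j f * g" for i j
    unfolding partial_def dirderiv_mult by (rule ring_rearrange)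
  then show ?case
    by (simp only: dirderiv_mult mult.IH sum.distrib sum_distrib_left sum_distrib_right)
qed

lemma rowpol_eq_partials: "rowpol a b f = (\<Sum>j\<in>UNIV. var a j * partial b j f)"
proof -
  have "(\<Sum>j\<in>UNIV. (if i = b then var a j else 0) * partial i j f)
      = (if i = b then \<Sum>j\<in>UNIV. var a j * partial b j f else 0)" for i
    by simp
  then show ?thesis unfolding rowpol_def by (simp add: dirderiv_eq_partials)
qed

lemma colpol_eq_partials: "colpol a b f = (\<Sum>i\<in>UNIV. var i a * partial i b f)"
proof -
  have "(\<Sum>j\<in>UNIV. (if j = b then var i a else 0) * partial i j f) = var i a * partial i b f" for i
  proof -
    have "(if j = b then var i a else 0) * partial i j f = (if j = b then var i a * partial i b f else 0)" for j
      by simp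
    then show ?thesis by simp
  qed
  then show ?thesis unfolding colpol_def by (simp add: dirderiv_eq_partials)
qed

subsection \<open>Coefficients\<close>

definition munit :: "'r \<Rightarrow> 'n \<Rightarrow> ('r \<Rightarrow>\<^sub>0 ('n \<Rightarrow>\<^sub>0 nat))" where
  "munit i j = Poly_Mapping.single i (Poly_Mapping.single j 1)"

lemma var_eq: "var i j = Poly_Mapping.single (munit i j) 1"
  by (simp add: var_def munit_def)

lemma mexp_munit: "mexp (munit i j) a b = (if a = i \<and> b = j then 1 else 0)"
  by (simp add: munit_def lookup_single when_def)

lemma mexp_add: "mexp (m + m') i j = mexp m i j + mexp m' i j"
  by (simp add: lookup_add)

lemma mexp_minus: "mexp (m - m') i j = mexp m i j - mexp m' i j"
  by (simp add: lookup_minus)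

lemmas mexp_simps = mexp_add mexp_minus mexp_munit

lemma coef_var_mult_add: "coef (var i j * f) (m + munit i j) = coef f m"
proof -
  have "var i j * f = (\<Sum>m'\<in>msupp f. Poly_Mapping.single (munit i j + m') (coef f m'))"
    unfolding var_eq by (subst matpoly_decompose[of f]) (simp add: sum_distrib_left mult_single)
  then have "coef (var i j * f) (m + munit i j)
      = (\<Sum>m'\<in>msupp f. if m' = m then coef f m' else 0)"
    by (simp add: lookup_sum lookup_single when_def add.commute)
  also have "\<dots> = coef f m" by (simp add: in_keys_iff)
  finally show ?thesis .
qed

lemma coef_var_mult_zero:
  assumes "mexp m i j = 0" shows "coef (var i j * f) m = 0"
proof -
  have "var i j * f = (\<Sum>m'\<in>msupp f. Poly_Mapping.single (munit i j + m') (coef f m'))"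
    unfolding var_eq by (subst matpoly_decompose[of f]) (simp add: sum_distrib_left mult_single)
  moreover have "munit i j + m' \<noteq> m" for m' using assms by (auto simp: mexp_simps)
  ultimately show ?thesis by (simp add: lookup_sum lookup_single when_def)
qed

lemma munit_minus_add: "mexp m i j > 0 \<Longrightarrow> m - munit i j + munit i j = m"
  by (rule mexp_eqI) (auto simp: mexp_simps)

lemma coef_var_mult:
  "coef (var i j * f) m = (if mexp m i j > 0 then coef f (m - munit i j) else 0)"
  using coef_var_mult_add[of i j f "m - munit i j"] coef_var_mult_zero[of m i j f] munit_minus_add[of m i j]
  by auto

lemma matpoly_monomial_induct [case_names one cmult vmult add]:
  assumes "P 1" and "\<And>c f. P f \<Longrightarrow> P (const_poly c * f)" and "\<And>i j f. P f \<Longrightarrow> P (var i j * f)"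
    and "\<And>f g. P f \<Longrightarrow> P g \<Longrightarrow> P (f + g)"
  shows "P f"
proof -
  have "P g \<Longrightarrow> P (f * g)" for g
    by (induction f arbitrary: g rule: matpoly_induct)
      (simp_all only: distrib_right mult.assoc assms(2-4))
  from this[of 1] show ?thesis using assms(1) by simp
qed

lemma coef_partial: "coef (partial i j f) m = of_nat (mexp m i j + 1) * coef f (m + munit i j)"
proof (induction f arbitrary: m rule: matpoly_monomial_induct)
  case one
  have "m + munit i j \<noteq> 0"
    by (metis Nat.add_0_right add_is_0 lookup_zero mexp_add mexp_munit zero_neq_one)
  then show ?case by (simp add: partial_def lookup_one when_def)
next
  case (cmult c f)
  then show ?case by (simp add: partial_def dirderiv_cmult coef_const_mult)
next
  case (vmult a b f)
  have *: "partial i j (var a b * f) = var a b * partial i j f + (if a = i \<and> b = j then f else 0)"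
    by (simp add: partial_def dirderiv_mult)
  show ?case
  proof (cases "a = i \<and> b = j")
    case True
    have "coef (var i j * partial i j f) m = of_nat (mexp m i j) * coef f m"
      using vmult[of "m - munit i j"]
      by (cases "mexp m i j = 0") (simp_all add: coef_var_mult munit_minus_add mexp_simps)
    then show ?thesis
      unfolding * using True
      by (simp add: lookup_add[of "var _ _ * _"] coef_var_mult_add distrib_right)
  next
    case False
    have 1: "m + munit i j - munit a b = m - munit a b + munit i j" if "0 < mexp m a b"
      by (rule mexp_eqI) (use that False in \<open>auto simp: mexp_simps\<close>)
    have 2: "mexp (m + munit i j) a b = mexp m a b" "mexp (m - munit a b) i j = mexp m i j"
      using False by (auto simp: mexp_simps)
    show ?thesis
      unfolding * coef_var_mult lookup_add[of "var _ _ * _"] 2 using False 1 vmult[of "m - munit a b"]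
      by (auto simp: 2)
  qed
next
  case (add f g)
  then show ?case by (simp add: partial_def dirderiv_add lookup_add[of "dirderiv _ _"] lookup_add[of f] algebra_simps)
qed

text \<open>
  The coefficient of a monomial in \<open>rowpol a b f\<close> collects the monomials of \<open>f\<close> from which it arises by
  moving one factor from row \<open>b\<close> to row \<open>a\<close> inside its column.
\<close>

lemma coef_rowpol:
  assumes "a \<noteq> b"
  shows "coef (rowpol a b f) m =
    (\<Sum>j\<in>UNIV. if mexp m a j > 0 then of_nat (mexp m b j + 1) * coef f (m - munit a j + munit b j) else 0)"
  unfolding rowpol_eq_partials using assms
  by (auto simp: lookup_sum coef_var_mult coef_partial mexp_simps intro!: sum.cong)

lemma coef_colpol:
  assumes "a \<noteq> b"
  shows "coef (colpol a b f) m =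
    (\<Sum>i\<in>UNIV. if mexp m i a > 0 then of_nat (mexp m i b + 1) * coef f (m - munit i a + munit i b) else 0)"
  unfolding colpol_eq_partials using assms
  by (auto simp: lookup_sum coef_var_mult coef_partial mexp_simps intro!: sum.cong)

lemma coef_var_partial: "coef (var i j * partial i j f) m = of_nat (mexp m i j) * coef f m"
  by (cases "mexp m i j = 0") (auto simp: coef_var_mult coef_partial munit_minus_add mexp_simps)

lemma coef_rowpol_diag: "coef (rowpol a a f) m = of_nat (\<Sum>j\<in>UNIV. mexp m a j) * coef f m"
  unfolding rowpol_eq_partials by (simp add: lookup_sum coef_var_partial sum_distrib_right)

lemma coef_colpol_diag: "coef (colpol a a f) m = of_nat (\<Sum>i\<in>UNIV. mexp m i a) * coef f m"
  unfolding colpol_eq_partials by (simp add: lookup_sum coef_var_partial sum_distrib_right)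

section \<open>Polarization-stable subspaces\<close>

text \<open>
  Stability under the Lie algebra. Compared with stability under the group it has the advantage that it
  is tested by derivations, so that the product rule transfers it to powers of ideals.
\<close>

definition stable :: "('r::{finite,linorder}, 'n::{finite,linorder}, 'k::field_char_0) matpoly set \<Rightarrow> bool" where
  "stable A \<longleftrightarrow> 0 \<in> A \<and> (\<forall>f\<in>A. \<forall>g\<in>A. f + g \<in> A) \<and> (\<forall>c. \<forall>f\<in>A. const_poly c * f \<in> A)
     \<and> (\<forall>a b. \<forall>f\<in>A. rowpol a b f \<in> A) \<and> (\<forall>a b. \<forall>f\<in>A. colpol a b f \<in> A)"

lemma stableD:
  assumes "stable A"
  shows "0 \<in> A" "f \<in> A \<Longrightarrow> g \<in> A \<Longrightarrow> f + g \<in> A" "f \<in> A \<Longrightarrow> const_poly c * f \<in> A"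
    "f \<in> A \<Longrightarrow> rowpol a b f \<in> A" "f \<in> A \<Longrightarrow> colpol d e f \<in> A"
  using assms by (auto simp: stable_def)

lemma stable_diff: "stable A \<Longrightarrow> f \<in> A \<Longrightarrow> g \<in> A \<Longrightarrow> f - g \<in> A"
  using stableD(2)[of A f "const_poly (-1) * g"] stableD(3)[of A g "-1"] by (simp add: cp.hom_uminus)

lemma stable_sum: "stable A \<Longrightarrow> (\<And>x. x \<in> S \<Longrightarrow> g x \<in> A) \<Longrightarrow> sum g S \<in> A"
  by (induction S rule: infinite_finite_induct) (auto intro: stableD)

lemma stable_Int: "stable A \<Longrightarrow> stable B \<Longrightarrow> stable (A \<inter> B)"
  by (auto simp: stable_def)

text \<open>
  Divide by \<open>t - c\<^sub>0\<close> for some \<open>c\<^sub>0 \<in> S\<close>: the quotient has smaller degree, and its values at the other elements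
  of \<open>S\<close> are in \<open>A\<close>.
\<close>

lemma coeffs_in_subspace:
  fixes P :: "('r::{finite,linorder}, 'n::{finite,linorder}, 'k::field_char_0) matpoly poly"
  assumes "0 \<in> A" "\<And>f g. f \<in> A \<Longrightarrow> g \<in> A \<Longrightarrow> f + g \<in> A" "\<And>c f. f \<in> A \<Longrightarrow> const_poly c * f \<in> A"
  shows "\<lbrakk>infinite S; \<And>c. c \<in> S \<Longrightarrow> poly P (const_poly c) \<in> A\<rbrakk> \<Longrightarrow> poly.coeff P q \<in> A"
proof (induction "Polynomial.degree P" arbitrary: P q S rule: less_induct)
  case less
  obtain c0 where c0: "c0 \<in> S" using less.prems(1) by fastforce
  have minus: "f - g \<in> A" if "f \<in> A" "g \<in> A" for f g
    using assms(2)[OF that(1) assms(3)[OF that(2), of "-1"]] by (simp add: cp.hom_uminus)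
  show ?case
  proof (cases "Polynomial.degree P = 0")
    case True
    then obtain a where "P = [:a:]" by (rule degree_eq_zeroE)
    then show ?thesis using less.prems(2)[OF c0] assms(1) by (cases q) auto
  next
    case False
    define Q where "Q = synthetic_div P (const_poly c0)"
    have P: "P = [:- const_poly c0, 1:] * Q + [:poly P (const_poly c0):]"
      unfolding Q_def by (rule synthetic_div_correct'[symmetric])
    have Q: "poly.coeff Q q \<in> A" for q
    proof (rule less.hyps)
      show "Polynomial.degree Q < Polynomial.degree P" using False by (simp add: Q_def degree_synthetic_div)
      show "infinite (S - {c0})" using less.prems(1) by simp
      fix c assume c: "c \<in> S - {c0}"
      have "poly P (const_poly c) = const_poly (c - c0) * poly Q (const_poly c) + poly P (const_poly c0)"
        by (subst P) (simp add: cp.hom_minus algebra_simps)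
      then have "const_poly (c - c0) * poly Q (const_poly c) \<in> A"
        using minus[OF less.prems(2)[of c] less.prems(2)[OF c0]] c by simp
      then have "const_poly (inverse (c - c0)) * (const_poly (c - c0) * poly Q (const_poly c)) \<in> A"
        by (rule assms(3))
      then show "poly Q (const_poly c) \<in> A"
        using c by (simp add: mult.assoc[symmetric] cp.hom_mult[symmetric])
    qed
    have "poly.coeff P q = poly.coeff (pCons 0 Q) q - const_poly c0 * poly.coeff Q q
        + poly.coeff [:poly P (const_poly c0):] q"
      by (subst P) simp
    also have "\<dots> \<in> A"
      using assms(1) less.prems(2)[OF c0] Q
      by (intro assms(2) minus assms(3)) (auto simp: coeff_pCons split: nat.splits)
    finally show ?thesis .
  qed
qed

section \<open>Positions and weights\<close>

definition nth_elem :: "nat \<Rightarrow> 'x::{finite,linorder}" where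
  "nth_elem a = sorted_list_of_set UNIV ! a"

text \<open>
  Rows and columns are indexed by different types; the \<open>(i, j)\<close> entry is on the diagonal if
  \<open>pos i = pos j\<close>.
\<close>

definition pos :: "'x::{finite,linorder} \<Rightarrow> nat" where
  "pos x = card {..<x}"

lemma pos_less_card: "pos (x::'x::{finite,linorder}) < CARD('x)"
  unfolding pos_def by (rule psubset_card_mono) auto

lemma pos_less_iff [simp]: "pos x < pos y \<longleftrightarrow> x < y"
proof -
  have "x < y \<Longrightarrow> pos x < pos y" for x y :: 'a
    unfolding pos_def by (rule psubset_card_mono) (auto simp: psubset_eq)
  then show ?thesis by (metis less_asym linorder_neq_iff)
qed

lemma pos_eq_iff [simp]: "pos x = pos y \<longleftrightarrow> x = y"
  by (metis less_irrefl linorder_neq_iff pos_less_iff)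

lemma nth_elem_less:
  assumes "a < b" "b < CARD('x::{finite,linorder})" shows "(nth_elem a :: 'x) < nth_elem b"
  unfolding nth_elem_def using assms
  by (intro sorted_wrt_nth_less[OF strict_sorted_list_of_set]) auto

lemma nth_elem_surj: "\<exists>a<CARD('x). (x::'x::{finite,linorder}) = nth_elem a"
proof -
  have "x \<in> set (sorted_list_of_set UNIV)" by simp
  then show ?thesis unfolding nth_elem_def in_set_conv_nth by auto
qed

lemma nth_elem_inj: "a < CARD('x) \<Longrightarrow> b < CARD('x) \<Longrightarrow> (nth_elem a :: 'x::{finite,linorder}) = nth_elem b \<longleftrightarrow> a = b"
  using nth_elem_less[of a b, where 'x = 'x] nth_elem_less[of b a, where 'x = 'x] by (metis less_irrefl linorder_neq_iff)

lemma pos_nth_elem: "a < CARD('x) \<Longrightarrow> pos (nth_elem a :: 'x::{finite,linorder}) = a"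
proof -
  assume a: "a < CARD('x)"
  have "{..<nth_elem a :: 'x} = nth_elem ` {..<a}"
  proof (intro subset_antisym subsetI)
    fix x :: 'x assume "x \<in> {..<nth_elem a}"
    moreover obtain b where "b < CARD('x)" "x = nth_elem b" using nth_elem_surj[of x] by auto
    ultimately show "x \<in> nth_elem ` {..<a}"
      using nth_elem_less[of a b, where 'x = 'x] a by (metis imageI lessThan_iff less_asym linorder_neqE_nat)
  qed (use a nth_elem_less in auto)
  moreover have "inj_on (nth_elem :: nat \<Rightarrow> 'x) {..<a}"
    using a by (auto intro!: inj_onI simp: nth_elem_inj)
  ultimately show ?thesis unfolding pos_def by (simp add: card_image)
qed

lemma nth_elem_pos [simp]: "nth_elem (pos x) = x"
  using nth_elem_surj[of x] pos_nth_elem by metis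

text \<open>
  Row weights, column weights, the degree, the off-diagonal degree and the height below are all instances
  of this linear function of the exponent matrix.
\<close>

definition wt :: "('r \<Rightarrow> 'n \<Rightarrow> nat) \<Rightarrow> ('r::finite \<Rightarrow>\<^sub>0 ('n::finite \<Rightarrow>\<^sub>0 nat)) \<Rightarrow> nat" where
  "wt w m = (\<Sum>i\<in>UNIV. \<Sum>j\<in>UNIV. w i j * mexp m i j)"

lemma wt_add: "wt w (m + m') = wt w m + wt w m'"
  by (simp add: wt_def mexp_add distrib_left sum.distrib)

lemma wt_munit: "wt w (munit i j) = w i j"
proof -
  have "w a b * mexp (munit i j) a b = (if a = i then if b = j then w i j else 0 else 0)" for a b
    by (simp add: mexp_munit)
  moreover have "(\<Sum>b\<in>UNIV. if a = i then if b = j then w i j else 0 else 0) = (if a = i then w i j else 0)" for a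
    by (cases "a = i") simp_all
  ultimately show ?thesis unfolding wt_def by simp
qed

lemma wt_ge: "w i j * mexp m i j \<le> wt w m"
proof -
  have "w i j * mexp m i j \<le> (\<Sum>j\<in>UNIV. w i j * mexp m i j)"
    by (rule member_le_sum) auto
  also have "\<dots> \<le> wt w m" unfolding wt_def by (rule member_le_sum) auto
  finally show ?thesis .
qed

text \<open>Stated additively since natural number subtraction truncates.\<close>

lemma wt_move:
  assumes "mexp t a b > 0"
  shows "wt w (t - munit a b + munit c d) + w a b = wt w t + w c d"
proof -
  have "t - munit a b + munit a b = t" using assms by (rule munit_minus_add)
  then show ?thesis by (metis (no_types, lifting) add.assoc add.commute wt_add wt_munit)
qed

abbreviation roww :: "'r::finite \<Rightarrow> ('r \<Rightarrow>\<^sub>0 ('n::finite \<Rightarrow>\<^sub>0 nat)) \<Rightarrow> nat" where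
  "roww a \<equiv> wt (\<lambda>i j. if i = a then 1 else 0)"

abbreviation colw :: "'n::finite \<Rightarrow> ('r::finite \<Rightarrow>\<^sub>0 ('n \<Rightarrow>\<^sub>0 nat)) \<Rightarrow> nat" where
  "colw b \<equiv> wt (\<lambda>i j. if j = b then 1 else 0)"

lemma roww_eq: "roww a m = (\<Sum>j\<in>UNIV. mexp m a j)"
proof -
  have "(\<Sum>j\<in>UNIV. (if i = a then 1 else 0) * mexp m i j) = (if i = a then \<Sum>j\<in>UNIV. mexp m a j else 0)" for i
    by simp
  then show ?thesis unfolding wt_def by simp
qed

lemma colw_eq: "colw b m = (\<Sum>i\<in>UNIV. mexp m i b)"
proof -
  have "(if j = b then 1 else 0) * mexp m i j = (if j = b then mexp m i b else 0)" for i j by simp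
  then show ?thesis unfolding wt_def by simp
qed

lemma mon_deg_eq_wt: "mon_deg m = wt (\<lambda>i j. 1) m"
  by (simp add: mon_deg_def wt_def)

lemma wt_split: "wt (\<lambda>i j. u i + v j) m = (\<Sum>i\<in>UNIV. u i * roww i m) + (\<Sum>j\<in>UNIV. v j * colw j m)"
  unfolding roww_eq colw_eq wt_def distrib_right sum.distrib sum_distrib_left
  by (subst (4) sum.swap) simp

lemma keys_rowpol:
  assumes "a \<noteq> b" "m \<in> msupp (rowpol a b f)"
  obtains j where "mexp m a j > 0" "m - munit a j + munit b j \<in> msupp f"
proof -
  have "coef (rowpol a b f) m \<noteq> 0" using assms(2) by (simp add: in_keys_iff)
  then obtain j where "(if mexp m a j > 0 then of_nat (mexp m b j + 1) * coef f (m - munit a j + munit b j) else 0) \<noteq> 0"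
    unfolding coef_rowpol[OF assms(1)] by (rule sum.not_neutral_contains_not_neutral)
  then show thesis by (intro that[of j]) (auto simp: in_keys_iff split: if_splits)
qed

lemma keys_colpol:
  assumes "a \<noteq> b" "m \<in> msupp (colpol a b f)"
  obtains i where "mexp m i a > 0" "m - munit i a + munit i b \<in> msupp f"
proof -
  have "coef (colpol a b f) m \<noteq> 0" using assms(2) by (simp add: in_keys_iff)
  then obtain i where "(if mexp m i a > 0 then of_nat (mexp m i b + 1) * coef f (m - munit i a + munit i b) else 0) \<noteq> 0"
    unfolding coef_colpol[OF assms(1)] by (rule sum.not_neutral_contains_not_neutral)
  then show thesis by (intro that[of i]) (auto simp: in_keys_iff split: if_splits)
qed

definition weight_vector :: "('r::{finite,linorder}, 'n::{finite,linorder}, 'k::field_char_0) matpoly \<Rightarrow> bool" where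
  "weight_vector f \<longleftrightarrow> (\<forall>m\<in>msupp f. \<forall>m'\<in>msupp f.
     (\<forall>a. roww a m = roww a m') \<and> (\<forall>b. colw b m = colw b m'))"

definition raising_killed :: "('r::{finite,linorder}, 'n::{finite,linorder}, 'k::field_char_0) matpoly \<Rightarrow> bool" where
  "raising_killed f \<longleftrightarrow> (\<forall>a b. a < b \<longrightarrow> rowpol a b f = 0) \<and> (\<forall>a b. a < b \<longrightarrow> colpol a b f = 0)"

text \<open>
  All monomials of \<open>rowpol a b f\<close> arise from those of \<open>f\<close> by the same change of weights.
\<close>

lemma weight_vector_rowpol:
  assumes "weight_vector f" "a \<noteq> b"
  shows "weight_vector (rowpol a b f)"
  unfolding weight_vector_def
proof (intro ballI)
  fix m m' assume m: "m \<in> msupp (rowpol a b f)" "m' \<in> msupp (rowpol a b f)"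
  obtain j where j: "mexp m a j > 0" "m - munit a j + munit b j \<in> msupp f"
    using keys_rowpol[OF assms(2) m(1)] by blast
  obtain j' where j': "mexp m' a j' > 0" "m' - munit a j' + munit b j' \<in> msupp f"
    using keys_rowpol[OF assms(2) m(2)] by blast
  note eq = assms(1)[unfolded weight_vector_def, rule_format, OF j(2) j'(2)]
  show "(\<forall>c. roww c m = roww c m') \<and> (\<forall>c. colw c m = colw c m')"
  proof (intro conjI allI)
    fix c show "roww c m = roww c m'"
      using wt_move[OF j(1), of "\<lambda>i j. if i = c then 1 else 0" b j]
        wt_move[OF j'(1), of "\<lambda>i j. if i = c then 1 else 0" b j'] eq by (metis (no_types, lifting) add_right_cancel)
  next
    fix c show "colw c m = colw c m'"
      using wt_move[OF j(1), of "\<lambda>i j. if j = c then 1 else 0" b j]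
        wt_move[OF j'(1), of "\<lambda>i j. if j = c then 1 else 0" b j'] eq by (metis (no_types, lifting) add_right_cancel)
  qed
qed

lemma weight_vector_colpol:
  assumes "weight_vector f" "a \<noteq> b"
  shows "weight_vector (colpol a b f)"
  unfolding weight_vector_def
proof (intro ballI)
  fix m m' assume m: "m \<in> msupp (colpol a b f)" "m' \<in> msupp (colpol a b f)"
  obtain j where j: "mexp m j a > 0" "m - munit j a + munit j b \<in> msupp f"
    using keys_colpol[OF assms(2) m(1)] by blast
  obtain j' where j': "mexp m' j' a > 0" "m' - munit j' a + munit j' b \<in> msupp f"
    using keys_colpol[OF assms(2) m(2)] by blast
  note eq = assms(1)[unfolded weight_vector_def, rule_format, OF j(2) j'(2)]
  show "(\<forall>c. roww c m = roww c m') \<and> (\<forall>c. colw c m = colw c m')"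
  proof (intro conjI allI)
    fix c show "roww c m = roww c m'"
      using wt_move[OF j(1), of "\<lambda>i j. if i = c then 1 else 0" j b]
        wt_move[OF j'(1), of "\<lambda>i j. if i = c then 1 else 0" j' b] eq by (metis (no_types, lifting) add_right_cancel)
  next
    fix c show "colw c m = colw c m'"
      using wt_move[OF j(1), of "\<lambda>i j. if j = c then 1 else 0" j b]
        wt_move[OF j'(1), of "\<lambda>i j. if j = c then 1 else 0" j' b] eq by (metis (no_types, lifting) add_right_cancel)
  qed
qed

section \<open>Highest weight vectors\<close>

text \<open>
  An element with the fewest monomials is a weight vector: the diagonal operators \<open>E\<^sub>a\<^sub>a\<close> multiply every
  monomial by its weight, so if two weights differed, subtracting a scalar multiple of the element from
  its image would remove a monomial without removing all of them.
\<close>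

lemma stable_weight_vector:
  assumes A: "stable A" and f: "f \<in> A" "f \<noteq> 0"
  obtains g where "g \<in> A" "g \<noteq> 0" "weight_vector g"
proof -
  obtain g where g: "g \<in> A" "g \<noteq> 0"
    and min: "\<And>h. h \<in> A \<Longrightarrow> h \<noteq> 0 \<Longrightarrow> card (msupp g) \<le> card (msupp h)"
    using ex_has_least_nat[of "\<lambda>g. g \<in> A \<and> g \<noteq> 0" f "\<lambda>g. card (msupp g)"] f by auto
  have const: "w m = w m'" if "h \<in> A" "\<And>m. coef h m = of_nat (w m) * coef g m"
    "m \<in> msupp g" "m' \<in> msupp g" for h and w :: "_ \<Rightarrow> nat" and m m'
  proof -
    define d where "d = h - const_poly (of_nat (w m')) * g"
    have "d \<in> A" unfolding d_def using A that(1) g(1) by (intro stable_diff stableD)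
    have c: "coef d x = (of_nat (w x) - of_nat (w m')) * coef g x" for x
      unfolding d_def by (simp add: lookup_minus[of h] that(2) coef_const_mult left_diff_distrib)
    have "msupp d \<subseteq> msupp g - {m'}"
      by (auto simp: in_keys_iff c)
    then have "card (msupp d) < card (msupp g)"
      using that(4) by (intro psubset_card_mono) auto
    with min[OF \<open>d \<in> A\<close>] have "d = 0" by force
    then have "coef d m = 0" by simp
    with that(3) show ?thesis unfolding c by (simp add: in_keys_iff)
  qed
  have "weight_vector g"
    unfolding weight_vector_def roww_eq colw_eq
    using const[OF stableD(4)[OF A g(1)] coef_rowpol_diag] const[OF stableD(5)[OF A g(1)] coef_colpol_diag]
    by blast
  with g show thesis by (rule that)
qed

text \<open>
  Operators \<open>E\<^sub>a\<^sub>b\<close> with \<open>a < b\<close>, for rows or columns, strictly increase the height, and the height is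
  bounded in terms of the degree; so raising has to stop.
\<close>

definition height :: "('r::{finite,linorder} \<Rightarrow>\<^sub>0 ('n::{finite,linorder} \<Rightarrow>\<^sub>0 nat)) \<Rightarrow> nat" where
  "height = wt (\<lambda>i j. (CARD('r) - pos i) + (CARD('n) - pos j))"

text \<open>Among the weight vectors one of maximal height is killed by all raising operators.\<close>

lemma stable_highest_weight_vector:
  fixes A :: "('r::{finite,linorder}, 'n::{finite,linorder}, 'k::field_char_0) matpoly set"
  assumes A: "stable A" and f: "f \<in> A" "f \<noteq> 0"
    and D: "\<And>f m. f \<in> A \<Longrightarrow> m \<in> msupp f \<Longrightarrow> mon_deg m \<le> D"
  obtains g where "g \<in> A" "g \<noteq> 0" "weight_vector g" "raising_killed g"
proof -
  define Q where "Q h = (\<exists>g\<in>A. weight_vector g \<and> (\<exists>m\<in>msupp g. height m = h))" for h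
  have bound: "height m \<le> (CARD('r) + CARD('n)) * mon_deg m" for m :: "'r \<Rightarrow>\<^sub>0 ('n \<Rightarrow>\<^sub>0 nat)"
    unfolding height_def mon_deg_eq_wt wt_def sum_distrib_left
    by (intro sum_mono) (simp add: add_mono)
  obtain g0 where g0: "g0 \<in> A" "g0 \<noteq> 0" "weight_vector g0"
    using stable_weight_vector[OF A f] by blast
  then obtain m0 where "m0 \<in> msupp g0" by fastforce
  then have "Q (height m0)" unfolding Q_def using g0 by blast
  moreover have "h \<le> (CARD('r) + CARD('n)) * D" if "Q h" for h
  proof -
    from that obtain g m where g: "g \<in> A" "m \<in> msupp g" "height m = h"
      unfolding Q_def by blast
    have "height m \<le> (CARD('r) + CARD('n)) * mon_deg m" by (rule bound)
    also have "\<dots> \<le> (CARD('r) + CARD('n)) * D" by (rule mult_le_mono2[OF D[OF g(1,2)]])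
    finally show ?thesis by (simp add: g)
  qed
  ultimately obtain h where h: "Q h" and max: "\<And>h'. Q h' \<Longrightarrow> h' \<le> h"
    using Nat.ex_has_greatest_nat[of Q "height m0" "(CARD('r) + CARD('n)) * D"] by auto
  from h obtain g m where g: "g \<in> A" "weight_vector g" "m \<in> msupp g" "height m = h"
    unfolding Q_def by blast
  have same: "height m' = h" if "m' \<in> msupp g" for m'
  proof -
    have "height m' = height m"
      unfolding height_def wt_split
      using g(2)[unfolded weight_vector_def, rule_format, OF that g(3)] by (simp only:)
    with g(4) show ?thesis by simp
  qed
  have "rowpol a b g = 0" if "a < b" for a b
  proof (rule ccontr)
    assume nz: "rowpol a b g \<noteq> 0"
    then obtain m' where m': "m' \<in> msupp (rowpol a b g)" by fastforce
    have "a \<noteq> b" using that by simp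
    then obtain j where j: "mexp m' a j > 0" "m' - munit a j + munit b j \<in> msupp g"
      using keys_rowpol m' by blast
    have "Q (height m')" unfolding Q_def
      using m' stableD(4)[OF A g(1)] weight_vector_rowpol[OF g(2) \<open>a \<noteq> b\<close>] by blast
    then have "height m' \<le> h" by (rule max)
    moreover have "pos a < pos b" "pos b < CARD('r)" using that pos_less_card[of b] by auto
    ultimately show False using same[OF j(2)]
        wt_move[OF j(1), of "\<lambda>i j. (CARD('r) - pos i) + (CARD('n) - pos j)" b j]
      unfolding height_def by linarith
  qed
  moreover have "colpol a b g = 0" if "a < b" for a b
  proof (rule ccontr)
    assume nz: "colpol a b g \<noteq> 0"
    then obtain m' where m': "m' \<in> msupp (colpol a b g)" by fastforce
    have "a \<noteq> b" using that by simp
    then obtain j where j: "mexp m' j a > 0" "m' - munit j a + munit j b \<in> msupp g"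
      using keys_colpol m' by blast
    have "Q (height m')" unfolding Q_def
      using m' stableD(5)[OF A g(1)] weight_vector_colpol[OF g(2) \<open>a \<noteq> b\<close>] by blast
    then have "height m' \<le> h" by (rule max)
    moreover have "pos a < pos b" "pos b < CARD('n)" using that pos_less_card[of b] by auto
    ultimately show False using same[OF j(2)]
        wt_move[OF j(1), of "\<lambda>i j. (CARD('r) - pos i) + (CARD('n) - pos j)" j b]
      unfolding height_def by linarith
  qed
  moreover have "g \<noteq> 0" using g(3) by auto
  ultimately show thesis using g that unfolding raising_killed_def by blast
qed

abbreviation offdiag :: "('r::{finite,linorder} \<Rightarrow>\<^sub>0 ('n::{finite,linorder} \<Rightarrow>\<^sub>0 nat)) \<Rightarrow> nat" where
  "offdiag \<equiv> wt (\<lambda>i j. if pos i = pos j then 0 else 1)"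

text \<open>
  Take a monomial of least off-diagonal degree and suppose that it contains an off-diagonal variable.
  The raising operator that moves this variable to the diagonal in its own column (if it is below the
  diagonal) or row (if it is above) yields a monomial of smaller off-diagonal degree. Any other source
  of that monomial would have less than the minimal off-diagonal degree, so its coefficient is a nonzero
  multiple of the given one, although the operator kills \<open>f\<close>.
\<close>

lemma raising_killed_diagonal_term:
  fixes f :: "('r::{finite,linorder}, 'n::{finite,linorder}, 'k::field_char_0) matpoly"
  assumes "raising_killed f" "f \<noteq> 0"
  obtains m where "m \<in> msupp f" "offdiag m = 0"
proof -
  obtain m0 where "m0 \<in> msupp f" using assms(2) by fastforce
  then obtain m where m: "m \<in> msupp f"
    and min: "\<And>m'. m' \<in> msupp f \<Longrightarrow> offdiag m \<le> offdiag m'"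
    using ex_has_least_nat[of "\<lambda>m. m \<in> msupp f" m0 offdiag] by auto
  let ?o = "\<lambda>i j. if pos i = pos j then 0 else 1 :: nat"
  have zero: "coef f m' = 0" if "offdiag m' < offdiag m" for m'
    using min[of m'] that by (auto simp: in_keys_iff)
  have "offdiag m = 0"
  proof (rule ccontr)
    assume "offdiag m \<noteq> 0"
    then obtain i j where ij: "pos i \<noteq> pos j" "mexp m i j > 0"
      unfolding wt_def by (auto simp: sum_eq_0_iff split: if_splits)
    show False
    proof (cases "pos j < pos i")
      case True
      define a :: 'r where "a = nth_elem (pos j)"
      have a: "pos a = pos j" unfolding a_def using True pos_less_card[of i] by (intro pos_nth_elem) simp
      then have "a < i" using True by (simp only: pos_less_iff[symmetric])
      define t where "t = m - munit i j + munit a j"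
      have t: "offdiag t + 1 = offdiag m"
        using wt_move[OF ij(2), of ?o a j] a ij(1) by (simp add: t_def)
      have bk: "t - munit a j + munit i j = m"
        by (rule mexp_eqI) (use ij(2) in \<open>auto simp: t_def mexp_simps\<close>)
      have "0 = coef (rowpol a i f) t"
        using assms(1) \<open>a < i\<close> by (simp add: raising_killed_def)
      also have "\<dots> = (\<Sum>j'\<in>UNIV. if j' = j then of_nat (mexp t i j + 1) * coef f m else 0)"
        unfolding coef_rowpol[OF less_imp_neq[OF \<open>a < i\<close>]]
      proof (intro sum.cong refl)
        fix j'
        show "(if mexp t a j' > 0 then of_nat (mexp t i j' + 1) * coef f (t - munit a j' + munit i j') else 0)
            = (if j' = j then of_nat (mexp t i j + 1) * coef f m else 0)"
        proof (cases "j' = j")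
          case True
          have "mexp t a j > 0" by (simp add: t_def mexp_simps)
          with True show ?thesis by (simp add: bk)
        next
          case False
          then have "pos a \<noteq> pos j'" by (simp add: a)
          then have "mexp t a j' > 0 \<Longrightarrow> offdiag (t - munit a j' + munit i j') < offdiag m"
            using wt_move[of t a j' ?o i j'] t by (auto split: if_splits)
          with False show ?thesis using zero by auto
        qed
      qed
      also have "\<dots> = of_nat (mexp t i j + 1) * coef f m" by simp
      finally show False using m by (simp add: in_keys_iff del: of_nat_Suc of_nat_add)
    next
      case False
      then have lt: "pos i < pos j" using ij by simp
      define a :: 'n where "a = nth_elem (pos i)"
      have a: "pos a = pos i" unfolding a_def using lt pos_less_card[of j] by (intro pos_nth_elem) simp
      then have "a < j" using lt by (simp only: pos_less_iff[symmetric])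
      define t where "t = m - munit i j + munit i a"
      have t: "offdiag t + 1 = offdiag m"
        using wt_move[OF ij(2), of ?o i a] a ij(1) by (simp add: t_def)
      have bk: "t - munit i a + munit i j = m"
        by (rule mexp_eqI) (use ij(2) in \<open>auto simp: t_def mexp_simps\<close>)
      have "0 = coef (colpol a j f) t"
        using assms(1) \<open>a < j\<close> by (simp add: raising_killed_def)
      also have "\<dots> = (\<Sum>i'\<in>UNIV. if i' = i then of_nat (mexp t i j + 1) * coef f m else 0)"
        unfolding coef_colpol[OF less_imp_neq[OF \<open>a < j\<close>]]
      proof (intro sum.cong refl)
        fix i'
        show "(if mexp t i' a > 0 then of_nat (mexp t i' j + 1) * coef f (t - munit i' a + munit i' j) else 0)
            = (if i' = i then of_nat (mexp t i j + 1) * coef f m else 0)"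
        proof (cases "i' = i")
          case True
          have "mexp t i a > 0" by (simp add: t_def mexp_simps)
          with True show ?thesis by (simp add: bk)
        next
          case False
          then have "pos i' \<noteq> pos a" by (simp add: a)
          then have "mexp t i' a > 0 \<Longrightarrow> offdiag (t - munit i' a + munit i' j) < offdiag m"
            using wt_move[of t i' a ?o i' j] t by (auto split: if_splits)
          with False show ?thesis using zero by auto
        qed
      qed
      also have "\<dots> = of_nat (mexp t i j + 1) * coef f m" by simp
      finally show False using m by (simp add: in_keys_iff del: of_nat_Suc of_nat_add)
    qed
  qed
  with m show thesis by (rule that)
qed

lemma diagonal_monomial_eq:
  assumes "offdiag m = 0" "offdiag m' = 0" "\<And>a. roww a m = roww a m'"
  shows "m = m'"
proof (rule mexp_eqI)
  fix i j
  have off: "mexp x i j = 0" if "offdiag x = 0" "pos i \<noteq> pos j" for x :: "'a \<Rightarrow>\<^sub>0 ('b \<Rightarrow>\<^sub>0 nat)" and i j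
    using wt_ge[of "\<lambda>i j. if pos i = pos j then 0 else 1" i j x] that by simp
  have row: "roww i x = mexp x i j" if "offdiag x = 0" "pos i = pos j" for x :: "'a \<Rightarrow>\<^sub>0 ('b \<Rightarrow>\<^sub>0 nat)"
  proof -
    have "mexp x i j' = (if j' = j then mexp x i j else 0)" for j'
      using off[OF that(1), of i j'] that(2) by (metis pos_eq_iff)
    then have "(\<Sum>j'\<in>UNIV. mexp x i j') = (\<Sum>j'\<in>UNIV. if j' = j then mexp x i j else 0)"
      by (intro sum.cong refl)
    then show ?thesis unfolding roww_eq by simp
  qed
  show "mexp m i j = mexp m' i j"
    using off row assms by (metis (no_types, lifting))
qed

text \<open>
  A highest weight vector is determined up to a scalar by its row weights: these determine the only
  diagonal monomial that can occur, and a linear combination in which it cancels is zero by the preceding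
  lemma.
\<close>

lemma raising_killed_proportional:
  fixes f g :: "('r::{finite,linorder}, 'n::{finite,linorder}, 'k::field_char_0) matpoly"
  assumes f: "raising_killed f" and g: "raising_killed g" "g \<noteq> 0"
    and wts: "\<And>m m' a. m \<in> msupp f \<union> msupp g
      \<Longrightarrow> m' \<in> msupp f \<union> msupp g \<Longrightarrow> roww a m = roww a m'"
  obtains c where "f = const_poly c * g"
proof -
  obtain m where m: "m \<in> msupp g" "offdiag m = 0"
    using raising_killed_diagonal_term[OF g] by blast
  define c where "c = coef f m / coef g m"
  define d where "d = f - const_poly c * g"
  have d: "coef d x = coef f x - c * coef g x" for x
    by (simp add: d_def lookup_minus[of f] coef_const_mult)
  have d': "d = f + const_poly (- c) * g" by (simp add: d_def cp.hom_uminus)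
  have "raising_killed d"
    using f g(1) unfolding raising_killed_def d'
    by (simp add: rowpol_def colpol_def dirderiv_add dirderiv_cmult)
  have "d = 0"
  proof (rule ccontr)
    assume "d \<noteq> 0"
    then obtain x where x: "x \<in> msupp d" "offdiag x = 0"
      using raising_killed_diagonal_term[OF \<open>raising_killed d\<close>] by blast
    then have "x \<in> msupp f \<union> msupp g" by (auto simp: in_keys_iff d)
    then have "x = m" using m x by (intro diagonal_monomial_eq) (auto intro: wts)
    then have "coef d x = 0" using m unfolding d by (simp add: c_def in_keys_iff)
    with x show False by (simp add: in_keys_iff)
  qed
  then show thesis by (intro that[of c]) (simp add: d_def)
qed

text \<open>
  The equation \<open>E\<^sub>a\<^sub>b f = 0\<close> is used on the \<open>2 \<times> 2\<close> square of the matrix formed by the rows \<open>a < b\<close> and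
  the corresponding columns. If \<open>u\<close>, \<open>v\<close> are the exponents of the diagonal entries of the square in the
  given monomial, the coefficient \<open>c\<^sub>q\<close> of the monomial where \<open>q\<close> units have been moved from each of them
  to the other diagonal satisfies \<open>(v - q) c\<^sub>q + (q + 1) c\<^sub>q\<^sub>+\<^sub>1 = 0\<close> for \<open>q < u\<close>, and \<open>(v - u) c\<^sub>u = 0\<close> at the
  end. If \<open>u < v\<close>, this forces \<open>c\<^sub>0 = 0\<close>.
\<close>

lemma raising_killed_dominant:
  fixes f :: "('r::{finite,linorder}, 'n::{finite,linorder}, 'k::field_char_0) matpoly"
  assumes rn: "CARD('r) \<le> CARD('n)"
    and f: "raising_killed f" and m: "m \<in> msupp f" "offdiag m = 0" and ab: "a < b"
  shows "roww b m \<le> roww a m"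
proof (rule ccontr)
  assume "\<not> roww b m \<le> roww a m"
  define ja :: 'n where "ja = nth_elem (pos a)"
  define jb :: 'n where "jb = nth_elem (pos b)"
  have pos_ja: "pos ja = pos a" unfolding ja_def using pos_less_card[of a] rn by (intro pos_nth_elem) linarith
  have pos_jb: "pos jb = pos b" unfolding jb_def using pos_less_card[of b] rn by (intro pos_nth_elem) linarith
  have "a \<noteq> b" using ab by simp
  then have "ja \<noteq> jb" using pos_ja pos_jb by (metis pos_eq_iff)
  have off: "mexp m i j = 0" if "pos i \<noteq> pos j" for i j
    using wt_ge[of "\<lambda>i j. if pos i = pos j then 0 else 1" i j m] that m(2) by simp
  have row: "roww i m = mexp m i j" if "pos i = pos j" for i j
  proof -
    have "mexp m i j' = (if j' = j then mexp m i j else 0)" for j'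
      using off[of i j'] that by (metis pos_eq_iff)
    then have "(\<Sum>j'\<in>UNIV. mexp m i j') = (\<Sum>j'\<in>UNIV. if j' = j then mexp m i j else 0)"
      by (intro sum.cong refl)
    then show ?thesis unfolding roww_eq by simp
  qed
  define u v where "u = mexp m a ja" and "v = mexp m b jb"
  have uv: "u < v" using \<open>\<not> roww b m \<le> roww a m\<close> row[of a ja] row[of b jb] pos_ja pos_jb
    by (simp add: u_def v_def)
  define E where "E i j q = (if i = a \<and> j = ja then u - q else if i = b \<and> j = jb then v - q
    else if (i = a \<and> j = jb) \<or> (i = b \<and> j = ja) then q else mexp m i j)" for i j and q :: nat
  \<comment> \<open>\<open>M q\<close> has exponents \<open>u - q\<close>, \<open>q\<close>, \<open>q\<close>, \<open>v - q\<close> in the square with rows \<open>a\<close>, \<open>b\<close>\<close>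
  define M where "M q = m - (\<Sum>_<q. munit a ja) - (\<Sum>_<q. munit b jb)
     + (\<Sum>_<q. munit a jb) + (\<Sum>_<q. munit b ja)" for q :: nat
  have lk: "mexp (\<Sum>_<q. munit i j) x y = (if x = i \<and> y = j then q else 0)" for q :: nat and i :: 'r and j :: 'n and x y
    by (simp add: lookup_sum mexp_munit)
  have z: "mexp m a jb = 0" "mexp m b ja = 0"
    using off[of a jb] off[of b ja] pos_ja pos_jb \<open>a \<noteq> b\<close> by auto
  have M: "mexp (M q) i j = E i j q" for q i j
    using \<open>ja \<noteq> jb\<close> \<open>a \<noteq> b\<close> z by (auto simp: M_def mexp_add mexp_minus lk E_def u_def v_def)
  have M0: "M 0 = m" by (rule mexp_eqI) (auto simp: M E_def u_def v_def z)
  have rec: "of_nat (v - q) * coef f (M q) + (if q < u then of_nat (q + 1) * coef f (M (Suc q)) else 0) = 0"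
    if q: "q \<le> u" for q
  proof -
    define t where "t = M q - munit b jb + munit a jb"
    have t: "mexp t i j = (if i = b \<and> j = jb then v - q - 1 else if i = a \<and> j = jb then q + 1 else E i j q)" for i j
      using \<open>ja \<noteq> jb\<close> \<open>a \<noteq> b\<close> by (auto simp: t_def mexp_simps M E_def)
    have t1: "t - munit a jb + munit b jb = M q"
      by (rule mexp_eqI) (use \<open>ja \<noteq> jb\<close> \<open>a \<noteq> b\<close> uv q in \<open>auto simp: mexp_add mexp_minus mexp_munit t M E_def\<close>)
    have t2: "t - munit a ja + munit b ja = M (Suc q)"
      by (rule mexp_eqI) (use \<open>ja \<noteq> jb\<close> \<open>a \<noteq> b\<close> uv q in \<open>auto simp: mexp_add mexp_minus mexp_munit t M E_def\<close>)
    let ?s = "\<lambda>j. if mexp t a j > 0 then of_nat (mexp t b j + 1) * coef f (t - munit a j + munit b j) else 0"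
    have "0 = coef (rowpol a b f) t" using f ab by (simp add: raising_killed_def)
    also have "\<dots> = (\<Sum>j\<in>UNIV. ?s j)" by (rule coef_rowpol) fact
    also have "\<dots> = (\<Sum>j\<in>{ja, jb}. ?s j)"
    proof (rule sum.mono_neutral_right)
      show "\<forall>j\<in>UNIV - {ja, jb}. ?s j = 0"
      proof
        fix j assume j: "j \<in> UNIV - {ja, jb}"
        then have "pos ja \<noteq> pos j" by auto
        then have "mexp m a j = 0" by (intro off) (simp add: pos_ja)
        then have "mexp t a j = 0" using j \<open>a \<noteq> b\<close> by (simp add: t E_def)
        then show "?s j = 0" by simp
      qed
    qed auto
    also have "\<dots> = ?s ja + ?s jb" using \<open>ja \<noteq> jb\<close> by simp
    also have "?s jb = of_nat (v - q) * coef f (M q)"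
    proof -
      have "mexp t a jb > 0" "mexp t b jb + 1 = v - q" using uv q \<open>a \<noteq> b\<close> by (auto simp: t)
      then show ?thesis by (simp only: t1 if_True)
    qed
    also have "?s ja = (if q < u then of_nat (q + 1) * coef f (M (Suc q)) else 0)"
    proof -
      have "mexp t a ja = u - q" "mexp t b ja = q" using \<open>ja \<noteq> jb\<close> \<open>a \<noteq> b\<close> by (auto simp: t E_def)
      then show ?thesis by (simp only: t2 zero_less_diff)
    qed
    finally show ?thesis by (simp add: add.commute)
  qed
  have "q \<le> u \<Longrightarrow> coef f (M q) \<noteq> 0" for q
  proof (induction q)
    case 0
    then show ?case using m by (simp add: M0 in_keys_iff)
  next
    case (Suc q)
    then have "coef f (M q) \<noteq> 0" "q < u" by auto
    moreover have "(of_nat (v - q) :: 'k) \<noteq> 0" using uv \<open>q < u\<close> by (simp del: of_nat_diff)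
    ultimately show ?case using rec[of q] by (auto simp del: of_nat_diff)
  qed
  then have "coef f (M u) \<noteq> 0" by simp
  moreover have "(of_nat (v - u) :: 'k) \<noteq> 0" using uv by (simp del: of_nat_diff)
  ultimately show False using rec[of u] by (simp del: of_nat_diff)
qed

section \<open>The apolar bilinear form\<close>

definition mfact :: "('r::finite \<Rightarrow>\<^sub>0 ('n::finite \<Rightarrow>\<^sub>0 nat)) \<Rightarrow> nat" where
  "mfact m = (\<Prod>i\<in>UNIV. \<Prod>j\<in>UNIV. fact (mexp m i j))"

text \<open>
  This is \<open>f(\<partial>) g\<close> at the origin, also known as the Fischer inner product. It is chosen because
  multiplication by a variable is adjoint to the partial derivative, so that \<open>E\<^sub>a\<^sub>b\<close> is adjoint to \<open>E\<^sub>b\<^sub>a\<close>.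
\<close>

definition form :: "('r::{finite,linorder}, 'n::{finite,linorder}, 'k::field_char_0) matpoly \<Rightarrow> ('r, 'n, 'k) matpoly \<Rightarrow> 'k" where
  "form f g = (\<Sum>m\<in>msupp f. coef f m * coef g m * of_nat (mfact m))"

lemma mfact_pos: "mfact m > 0"
  by (simp add: mfact_def)

lemma mfact_munit: "mfact (m + munit i j) = (mexp m i j + 1) * mfact m"
proof -
  have "fact (mexp (m + munit i j) a b) = (if a = i then if b = j then mexp m i j + 1 else 1 else 1) * (fact (mexp m a b) :: nat)" for a b
    by (auto simp: mexp_simps)
  moreover have "(\<Prod>b\<in>UNIV. (if a = i then if b = j then mexp m i j + 1 else 1 else 1)) = (if a = i then mexp m i j + 1 else 1)" for a
    by (cases "a = i") simp_all
  ultimately show ?thesis by (simp add: mfact_def prod.distrib)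
qed

lemma form_superset:
  assumes "finite S" "msupp f \<subseteq> S"
  shows "form f g = (\<Sum>m\<in>S. coef f m * coef g m * of_nat (mfact m))"
  unfolding form_def by (rule sum.mono_neutral_left) (use assms in \<open>auto simp: in_keys_iff\<close>)

lemma form_commute: "form f g = form g f"
  using form_superset[of "msupp f \<union> msupp g" f g]
    form_superset[of "msupp f \<union> msupp g" g f]
  by (simp add: mult.commute)

lemma form_add_right: "form f (g + h) = form f g + form f h"
  by (simp add: form_def lookup_add[of g] distrib_left distrib_right sum.distrib)

lemma form_cmult_right: "form f (const_poly c * g) = c * form f g"
  unfolding form_def coef_const_mult sum_distrib_left by (intro sum.cong refl) (simp add: algebra_simps)

lemma form_0_right [simp]: "form f 0 = 0"
  by (simp add: form_def)

lemma form_sum_right: "form f (sum g A) = (\<Sum>a\<in>A. form f (g a))"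
  by (induction A rule: infinite_finite_induct) (simp_all add: form_add_right)

lemma form_add_left: "form (g + h) f = form g f + form h f"
  using form_add_right[of f g h] by (simp add: form_commute)

lemma form_cmult_left: "form (const_poly c * g) f = c * form g f"
  using form_cmult_right[of f c g] by (simp add: form_commute)

lemma form_0_left [simp]: "form 0 f = 0"
  by (simp add: form_def)

lemma form_sum_left: "form (sum g A) f = (\<Sum>a\<in>A. form (g a) f)"
  using form_sum_right[of f g A] by (simp add: form_commute)

lemma form_var_adjoint: "form (var i j * f) g = form f (partial i j g)"
proof -
  let ?S = "(\<lambda>m. m + munit i j) ` msupp f"
  have "msupp (var i j * f) \<subseteq> ?S"
  proof
    fix m assume "m \<in> msupp (var i j * f)"
    then have "mexp m i j > 0" "m - munit i j \<in> msupp f"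
      by (auto simp: in_keys_iff coef_var_mult split: if_splits)
    then show "m \<in> ?S" using munit_minus_add[of m i j] by (metis imageI)
  qed
  then have "form (var i j * f) g = (\<Sum>m\<in>?S. coef (var i j * f) m * coef g m * of_nat (mfact m))"
    by (intro form_superset) auto
  also have "\<dots> = (\<Sum>m\<in>msupp f. coef f m * coef g (m + munit i j) * of_nat (mfact (m + munit i j)))"
    by (subst sum.reindex) (auto intro!: inj_onI simp: coef_var_mult_add)
  also have "\<dots> = form f (partial i j g)"
    unfolding form_def coef_partial mfact_munit by (intro sum.cong refl) (simp add: algebra_simps)
  finally show ?thesis .
qed

lemma form_partial_adjoint: "form (partial i j f) g = form f (var i j * g)"
  using form_var_adjoint[of i j g f] by (simp add: form_commute)

lemma form_rowpol: "form (rowpol a b f) g = form f (rowpol b a g)"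
  by (simp add: rowpol_eq_partials form_sum_left form_sum_right form_var_adjoint form_partial_adjoint)

lemma form_colpol: "form (colpol a b f) g = form f (colpol b a g)"
  by (simp add: colpol_eq_partials form_sum_left form_sum_right form_var_adjoint form_partial_adjoint)

text \<open>
  The form is positive definite over the rationals but may have isotropic vectors over \<open>k\<close>. Integer
  coefficients keep the argument inside the integers.
\<close>

lemma form_integral_nonzero:
  fixes f :: "('r::{finite,linorder}, 'n::{finite,linorder}, 'k::field_char_0) matpoly"
  assumes "\<And>m. coef f m \<in> \<int>" "f \<noteq> 0"
  shows "form f f \<noteq> 0"
proof -
  have "\<forall>m. \<exists>z. coef f m = of_int z" using assms(1) by (meson Ints_cases)
  then obtain z where z: "coef f m = of_int (z m)" for m by metis
  have *: "form f f = of_int (\<Sum>m\<in>msupp f. z m * z m * int (mfact m))"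
    unfolding form_def by (simp add: z)
  have "z m * z m * int (mfact m) > 0" if "m \<in> msupp f" for m
  proof -
    have "z m \<noteq> 0" using that z[of m] by (auto simp: in_keys_iff)
    then show ?thesis using mfact_pos[of m] by (auto intro!: mult_pos_pos simp: zero_less_mult_iff)
  qed
  moreover have "msupp f \<noteq> {}" using assms(2) by simp
  ultimately have "(\<Sum>m\<in>msupp f. z m * z m * int (mfact m)) > 0"
    by (intro sum_pos) auto
  then show ?thesis unfolding * by (metis less_irrefl of_int_eq_0_iff)
qed

lemma stable_orthogonal:
  assumes "stable A" "stable N"
  shows "stable {f\<in>A. \<forall>g\<in>N. form f g = 0}"
  using assms unfolding stable_def
  by (auto simp: form_add_left form_cmult_left form_rowpol form_colpol)

text \<open>
  A linear form that vanishes on the common kernel of finitely many linear forms is a combination of them: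
  restrict to the kernel of one of them and use induction.
\<close>

lemma common_kernel:
  fixes L :: "'b \<Rightarrow> ('r::{finite,linorder}, 'n::{finite,linorder}, 'k::field_char_0) matpoly \<Rightarrow> 'k"
  assumes "finite B"
    and "\<And>x y. x \<in> V \<Longrightarrow> y \<in> V \<Longrightarrow> x + y \<in> V" "\<And>c x. x \<in> V \<Longrightarrow> const_poly c * x \<in> V"
    and "\<And>b x y. L b (x + y) = L b x + L b y" "\<And>b c x. L b (const_poly c * x) = c * L b x"
    and "\<And>x y. \<psi> (x + y) = \<psi> x + \<psi> y" "\<And>c x. \<psi> (const_poly c * x) = c * \<psi> x"
    and "\<And>x. x \<in> V \<Longrightarrow> (\<forall>b\<in>B. L b x = 0) \<Longrightarrow> \<psi> x = 0"
  shows "\<exists>c. \<forall>x\<in>V. \<psi> x = (\<Sum>b\<in>B. c b * L b x)"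
  using assms
proof (induction B arbitrary: V rule: finite_induct)
  case empty
  then show ?case by simp
next
  case (insert b B)
  define V' where "V' = {x\<in>V. L b x = 0}"
  have "\<exists>c. \<forall>x\<in>V'. \<psi> x = (\<Sum>b\<in>B. c b * L b x)"
    by (rule insert.IH) (use insert.prems in \<open>auto simp: V'_def\<close>)
  then obtain c where c: "\<And>x. x \<in> V' \<Longrightarrow> \<psi> x = (\<Sum>b\<in>B. c b * L b x)" by blast
  show ?case
  proof (cases "\<exists>x0\<in>V. L b x0 \<noteq> 0")
    case False
    then have "V' = V" by (auto simp: V'_def)
    then have "\<forall>x\<in>V. \<psi> x = (\<Sum>a\<in>insert b B. (c(b := 0)) a * L a x)"
      using insert.hyps c by (auto simp: sum.insert intro!: sum.cong)
    then show ?thesis by blast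
  next
    case True
    then obtain x0 where x0: "x0 \<in> V" "L b x0 \<noteq> 0" by blast
    define \<delta> where "\<delta> x = \<psi> x - (\<Sum>a\<in>B. c a * L a x)" for x
    define e where "e = \<delta> x0 / L b x0"
    have "\<psi> x = (\<Sum>a\<in>insert b B. (c(b := e)) a * L a x)" if x: "x \<in> V" for x
    proof -
      define s where "s = - (L b x / L b x0)"
      have "L b (x + const_poly s * x0) = 0"
        unfolding insert.prems s_def using x0 by simp
      then have "x + const_poly s * x0 \<in> V'"
        using insert.prems(1,2) x x0(1) by (simp add: V'_def)
      then have "\<delta> (x + const_poly s * x0) = 0" by (simp add: \<delta>_def c)
      also have "\<delta> (x + const_poly s * x0) = \<delta> x + s * \<delta> x0"
        unfolding \<delta>_def insert.prems by (simp add: algebra_simps sum.distrib sum_distrib_left)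
      finally have "\<delta> x = e * L b x" using x0(2) by (simp add: s_def e_def)
      moreover have "(\<Sum>a\<in>B. (c(b := e)) a * L a x) = (\<Sum>a\<in>B. c a * L a x)"
        using insert.hyps by (intro sum.cong) auto
      ultimately show ?thesis using insert.hyps by (simp add: \<delta>_def sum.insert diff_eq_eq)
    qed
    then show ?thesis by blast
  qed
qed

text \<open>Elimination of one monomial after the other.\<close>

lemma finite_spanning_set:
  fixes V :: "('r::{finite,linorder}, 'n::{finite,linorder}, 'k::field_char_0) matpoly set"
  assumes "finite M" "\<And>f g. f \<in> V \<Longrightarrow> g \<in> V \<Longrightarrow> f + g \<in> V" "\<And>c f. f \<in> V \<Longrightarrow> const_poly c * f \<in> V"
    "\<And>f. f \<in> V \<Longrightarrow> msupp f \<subseteq> M"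
  shows "\<exists>B. finite B \<and> B \<subseteq> V \<and> (\<forall>f\<in>V. \<exists>c. f = (\<Sum>b\<in>B. const_poly (c b) * b))"
  using assms
proof (induction M arbitrary: V rule: finite_induct)
  case empty
  then have "\<forall>f\<in>V. f = 0" by (metis keys_eq_empty subset_empty)
  then show ?case by (intro exI[of _ "{}"]) auto
next
  case (insert m M)
  define V' where "V' = {f\<in>V. coef f m = 0}"
  have "\<exists>B. finite B \<and> B \<subseteq> V' \<and> (\<forall>f\<in>V'. \<exists>c. f = (\<Sum>b\<in>B. const_poly (c b) * b))"
  proof (rule insert.IH)
    fix f assume "f \<in> V'"
    then show "msupp f \<subseteq> M" using insert.prems(3)[of f] by (auto simp: V'_def in_keys_iff)
  next
    fix f g assume "f \<in> V'" "g \<in> V'"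
    then show "f + g \<in> V'" using insert.prems(1) by (simp add: V'_def lookup_add[of f])
  next
    fix f c assume "f \<in> V'"
    then show "const_poly c * f \<in> V'" using insert.prems(2) by (simp add: V'_def coef_const_mult)
  qed
  then obtain B where B: "finite B" "B \<subseteq> V'" "\<And>f. f \<in> V' \<Longrightarrow> \<exists>c. f = (\<Sum>b\<in>B. const_poly (c b) * b)" by blast
  show ?case
  proof (cases "\<exists>x\<in>V. coef x m \<noteq> 0")
    case False
    then have "V' = V" by (auto simp: V'_def)
    with B show ?thesis by blast
  next
    case True
    then obtain x where x: "x \<in> V" "coef x m \<noteq> 0" by blast
    then have "x \<notin> B" using B(2) by (auto simp: V'_def)
    have "\<exists>c. f = (\<Sum>b\<in>insert x B. const_poly (c b) * b)" if f: "f \<in> V" for f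
    proof -
      define e where "e = coef f m / coef x m"
      have "f + const_poly (- e) * x \<in> V'"
        using f x insert.prems(1,2) by (simp add: V'_def lookup_add[of f] coef_const_mult e_def)
      then obtain c where c: "f + const_poly (- e) * x = (\<Sum>b\<in>B. const_poly (c b) * b)" using B(3) by blast
      have "(\<Sum>b\<in>B. const_poly ((c(x := e)) b) * b) = (\<Sum>b\<in>B. const_poly (c b) * b)"
        using \<open>x \<notin> B\<close> by (intro sum.cong) auto
      then have "f = (\<Sum>b\<in>insert x B. const_poly ((c(x := e)) b) * b)"
        using B(1) \<open>x \<notin> B\<close> unfolding c[symmetric] by (simp add: cp.hom_uminus)
      then show ?thesis by blast
    qed
    then show ?thesis using B x by (intro exI[of _ "insert x B"]) (auto simp: V'_def)
  qed
qed

text \<open>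
  If \<open>A \<inter> N\<^sup>\<bottom> = 0\<close>, the form is nondegenerate on the finite-dimensional space \<open>N\<close>. So for \<open>f \<in> A\<close> the linear
  form that \<open>f\<close> induces on \<open>N\<close> is induced by some \<open>n \<in> N\<close>, and \<open>f - n \<in> A \<inter> N\<^sup>\<bottom>\<close>.
\<close>

lemma nondegenerate_projection:
  fixes A N :: "('r::{finite,linorder}, 'n::{finite,linorder}, 'k::field_char_0) matpoly set"
  assumes A: "stable A" and N: "stable N" "N \<subseteq> A" and M: "finite M" "\<And>f. f \<in> A \<Longrightarrow> msupp f \<subseteq> M"
    and trivial: "\<And>f. f \<in> A \<Longrightarrow> (\<forall>g\<in>N. form f g = 0) \<Longrightarrow> f = 0"
  shows "A \<subseteq> N"
proof
  fix f assume f: "f \<in> A"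
  have "\<exists>B. finite B \<and> B \<subseteq> N \<and> (\<forall>f\<in>N. \<exists>c. f = (\<Sum>b\<in>B. const_poly (c b) * b))"
    using M N(2) by (intro finite_spanning_set[of M]) (auto intro: stableD[OF N(1)])
  then obtain B where B: "finite B" "B \<subseteq> N" "\<And>g. g \<in> N \<Longrightarrow> \<exists>c. g = (\<Sum>b\<in>B. const_poly (c b) * b)"
    by blast
  have "\<exists>c. \<forall>x\<in>N. form f x = (\<Sum>b\<in>B. c b * form b x)"
  proof (rule common_kernel)
    fix x assume x: "x \<in> N" "\<forall>b\<in>B. form b x = 0"
    have "form x g = 0" if gN: "g \<in> N" for g
    proof -
      obtain c where "g = (\<Sum>b\<in>B. const_poly (c b) * b)" using B(3)[OF gN] by blast
      then show ?thesis using x(2) by (simp add: form_sum_right form_cmult_right form_commute[of x])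
    qed
    with trivial[of x] x N(2) have "x = 0" by blast
    then show "form f x = 0" by simp
  qed (use B N(1) in \<open>auto simp: form_add_right form_cmult_right intro: stableD\<close>)
  then obtain c where c: "\<And>x. x \<in> N \<Longrightarrow> form f x = (\<Sum>b\<in>B. c b * form b x)" by blast
  define n where "n = (\<Sum>b\<in>B. const_poly (c b) * b)"
  have n: "n \<in> N" unfolding n_def using B(2) N(1) by (intro stable_sum stableD) auto
  have "f - n \<in> A" using stable_diff[OF A f] n N(2) by blast
  moreover have "\<forall>g\<in>N. form (f - n) g = 0"
  proof
    fix g assume g: "g \<in> N"
    have "f - n = f + const_poly (-1) * n" by (simp add: cp.hom_uminus)
    then have "form (f - n) g = form f g - form n g"
      by (simp only: form_add_left form_cmult_left) simp
    also have "form n g = form f g" unfolding n_def c[OF g] by (simp add: form_sum_left form_cmult_left)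
    finally show "form (f - n) g = 0" by simp
  qed
  ultimately have "f - n = 0" by (rule trivial)
  with n show "f \<in> N" by simp
qed

section \<open>Products of leading minors\<close>

lemma peval_leading_minor:
  fixes Y :: "'r::{finite,linorder} \<Rightarrow> 'n::{finite,linorder} \<Rightarrow> 'b::comm_ring_1"
    and h :: "'k::field_char_0 \<Rightarrow> 'b"
  assumes h: "comm_ring_hom h" and t: "t \<le> CARD('r)" "CARD('r) \<le> CARD('n)"
  shows "peval h Y (leading_minor t) = Determinant.det (Matrix.mat t t (\<lambda>(a, b). Y (nth_elem a) (nth_elem b)))"
proof -
  have len: "length (take t (sorted_list_of_set (UNIV :: 'r set))) = t"
    "length (take t (sorted_list_of_set (UNIV :: 'n set))) = t"
    using t by auto
  have "peval h Y (leading_minor t) = Determinant.det (Matrix.mat t t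
      (\<lambda>(a, b). Y (take t (sorted_list_of_set UNIV) ! a) (take t (sorted_list_of_set UNIV) ! b)))"
    unfolding leading_minor_def by (subst peval_generic_minor[OF h]) (simp_all only: len)
  also have "\<dots> = Determinant.det (Matrix.mat t t (\<lambda>(a, b). Y (nth_elem a) (nth_elem b)))"
    by (rule arg_cong[where f = Determinant.det], rule eq_matI) (simp_all add: nth_elem_def)
  finally show ?thesis .
qed

lemma leading_minor_0 [simp]: "leading_minor 0 = 1"
  by (simp add: leading_minor_def minor_def)

lemma dirshift_leading_minor:
  fixes Z :: "'r::{finite,linorder} \<Rightarrow> 'n::{finite,linorder} \<Rightarrow> ('r, 'n, 'k::field_char_0) matpoly"
  assumes t: "t \<le> CARD('r)" "CARD('r) \<le> CARD('n)"
  shows "dirshift Z (leading_minor t) =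
    Determinant.det (Matrix.mat t t (\<lambda>(a, b). [:var (nth_elem a) (nth_elem b), Z (nth_elem a) (nth_elem b):]))"
  unfolding dirshift_def by (rule peval_leading_minor[OF lin_const_hom t])

lemma dirshift_leading_minor_0:
  fixes Z :: "'r::{finite,linorder} \<Rightarrow> 'n::{finite,linorder} \<Rightarrow> ('r, 'n, 'k::field_char_0) matpoly"
  assumes t: "t \<le> CARD('r)" "CARD('r) \<le> CARD('n)"
  shows "Determinant.det (Matrix.mat t t (\<lambda>(a, b). [:var (nth_elem a) (nth_elem b):])) = [:leading_minor t :: ('r, 'n, 'k) matpoly:]"
proof -
  interpret p: comm_ring_hom "\<lambda>c::('r, 'n, 'k) matpoly. [:c:]" by (rule pCons_const_hom)
  have "leading_minor t = peval const_poly var (leading_minor t :: ('r, 'n, 'k) matpoly)"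
    by (simp add: peval_var_id)
  also have "\<dots> = Determinant.det (Matrix.mat t t (\<lambda>(a, b). var (nth_elem a) (nth_elem b)))"
    by (rule peval_leading_minor[OF const_poly_hom t])
  finally have "[:leading_minor t :: ('r, 'n, 'k) matpoly:]
      = Determinant.det (map_mat (\<lambda>c. [:c:]) (Matrix.mat t t (\<lambda>(a, b). var (nth_elem a) (nth_elem b))))"
    by (simp only: p.hom_det)
  also have "map_mat (\<lambda>c. [:c:]) (Matrix.mat t t (\<lambda>(a, b). var (nth_elem a) (nth_elem b) :: ('r, 'n, 'k) matpoly))
      = Matrix.mat t t (\<lambda>(a, b). [:var (nth_elem a) (nth_elem b):])"
    by (rule eq_matI) auto
  finally show ?thesis by simp
qed

text \<open>
  Adding a multiple of row \<open>a\<close> to a later row \<open>b\<close> does not change a leading minor, since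
  row \<open>b\<close> takes part in it only together with row \<open>a\<close>.
\<close>

lemma rowpol_leading_minor:
  fixes a b :: "'r::{finite,linorder}"
  assumes t: "t \<le> CARD('r)" "CARD('r) \<le> CARD('n::{finite,linorder})" and ab: "a < b"
  shows "rowpol a b (leading_minor t :: ('r, 'n, 'k::field_char_0) matpoly) = 0"
proof -
  let ?Z = "\<lambda>i (j::'n). if i = b then var a j else 0 :: ('r, 'n, 'k) matpoly"
  let ?M = "Matrix.mat t t (\<lambda>(i, j). [:var (nth_elem i) (nth_elem j) :: ('r, 'n, 'k) matpoly:])"
  let ?MZ = "Matrix.mat t t (\<lambda>(i, j). [:var (nth_elem i) (nth_elem j), ?Z (nth_elem i) (nth_elem j):])"
  have lt: "pos a < pos b" using ab by simp
  have pa: "(nth_elem i = b) = (i = pos b)" if "i < t" for i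
    using that t pos_nth_elem[where 'x = 'r] by (metis less_le_trans nth_elem_pos)
  have "Determinant.det ?MZ = Determinant.det ?M"
  proof (cases "pos b < t")
    case True
    have at: "pos a < t" by (rule less_trans[OF lt True])
    have "?MZ = addrow [:0, 1:] (pos b) (pos a) ?M"
      using at True by (intro eq_matI) (auto simp: pa)
    also have "Determinant.det \<dots> = Determinant.det ?M"
      using ab at True by (intro det_addrow[where n = t]) auto
    finally show ?thesis .
  next
    case False
    have "?MZ = ?M" using False by (intro eq_matI) (auto simp: pa)
    then show ?thesis by simp
  qed
  then have "dirshift ?Z (leading_minor t) = [:leading_minor t:]"
    unfolding dirshift_leading_minor[OF t] dirshift_leading_minor_0[OF t] .
  then show ?thesis unfolding rowpol_def dirderiv_def by simp
qed

lemma colpol_leading_minor: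
  fixes a b :: "'n::{finite,linorder}"
  assumes t: "t \<le> CARD('r::{finite,linorder})" "CARD('r) \<le> CARD('n)" and ab: "a < b"
  shows "colpol a b (leading_minor t :: ('r, 'n, 'k::field_char_0) matpoly) = 0"
proof -
  let ?Z = "\<lambda>(i::'r) j. if j = b then var i a else 0 :: ('r, 'n, 'k) matpoly"
  let ?M = "Matrix.mat t t (\<lambda>(i, j). [:var (nth_elem i) (nth_elem j) :: ('r, 'n, 'k) matpoly:])"
  let ?MZ = "Matrix.mat t t (\<lambda>(i, j). [:var (nth_elem i) (nth_elem j), ?Z (nth_elem i) (nth_elem j):])"
  have lt: "pos a < pos b" using ab by simp
  have pa: "(nth_elem i = b) = (i = pos b)" if "i < t" for i
    using that t pos_nth_elem[where 'x = 'n] by (metis less_le_trans nth_elem_pos order_trans)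
  have "Determinant.det ?MZ = Determinant.det ?M"
  proof (cases "pos b < t")
    case True
    have at: "pos a < t" by (rule less_trans[OF lt True])
    have "?MZ = addcol [:0, 1:] (pos b) (pos a) ?M"
      using at True by (intro eq_matI) (auto simp: pa mat_addcol_def)
    also have "Determinant.det \<dots> = Determinant.det ?M"
      using ab at True by (intro det_addcol[where n = t]) auto
    finally show ?thesis .
  next
    case False
    have "?MZ = ?M" using False by (intro eq_matI) (auto simp: pa)
    then show ?thesis by simp
  qed
  then have "dirshift ?Z (leading_minor t) = [:leading_minor t:]"
    unfolding dirshift_leading_minor[OF t] dirshift_leading_minor_0[OF t] .
  then show ?thesis unfolding colpol_def dirderiv_def by simp
qed

text \<open>Scaling a row that takes part in the minor scales the minor.\<close>

lemma rowpol_leading_minor_diag: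
  fixes a :: "'r::{finite,linorder}"
  assumes t: "t \<le> CARD('r)" "CARD('r) \<le> CARD('n::{finite,linorder})"
  shows "rowpol a a (leading_minor t :: ('r, 'n, 'k::field_char_0) matpoly)
     = (if pos a < t then leading_minor t else 0)"
proof -
  let ?Z = "\<lambda>i (j::'n). if i = a then var a j else 0 :: ('r, 'n, 'k) matpoly"
  let ?M = "Matrix.mat t t (\<lambda>(i, j). [:var (nth_elem i) (nth_elem j) :: ('r, 'n, 'k) matpoly:])"
  let ?MZ = "Matrix.mat t t (\<lambda>(i, j). [:var (nth_elem i) (nth_elem j), ?Z (nth_elem i) (nth_elem j):])"
  have pa: "(nth_elem i = a) = (i = pos a)" if "i < t" for i
    using that t pos_nth_elem[where 'x = 'r] by (metis less_le_trans nth_elem_pos)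
  have "dirshift ?Z (leading_minor t) = (if pos a < t then [:1, 1:] else 1) * [:leading_minor t:]"
  proof (cases "pos a < t")
    case True
    have "?MZ = multrow (pos a) [:1, 1:] ?M"
      using True by (intro eq_matI) (auto simp: pa)
    also have "Determinant.det \<dots> = [:1, 1:] * Determinant.det ?M"
      using True by (intro det_multrow[where n = t]) auto
    finally show ?thesis using True unfolding dirshift_leading_minor[OF t] dirshift_leading_minor_0[OF t] by simp
  next
    case False
    have "?MZ = ?M" using False by (intro eq_matI) (auto simp: pa)
    then show ?thesis using False unfolding dirshift_leading_minor[OF t]
      by (simp add: dirshift_leading_minor_0[OF t])
  qed
  then show ?thesis unfolding rowpol_def dirderiv_def by simp
qed

text \<open>The rectangular unit matrix, at which all leading minors are \<open>1\<close>.\<close>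

definition idmat :: "'r::{finite,linorder} \<Rightarrow> 'n::{finite,linorder} \<Rightarrow> 'b::comm_ring_1" where
  "idmat i j = (if pos i = pos j then 1 else 0)"

lemma leading_minor_nonzero:
  assumes t: "t \<le> CARD('r::{finite,linorder})" "CARD('r) \<le> CARD('n::{finite,linorder})"
  shows "(leading_minor t :: ('r, 'n, 'k::field_char_0) matpoly) \<noteq> 0"
proof -
  have id: "comm_ring_hom (\<lambda>x::'k. x)" by unfold_locales auto
  have "peval (\<lambda>x. x) idmat (leading_minor t :: ('r, 'n, 'k) matpoly)
      = Determinant.det (Matrix.mat t t (\<lambda>(a, b). idmat (nth_elem a :: 'r) (nth_elem b :: 'n)))"
    by (rule peval_leading_minor[OF id t])
  also have "Matrix.mat t t (\<lambda>(a, b). idmat (nth_elem a :: 'r) (nth_elem b :: 'n) :: 'k) = 1\<^sub>m t"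
    using t by (intro eq_matI) (auto simp: idmat_def pos_nth_elem)
  finally have "peval (\<lambda>x. x) idmat (leading_minor t :: ('r, 'n, 'k) matpoly) = 1" by simp
  then show ?thesis by auto
qed

definition integral_poly :: "('r::{finite,linorder}, 'n::{finite,linorder}, 'k::field_char_0) matpoly \<Rightarrow> bool" where
  "integral_poly f \<longleftrightarrow> (\<forall>m. coef f m \<in> \<int>)"

lemma integral_poly_mult: "integral_poly f \<Longrightarrow> integral_poly g \<Longrightarrow> integral_poly (f * g)"
proof -
  assume fg: "integral_poly f" "integral_poly g"
  have "f * g = (\<Sum>m\<in>msupp f. Poly_Mapping.single m (coef f m))
      * (\<Sum>m'\<in>msupp g. Poly_Mapping.single m' (coef g m'))"
    by (simp only: matpoly_decompose[symmetric])
  also have "\<dots> = (\<Sum>m\<in>msupp f. \<Sum>m'\<in>msupp g.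
      Poly_Mapping.single (m + m') (coef f m * coef g m'))"
    by (simp only: sum_product mult_single)
  finally show ?thesis using fg
    unfolding integral_poly_def by (auto simp: lookup_sum lookup_single when_def intro!: Ints_sum)
qed

lemma integral_poly_1 [simp]: "integral_poly 1"
  by (auto simp: integral_poly_def lookup_one when_def)

lemma integral_poly_var [simp]: "integral_poly (var i j)"
  by (auto simp: integral_poly_def var_eq lookup_single when_def)

lemma integral_poly_sum: "(\<And>a. a \<in> A \<Longrightarrow> integral_poly (g a)) \<Longrightarrow> integral_poly (sum g A)"
  by (auto simp: integral_poly_def lookup_sum intro!: Ints_sum)

lemma integral_poly_prod: "(\<And>a. a \<in> A \<Longrightarrow> integral_poly (g a)) \<Longrightarrow> integral_poly (prod g A)"
  by (induction A rule: infinite_finite_induct) (auto intro: integral_poly_mult)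

lemma integral_poly_power: "integral_poly f \<Longrightarrow> integral_poly (f ^ k)"
  by (induction k) (auto intro: integral_poly_mult)

lemma integral_poly_leading_minor:
  assumes t: "t \<le> CARD('r::{finite,linorder})" "CARD('r) \<le> CARD('n::{finite,linorder})"
  shows "integral_poly (leading_minor t :: ('r, 'n, 'k::field_char_0) matpoly)"
proof -
  have sgn: "integral_poly (signof p :: ('r, 'n, 'k) matpoly)" for p
    by (auto simp: sign_def integral_poly_def lookup_one when_def)
  have "leading_minor t = peval const_poly var (leading_minor t :: ('r, 'n, 'k) matpoly)"
    by (simp add: peval_var_id)
  also have "\<dots> = Determinant.det (Matrix.mat t t (\<lambda>(a, b). var (nth_elem a) (nth_elem b)))"
    by (rule peval_leading_minor[OF const_poly_hom t])
  also have "\<dots> = (\<Sum>p\<in>{p. p permutes {0..<t}}. signof p *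
      (\<Prod>i = 0..<t. Matrix.mat t t (\<lambda>(a, b). var (nth_elem a) (nth_elem b)) $$ (i, p i)))"
    by (rule det_def') simp
  finally have eq: "(leading_minor t :: ('r, 'n, 'k) matpoly) = (\<Sum>p\<in>{p. p permutes {0..<t}}. signof p *
      (\<Prod>i = 0..<t. Matrix.mat t t (\<lambda>(a, b). var (nth_elem a) (nth_elem b)) $$ (i, p i)))" .
  show ?thesis unfolding eq
  proof (intro integral_poly_sum integral_poly_mult integral_poly_prod sgn)
    fix p i assume "p \<in> {p. p permutes {0..<t}}" "i \<in> {0..<t}"
    then have "p i < t" "i < t" using permutes_in_image[of p "{0..<t}" i] by auto
    then show "integral_poly (Matrix.mat t t (\<lambda>(a, b). var (nth_elem a) (nth_elem b) :: ('r, 'n, 'k) matpoly) $$ (i, p i))"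
      by simp
  qed
qed

definition Kprod :: "(nat \<Rightarrow> nat) \<Rightarrow> ('r::{finite,linorder}, 'n::{finite,linorder}, 'k::field_char_0) matpoly" where
  "Kprod e = (\<Prod>t\<in>{1..CARD('r)}. leading_minor t ^ e t)"

lemma derivation_eigen_prod:
  assumes "finite S" "\<And>t. t \<in> S \<Longrightarrow> dirderiv Z (u t) = const_poly (c t) * u t"
  shows "dirderiv Z (\<Prod>t\<in>S. u t ^ e t) = const_poly (\<Sum>t\<in>S. of_nat (e t) * c t) * (\<Prod>t\<in>S. u t ^ e t)"
proof -
  have pw: "dirderiv Z (u t ^ k) = const_poly (of_nat k * c t) * u t ^ k" if "t \<in> S" for t k
  proof (induction k)
    case (Suc k)
    have "dirderiv Z (u t ^ Suc k) = u t * (const_poly (of_nat k * c t) * u t ^ k) + const_poly (c t) * u t * u t ^ k"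
      using assms(2)[OF that] by (simp add: dirderiv_mult Suc)
    also have "\<dots> = const_poly (of_nat (Suc k) * c t) * u t ^ Suc k"
      by (simp add: cp.hom_add cp.hom_mult algebra_simps)
    finally show ?case .
  qed simp
  show ?thesis using assms(1) pw
  proof (induction S rule: finite_induct)
    case (insert t S)
    have "dirderiv Z (\<Prod>t\<in>insert t S. u t ^ e t)
        = u t ^ e t * dirderiv Z (\<Prod>t\<in>S. u t ^ e t) + dirderiv Z (u t ^ e t) * (\<Prod>t\<in>S. u t ^ e t)"
      using insert.hyps by (simp add: dirderiv_mult)
    also have "\<dots> = u t ^ e t * (const_poly (\<Sum>t\<in>S. of_nat (e t) * c t) * (\<Prod>t\<in>S. u t ^ e t))
        + const_poly (of_nat (e t) * c t) * u t ^ e t * (\<Prod>t\<in>S. u t ^ e t)"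
      using insert.IH insert.prems by simp
    finally show ?case using insert.hyps by (simp add: cp.hom_add distrib_left distrib_right mult_ac)
  qed simp
qed

context
  fixes e :: "nat \<Rightarrow> nat"
  assumes rn: "CARD('r::{finite,linorder}) \<le> CARD('n::{finite,linorder})"
begin

lemma Kprod_nonzero: "(Kprod e :: ('r, 'n, 'k::field_char_0) matpoly) \<noteq> 0"
proof -
  have "(leading_minor t :: ('r, 'n, 'k) matpoly) ^ e t \<noteq> 0" if "t \<in> {1..CARD('r)}" for t
    using leading_minor_nonzero[OF _ rn, of t, where 'k = 'k] that by simp
  then show ?thesis unfolding Kprod_def by (simp only: prod_zero_iff[OF finite_atLeastAtMost]) blast
qed

lemma integral_poly_Kprod: "integral_poly (Kprod e :: ('r, 'n, 'k::field_char_0) matpoly)"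
  unfolding Kprod_def using rn
  by (intro integral_poly_prod integral_poly_power integral_poly_leading_minor) auto

lemma raising_killed_Kprod: "raising_killed (Kprod e :: ('r, 'n, 'k::field_char_0) matpoly)"
proof -
  have "rowpol a b (Kprod e :: ('r, 'n, 'k) matpoly) = 0" if "a < b" for a b :: 'r
  proof -
    have "dirderiv (\<lambda>i j. if i = b then var a j else 0) (leading_minor t :: ('r, 'n, 'k) matpoly) = const_poly 0 * leading_minor t"
      if "t \<in> {1..CARD('r)}" for t
      using rowpol_leading_minor[OF _ rn \<open>a < b\<close>, of t, where 'k = 'k] that by (simp add: rowpol_def)
    from derivation_eigen_prod[OF finite_atLeastAtMost this, where e = e] show ?thesis
      unfolding Kprod_def rowpol_def by simp
  qed
  moreover have "colpol a b (Kprod e :: ('r, 'n, 'k) matpoly) = 0" if "a < b" for a b :: 'n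
  proof -
    have "dirderiv (\<lambda>i j. if j = b then var i a else 0) (leading_minor t :: ('r, 'n, 'k) matpoly) = const_poly 0 * leading_minor t"
      if "t \<in> {1..CARD('r)}" for t
      using colpol_leading_minor[OF _ rn \<open>a < b\<close>, of t, where 'k = 'k] that by (simp add: colpol_def)
    from derivation_eigen_prod[OF finite_atLeastAtMost this, where e = e] show ?thesis
      unfolding Kprod_def colpol_def by simp
  qed
  ultimately show ?thesis by (simp add: raising_killed_def)
qed

text \<open>
  The row weights of \<open>Kprod e\<close> are the column lengths of the diagram with \<open>e t\<close> rows of length \<open>t\<close>.
\<close>

lemma roww_Kprod:
  assumes "m \<in> msupp (Kprod e :: ('r, 'n, 'k::field_char_0) matpoly)"
  shows "roww a m = (\<Sum>t\<in>{pos a<..CARD('r)}. e t)"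
proof -
  have *: "dirderiv (\<lambda>i j. if i = a then var a j else 0) (leading_minor t :: ('r, 'n, 'k) matpoly)
      = const_poly (if pos a < t then 1 else 0) * leading_minor t" if "t \<in> {1..CARD('r)}" for t
    using rowpol_leading_minor_diag[OF _ rn, of t a, where 'k = 'k] that by (simp add: rowpol_def)
  have "rowpol a a (Kprod e :: ('r, 'n, 'k) matpoly)
      = const_poly (\<Sum>t\<in>{1..CARD('r)}. of_nat (e t) * (if pos a < t then 1 else 0)) * Kprod e"
    unfolding Kprod_def rowpol_def by (rule derivation_eigen_prod[OF finite_atLeastAtMost *])
  also have "(\<Sum>t\<in>{1..CARD('r)}. of_nat (e t) * (if pos a < t then 1 else 0 :: 'k))
      = of_nat (\<Sum>t\<in>{1..CARD('r)}. if pos a < t then e t else 0)"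
    unfolding of_nat_sum by (intro sum.cong) auto
  also have "(\<Sum>t\<in>{1..CARD('r)}. if pos a < t then e t else 0) = (\<Sum>t\<in>{pos a<..CARD('r)}. e t)"
    by (rule sum.mono_neutral_cong_right) auto
  finally have "rowpol a a (Kprod e :: ('r, 'n, 'k) matpoly) = const_poly (of_nat (\<Sum>t\<in>{pos a<..CARD('r)}. e t)) * Kprod e" .
  from arg_cong[OF this, of "\<lambda>f. coef f m"]
  have "of_nat (roww a m) * coef (Kprod e) m = (of_nat (\<Sum>t\<in>{pos a<..CARD('r)}. e t) :: 'k) * coef (Kprod e) m"
    unfolding roww_eq coef_rowpol_diag coef_const_mult .
  then show ?thesis using assms by (simp add: in_keys_iff del: of_nat_sum)
qed

lemma mon_deg_Kprod:
  assumes "m \<in> msupp (Kprod e :: ('r, 'n, 'k::field_char_0) matpoly)"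
  shows "mon_deg m = (\<Sum>t\<in>{1..CARD('r)}. e t * t)"
proof -
  have "mon_deg m = (\<Sum>a\<in>UNIV. roww a m)" by (simp add: mon_deg_def roww_eq)
  also have "\<dots> = (\<Sum>a\<in>(UNIV::'r set). \<Sum>t\<in>{pos a<..CARD('r)}. e t)" by (simp only: roww_Kprod[OF assms])
  also have "\<dots> = (\<Sum>a\<in>{..<CARD('r)}. \<Sum>t\<in>{a<..CARD('r)}. e t)"
    by (rule sum.reindex_bij_witness[of _ nth_elem pos]) (auto simp: pos_less_card pos_nth_elem)
  also have "\<dots> = (\<Sum>a\<in>{..<CARD('r)}. \<Sum>t\<in>{1..CARD('r)}. if a < t then e t else 0)"
    by (intro sum.cong refl sum.mono_neutral_cong_left) auto
  also have "\<dots> = (\<Sum>t\<in>{1..CARD('r)}. \<Sum>a\<in>{..<CARD('r)}. if a < t then e t else 0)"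
    by (rule sum.swap)
  also have "\<dots> = (\<Sum>t\<in>{1..CARD('r)}. e t * t)"
  proof (intro sum.cong refl)
    fix t assume "t \<in> {1..CARD('r)}"
    then have "(\<Sum>a\<in>{..<CARD('r)}. if a < t then e t else 0) = (\<Sum>a\<in>{..<t}. e t)"
      by (intro sum.mono_neutral_cong_right) auto
    then show "(\<Sum>a\<in>{..<CARD('r)}. if a < t then e t else 0) = e t * t" by simp
  qed
  finally show ?thesis .
qed

lemma homogeneous_Kprod: "homogeneous (\<Sum>t\<in>{1..CARD('r)}. e t * t) (Kprod e :: ('r, 'n, 'k::field_char_0) matpoly)"
  unfolding homogeneous_def using mon_deg_Kprod by blast

end

text \<open>
  The row weights of a highest weight vector decrease, so they are those of \<open>Kprod e\<close> for the exponents
  \<open>e\<close> given by their successive differences.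
\<close>

lemma highest_weight_vector_classification:
  fixes f :: "('r::{finite,linorder}, 'n::{finite,linorder}, 'k::field_char_0) matpoly"
  assumes rn: "CARD('r) \<le> CARD('n)"
    and f: "raising_killed f" "weight_vector f" "f \<noteq> 0"
  obtains e c where "f = const_poly c * Kprod e"
proof -
  obtain m where m: "m \<in> msupp f" "offdiag m = 0"
    using raising_killed_diagonal_term f by blast
  define \<mu> where "\<mu> t = (if t < CARD('r) then roww (nth_elem t) m else 0)" for t
  define e where "e t = \<mu> (t - 1) - \<mu> t" for t
  have dec: "\<mu> (Suc t) \<le> \<mu> t" for t
    using raising_killed_dominant[OF rn f(1) m, of "nth_elem t" "nth_elem (Suc t)"]
    by (auto simp: \<mu>_def nth_elem_less)
  have tele: "(\<Sum>t\<in>{s<..s + d}. e t) = \<mu> s - \<mu> (s + d) \<and> \<mu> (s + d) \<le> \<mu> s" for s d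
  proof (induction d)
    case (Suc d)
    have "{s<..s + Suc d} = insert (Suc (s + d)) {s<..s + d}" by auto
    then show ?case using Suc dec[of "s + d"] by (simp add: e_def)
  qed simp
  have row: "roww a m = (\<Sum>t\<in>{pos a<..CARD('r)}. e t)" for a
    using tele[of "pos a" "CARD('r) - pos a"] pos_less_card[of a] by (simp add: \<mu>_def)
  have rowf: "roww a x = roww a m" if "x \<in> msupp f" for a x
    using f(2) that m(1) unfolding weight_vector_def by blast
  have rows: "roww a x = roww a m" if "x \<in> msupp f \<union> msupp (Kprod e :: ('r, 'n, 'k) matpoly)" for a x
    using that rowf roww_Kprod[OF rn, of x e a] row by auto
  obtain c where "f = const_poly c * Kprod e"
  proof (rule raising_killed_proportional[OF f(1) raising_killed_Kprod[OF rn, of e, where 'k = 'k] Kprod_nonzero[OF rn]])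
    fix x x' :: "'r \<Rightarrow>\<^sub>0 ('n \<Rightarrow>\<^sub>0 nat)" and a
    assume "x \<in> msupp f \<union> msupp (Kprod e :: ('r, 'n, 'k) matpoly)"
      "x' \<in> msupp f \<union> msupp (Kprod e :: ('r, 'n, 'k) matpoly)"
    then show "roww a x = roww a x'" using rows by (simp only:)
  qed
  then show thesis by (rule that)
qed

section \<open>Stable subspaces are determined by products of leading minors\<close>

lemma mon_deg_rowpol:
  assumes "m \<in> msupp (rowpol a b f)"
  obtains m' where "m' \<in> msupp f" "mon_deg m' = mon_deg m"
proof (cases "a = b")
  case True
  with assms have "m \<in> msupp f" by (auto simp: in_keys_iff coef_rowpol_diag)
  then show thesis by (rule that) simp
next
  case False
  then obtain j where j: "mexp m a j > 0" "m - munit a j + munit b j \<in> msupp f"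
    using keys_rowpol[OF _ assms] by blast
  then show thesis using wt_move[OF j(1), of "\<lambda>i j. 1" b j] by (intro that[OF j(2)]) (simp add: mon_deg_eq_wt)
qed

lemma mon_deg_colpol:
  assumes "m \<in> msupp (colpol a b f)"
  obtains m' where "m' \<in> msupp f" "mon_deg m' = mon_deg m"
proof (cases "a = b")
  case True
  with assms have "m \<in> msupp f" by (auto simp: in_keys_iff coef_colpol_diag)
  then show thesis by (rule that) simp
next
  case False
  then obtain j where j: "mexp m j a > 0" "m - munit j a + munit j b \<in> msupp f"
    using keys_colpol[OF _ assms] by blast
  then show thesis using wt_move[OF j(1), of "\<lambda>i j. 1" j b] by (intro that[OF j(2)]) (simp add: mon_deg_eq_wt)
qed

lemma stable_degree_condition:
  "stable {f :: ('r::{finite,linorder}, 'n::{finite,linorder}, 'k::field_char_0) matpoly.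
     \<forall>m\<in>msupp f. P (mon_deg m)}"
  unfolding stable_def
proof (intro conjI allI ballI)
  fix f g :: "('r, 'n, 'k) matpoly" assume fg: "f \<in> {f. \<forall>m\<in>msupp f. P (mon_deg m)}" "g \<in> {f. \<forall>m\<in>msupp f. P (mon_deg m)}"
  then show "f + g \<in> {f. \<forall>m\<in>msupp f. P (mon_deg m)}"
    using keys_add[of f g] by auto
next
  fix c and f :: "('r, 'n, 'k) matpoly" assume "f \<in> {f. \<forall>m\<in>msupp f. P (mon_deg m)}"
  then show "const_poly c * f \<in> {f. \<forall>m\<in>msupp f. P (mon_deg m)}"
    by (auto simp: in_keys_iff coef_const_mult)
next
  fix a b and f :: "('r, 'n, 'k) matpoly" assume "f \<in> {f. \<forall>m\<in>msupp f. P (mon_deg m)}"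
  then show "rowpol a b f \<in> {f. \<forall>m\<in>msupp f. P (mon_deg m)}"
    by (auto elim!: mon_deg_rowpol)
next
  fix a b and f :: "('r, 'n, 'k) matpoly" assume "f \<in> {f. \<forall>m\<in>msupp f. P (mon_deg m)}"
  then show "colpol a b f \<in> {f. \<forall>m\<in>msupp f. P (mon_deg m)}"
    by (auto elim!: mon_deg_colpol)
qed simp

lemma finite_monomials_deg_le: "finite {m :: 'r::finite \<Rightarrow>\<^sub>0 ('n::finite \<Rightarrow>\<^sub>0 nat). mon_deg m \<le> d}"
proof (rule finite_imageD)
  let ?F = "\<lambda>m (x :: 'r \<times> 'n). mexp m (fst x) (snd x)"
  show "inj_on ?F {m. mon_deg m \<le> d}"
    by (rule inj_onI, rule mexp_eqI) (metis fst_conv snd_conv)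
  have "mexp m i j \<le> mon_deg m" for m :: "'r \<Rightarrow>\<^sub>0 ('n \<Rightarrow>\<^sub>0 nat)" and i j
    using wt_ge[of "\<lambda>i j. 1" i j m] by (simp add: mon_deg_eq_wt)
  then have "?F ` {m. mon_deg m \<le> d} \<subseteq> PiE UNIV (\<lambda>_. {..d})"
    by (auto simp: PiE_def intro: le_trans)
  then show "finite (?F ` {m. mon_deg m \<le> d})"
    by (rule finite_subset) (intro finite_PiE finite_code; simp)
qed

text \<open>
  It suffices to treat the elements of bounded degree, which form a finite-dimensional stable space \<open>A1\<close>. The
  orthogonal complement \<open>A2\<close> of \<open>A1 \<inter> N\<close> in \<open>A1\<close> is stable; if it were nonzero it would contain a highest
  weight vector, hence some \<open>Kprod e\<close>. By assumption this lies in \<open>N\<close> as well, so it is orthogonal to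
  itself, which is impossible.
\<close>

theorem stable_subset_if_Kprods:
  fixes A N :: "('r::{finite,linorder}, 'n::{finite,linorder}, 'k::field_char_0) matpoly set"
  assumes rn: "CARD('r) \<le> CARD('n)" and A: "stable A" and N: "stable N"
    and K: "\<And>e. Kprod e \<in> A \<Longrightarrow> Kprod e \<in> N"
  shows "A \<subseteq> N"
proof
  fix f assume "f \<in> A"
  define d where "d = (\<Sum>m\<in>msupp f. mon_deg m)"
  define A1 where "A1 = A \<inter> {f. \<forall>m\<in>msupp f. mon_deg m \<le> d}"
  have A1: "stable A1" unfolding A1_def by (intro stable_Int A stable_degree_condition)
  have N1: "stable (A1 \<inter> N)" by (intro stable_Int A1 N)
  have "f \<in> A1" using \<open>f \<in> A\<close> unfolding A1_def d_def by (auto intro!: member_le_sum)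
  have "A1 \<subseteq> A1 \<inter> N"
  proof (rule nondegenerate_projection[OF A1 N1 _ finite_monomials_deg_le[of d]])
    fix g assume g: "g \<in> A1" "\<forall>x\<in>A1 \<inter> N. form g x = 0"
    show "g = 0"
    proof (rule ccontr)
      assume "g \<noteq> 0"
      define A2 where "A2 = {g\<in>A1. \<forall>x\<in>A1 \<inter> N. form g x = 0}"
      have A2: "stable A2" unfolding A2_def by (rule stable_orthogonal[OF A1 N1])
      have "g \<in> A2" using g by (simp add: A2_def)
      have "mon_deg m \<le> d" if "f \<in> A2" "m \<in> msupp f" for f m
        using that unfolding A2_def A1_def by blast
      then obtain h where h: "h \<in> A2" "h \<noteq> 0" "weight_vector h" "raising_killed h"
        using stable_highest_weight_vector[OF A2 \<open>g \<in> A2\<close> \<open>g \<noteq> 0\<close>] by metis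
      then obtain e c where e: "h = const_poly c * Kprod e"
        using highest_weight_vector_classification[OF rn] by blast
      with h(2) have "c \<noteq> 0" by auto
      then have "Kprod e = const_poly (inverse c) * h"
        unfolding e by (simp add: mult.assoc[symmetric] cp.hom_mult[symmetric])
      then have "Kprod e \<in> A2" using stableD(3)[OF A2 h(1)] by simp
      then have "Kprod e \<in> A1 \<inter> N" using K[of e] by (auto simp: A2_def A1_def)
      with \<open>Kprod e \<in> A2\<close> have "form (Kprod e) (Kprod e :: ('r, 'n, 'k) matpoly) = 0" by (auto simp: A2_def)
      then show False
        using form_integral_nonzero[OF _ Kprod_nonzero[OF rn, of e, where 'k = 'k]] integral_poly_Kprod[OF rn, of e, where 'k = 'k]
        unfolding integral_poly_def by blast
    qed
  qed (auto simp: A1_def)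
  with \<open>f \<in> A1\<close> show "f \<in> N" by blast
qed

text \<open>Initial degrees of stable spaces are therefore attained by products of leading minors.\<close>

corollary stable_homogeneous_Kprod:
  fixes A :: "('r::{finite,linorder}, 'n::{finite,linorder}, 'k::field_char_0) matpoly set"
  assumes rn: "CARD('r) \<le> CARD('n)" and A: "stable A" and f: "f \<in> A" "f \<noteq> 0" "homogeneous d f"
  obtains e where "Kprod e \<in> A" "(\<Sum>t\<in>{1..CARD('r)}. e t * t) = d"
proof -
  define A1 where "A1 = A \<inter> {f. \<forall>m\<in>msupp f. mon_deg m = d}"
  have A1: "stable A1" unfolding A1_def by (intro stable_Int A stable_degree_condition)
  have "f \<in> A1" using f by (simp add: A1_def homogeneous_def)
  have "stable {0 :: ('r, 'n, 'k) matpoly}" by (simp add: stable_def rowpol_def colpol_def)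
  then have "\<exists>e. Kprod e \<in> A1"
    using stable_subset_if_Kprods[OF rn A1, of "{0}"] \<open>f \<in> A1\<close> f(2) by blast
  then obtain e where e: "Kprod e \<in> A1" by blast
  obtain m where m: "m \<in> msupp (Kprod e :: ('r, 'n, 'k) matpoly)"
    using Kprod_nonzero[OF rn, of e, where 'k = 'k] by fastforce
  with e have "mon_deg m = d" by (simp add: A1_def)
  with mon_deg_Kprod[OF rn m] have "(\<Sum>t\<in>{1..CARD('r)}. e t * t) = d" by simp
  with e show thesis by (intro that) (auto simp: A1_def)
qed

section \<open>Group-invariant ideals are polarization-stable\<close>

lemma matrix_inv_eqI:
  fixes G H :: "('m::finite, 'm, 'k::field) matrix"
  assumes "G ** H = Finite_Cartesian_Product.mat 1" "H ** G = Finite_Cartesian_Product.mat 1"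
  shows "invertible H" "matrix_inv H = G"
proof -
  show inv: "invertible H" unfolding invertible_def using assms by blast
  have "\<exists>H'. H ** H' = Finite_Cartesian_Product.mat 1 \<and> H' ** H = Finite_Cartesian_Product.mat 1"
    using assms by blast
  then have "matrix_inv H ** H = Finite_Cartesian_Product.mat 1"
    unfolding matrix_inv_def by (rule someI2_ex) blast
  then have "matrix_inv H ** (H ** G) = G"
    by (simp add: matrix_mul_assoc)
  then show "matrix_inv H = G" by (simp add: assms)
qed

text \<open>The matrix \<open>1 + c E\<^sub>a\<^sub>b\<close>.\<close>

definition elem_mat :: "'m \<Rightarrow> 'm \<Rightarrow> 'k \<Rightarrow> ('m::finite, 'm, 'k::field) matrix" where
  "elem_mat a b c = (\<chi> i j. (if i = j then 1 else 0) + (if i = a \<and> j = b then c else 0))"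

lemma elem_mat_mult:
  "elem_mat a b c ** elem_mat a b d = elem_mat a b (c + d + (if a = b then c * d else 0))"
proof -
  have "(\<Sum>k\<in>UNIV. ((if i = k then 1 else 0) + (if i = a \<and> k = b then c else 0))
      * ((if k = j then 1 else 0) + (if k = a \<and> j = b then d else 0)))
    = (if i = j then 1 else 0) + (if i = a \<and> j = b then c + d + (if a = b then c * d else 0) else 0)" for i j
  proof -
    have "((if i = k then 1 else 0) + (if i = a \<and> k = b then c else 0))
      * ((if k = j then 1 else 0) + (if k = a \<and> j = b then d else 0))
     = (if k = i then (if i = j then 1 else 0) + (if i = a \<and> j = b then d else 0) else 0)
       + (if k = b then (if i = a then c * ((if b = j then 1 else 0) + (if b = a \<and> j = b then d else 0)) else 0) else 0)" for k
      by (auto simp: distrib_left distrib_right)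
    then have "(\<Sum>k\<in>UNIV. ((if i = k then 1 else 0) + (if i = a \<and> k = b then c else 0))
      * ((if k = j then 1 else 0) + (if k = a \<and> j = b then d else 0)))
     = ((if i = j then 1 else 0) + (if i = a \<and> j = b then d else 0))
       + (if i = a then c * ((if b = j then 1 else 0) + (if b = a \<and> j = b then d else 0)) else 0)"
      by (simp only: sum.distrib) simp
    also have "\<dots> = (if i = j then 1 else 0) + (if i = a \<and> j = b then c + d + (if a = b then c * d else 0) else 0)"
      by (auto simp: distrib_left)
    finally show ?thesis .
  qed
  then show ?thesis
    by (simp add: elem_mat_def matrix_matrix_mult_def vec_eq_iff)
qed

lemma elem_mat_0: "elem_mat a b 0 = Finite_Cartesian_Product.mat 1"
  by (simp add: elem_mat_def Finite_Cartesian_Product.mat_def)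

lemma elem_mat_inverse:
  assumes "a \<noteq> b \<or> c \<noteq> - 1"
  obtains d where "elem_mat a b c ** elem_mat a b d = Finite_Cartesian_Product.mat 1"
    "elem_mat a b d ** elem_mat a b c = Finite_Cartesian_Product.mat 1"
proof
  define d where "d = (if a = b then - c / (1 + c) else - c)"
  have "1 + c \<noteq> 0" if "a = b" using assms that by (metis add.commute add_eq_0_iff2)
  then have "d * (1 + c) = - c" if "a = b" using that by (simp add: d_def)
  moreover have "c + d + c * d = c + d * (1 + c)" by (simp add: algebra_simps)
  ultimately have sum0: "c + d + (if a = b then c * d else 0) = 0"
    by (cases "a = b") (simp_all add: d_def)
  have "d + c + (if a = b then d * c else 0) = c + d + (if a = b then c * d else 0)"
    by (simp add: add.commute mult.commute)
  then have sum0': "d + c + (if a = b then d * c else 0) = 0" using sum0 by (rule trans)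
  show "elem_mat a b c ** elem_mat a b d = Finite_Cartesian_Product.mat 1"
    unfolding elem_mat_mult sum0 by (rule elem_mat_0)
  show "elem_mat a b d ** elem_mat a b c = Finite_Cartesian_Product.mat 1"
    unfolding elem_mat_mult sum0' by (rule elem_mat_0)
qed

lemma GL_action_peval:
  "GL_action A B f = peval const_poly (\<lambda>i j. \<Sum>b\<in>UNIV. (\<Sum>a\<in>UNIV.
      const_poly (vec_nth (vec_nth (matrix_inv A) i) a) * var a b) * const_poly (vec_nth (vec_nth B b) j)) f"
  unfolding GL_action_def mat_subst_peval
  by (rule arg_cong[where f = "\<lambda>Y. peval const_poly Y f"], intro ext)
    (simp add: matrix_matrix_mult_def generic_matrix_nth)

lemma GL_invariant_row_shift:
  fixes J :: "('r::{finite,linorder}, 'n::{finite,linorder}, 'k::field_char_0) matpoly set"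
  assumes J: "GL_invariant J" and f: "f \<in> J" and c: "c \<noteq> - 1"
  shows "poly (dirshift (\<lambda>i j. if i = b then var a j else 0) f) (const_poly c) \<in> J"
proof -
  obtain d where d: "elem_mat b a c ** elem_mat b a d = Finite_Cartesian_Product.mat 1"
    "elem_mat b a d ** elem_mat b a c = Finite_Cartesian_Product.mat 1"
    using elem_mat_inverse[of b a c] c by blast
  note inv = matrix_inv_eqI[OF d]
  have inv1: "invertible (Finite_Cartesian_Product.mat 1 :: ('n, 'n, 'k) matrix)"
    unfolding invertible_def by (intro exI[of _ "Finite_Cartesian_Product.mat 1"]) simp
  have "GL_action (elem_mat b a d) (Finite_Cartesian_Product.mat 1) f \<in> J"
    using J f inv(1) inv1 unfolding GL_invariant_def by blast
  also have "GL_action (elem_mat b a d) (Finite_Cartesian_Product.mat 1) f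
      = peval const_poly (\<lambda>i j. var i j + const_poly c * (if i = b then var a j else 0)) f"
  proof -
    have 1: "(\<Sum>k\<in>UNIV. const_poly (vec_nth (vec_nth (elem_mat b a c) i) k) * var k j)
        = (var i j + const_poly c * (if i = b then var a j else 0) :: ('r, 'n, 'k) matpoly)" for i j
    proof -
      have "const_poly (vec_nth (vec_nth (elem_mat b a c) i) k) * var k j
        = (if k = i then var i j else 0) + (if k = a then (if i = b then const_poly c * var a j else 0) else 0 :: ('r, 'n, 'k) matpoly)" for k
        by (auto simp: elem_mat_def cp.hom_add distrib_right)
      then show ?thesis by (simp add: sum.distrib)
    qed
    have 2: "(\<Sum>k\<in>UNIV. g k * const_poly (vec_nth (vec_nth (Finite_Cartesian_Product.mat 1 :: ('n, 'n, 'k) matrix) k) j))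
        = (g j :: ('r, 'n, 'k) matpoly)" for g j
    proof -
      have "g k * const_poly (vec_nth (vec_nth (Finite_Cartesian_Product.mat 1 :: ('n, 'n, 'k) matrix) k) j)
        = (if k = j then g k else 0)" for k by (simp add: Finite_Cartesian_Product.mat_def)
      then show ?thesis by simp
    qed
    show ?thesis unfolding GL_action_peval inv(2) 1 2 ..
  qed
  finally show ?thesis by (simp add: dirshift_at)
qed

lemma GL_invariant_col_shift:
  fixes J :: "('r::{finite,linorder}, 'n::{finite,linorder}, 'k::field_char_0) matpoly set"
  assumes J: "GL_invariant J" and f: "f \<in> J" and c: "c \<noteq> - 1"
  shows "poly (dirshift (\<lambda>i j. if j = b then var i a else 0) f) (const_poly c) \<in> J"
proof -
  obtain d where d: "elem_mat a b d ** elem_mat a b c = Finite_Cartesian_Product.mat 1"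
    "elem_mat a b c ** elem_mat a b d = Finite_Cartesian_Product.mat 1"
    using elem_mat_inverse[of a b c] c by blast
  note inv = matrix_inv_eqI[OF d]
  have inv1: "invertible (Finite_Cartesian_Product.mat 1 :: ('r, 'r, 'k) matrix)"
    "matrix_inv (Finite_Cartesian_Product.mat 1 :: ('r, 'r, 'k) matrix) = Finite_Cartesian_Product.mat 1"
    by (rule matrix_inv_eqI; simp)+
  have "GL_action (Finite_Cartesian_Product.mat 1) (elem_mat a b c) f \<in> J"
    using J f inv(1) inv1 unfolding GL_invariant_def by blast
  also have "GL_action (Finite_Cartesian_Product.mat 1) (elem_mat a b c) f
      = peval const_poly (\<lambda>i j. var i j + const_poly c * (if j = b then var i a else 0)) f"
  proof -
    have 1: "(\<Sum>k\<in>UNIV. var i k * const_poly (vec_nth (vec_nth (elem_mat a b c) k) j))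
        = (var i j + const_poly c * (if j = b then var i a else 0) :: ('r, 'n, 'k) matpoly)" for i j
    proof -
      have "var i k * const_poly (vec_nth (vec_nth (elem_mat a b c) k) j)
        = (if k = j then var i j else 0) + (if k = a then (if j = b then const_poly c * var i a else 0) else 0 :: ('r, 'n, 'k) matpoly)" for k
        by (auto simp: elem_mat_def cp.hom_add distrib_left mult.commute)
      then show ?thesis by (simp add: sum.distrib)
    qed
    have 2: "(\<Sum>k\<in>UNIV. const_poly (vec_nth (vec_nth (Finite_Cartesian_Product.mat 1 :: ('r, 'r, 'k) matrix) i) k) * g k)
        = (g i :: ('r, 'n, 'k) matpoly)" for g i
    proof -
      have "const_poly (vec_nth (vec_nth (Finite_Cartesian_Product.mat 1 :: ('r, 'r, 'k) matrix) i) k) * g k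
        = (if k = i then g k else 0)" for k by (simp add: Finite_Cartesian_Product.mat_def)
      then show ?thesis by simp
    qed
    show ?thesis unfolding GL_action_peval inv1(2) 2 1 ..
  qed
  finally show ?thesis by (simp add: dirshift_at)
qed

lemma stable_idealI:
  assumes "ring_mod.subspace J"
    and "\<And>a b f. f \<in> J \<Longrightarrow> rowpol a b f \<in> J" "\<And>a b f. f \<in> J \<Longrightarrow> colpol a b f \<in> J"
  shows "stable J"
  unfolding stable_def using assms(2,3)
    ring_mod.subspace_0[OF assms(1)] ring_mod.subspace_add[OF assms(1)] ring_mod.subspace_scale[OF assms(1)]
  by blast

text \<open>
  The curve \<open>c \<mapsto> 1 + c E\<^sub>a\<^sub>b\<close> in the group moves \<open>f\<close> along a polynomial curve with linear coefficient
  \<open>E\<^sub>a\<^sub>b f\<close>. The value \<open>c = - 1\<close> has to be avoided because the matrix may be singular there.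
\<close>

lemma GL_invariant_stable:
  fixes J :: "('r::{finite,linorder}, 'n::{finite,linorder}, 'k::field_char_0) matpoly set"
  assumes I: "ring_mod.subspace J" and J: "GL_invariant J"
  shows "stable J"
proof (rule stable_idealI[OF I])
  have inf: "infinite (UNIV - {- 1 :: 'k})" by (simp add: infinite_UNIV_char_0)
  note J0 = ring_mod.subspace_0[OF I] ring_mod.subspace_add[OF I] ring_mod.subspace_scale[OF I]
  fix f assume f: "f \<in> J"
  show "rowpol a b f \<in> J" for a b
    unfolding rowpol_def dirderiv_def
    by (rule coeffs_in_subspace[OF J0 inf]) (use GL_invariant_row_shift[OF J f] in auto)
  show "colpol a b f \<in> J" for a b
    unfolding colpol_def dirderiv_def
    by (rule coeffs_in_subspace[OF J0 inf]) (use GL_invariant_col_shift[OF J f] in auto)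
qed

section \<open>Powers of ideals\<close>

lemma subspace_ideal_power: "ring_mod.subspace (ideal_power J m)"
  by (cases m) (auto simp: ideal_mult_def)

lemma ideal_mult_mem: "f \<in> J \<Longrightarrow> g \<in> L \<Longrightarrow> f * g \<in> ideal_mult J L"
  unfolding ideal_mult_def by (rule ring_mod.span_base) blast

lemma ideal_mult_induct:
  assumes "f \<in> ideal_mult J L" "ring_mod.subspace T" "\<And>a b. a \<in> J \<Longrightarrow> b \<in> L \<Longrightarrow> a * b \<in> T"
  shows "f \<in> T"
proof -
  have "ideal_mult J L \<subseteq> T" unfolding ideal_mult_def
    by (rule ring_mod.span_minimal) (use assms in auto)
  with assms(1) show ?thesis by blast
qed

lemma subspace_colon:
  fixes g :: "'a::comm_ring_1"
  assumes "ring_mod.subspace T" shows "ring_mod.subspace {f. f * g \<in> T}"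
  using assms by (auto intro!: ring_mod.subspaceI simp: ring_mod.subspace_0 distrib_right ring_mod.subspace_add
      mult.assoc ring_mod.subspace_scale)

lemma ideal_power_mult_mem: "f \<in> ideal_power J a \<Longrightarrow> g \<in> ideal_power J b \<Longrightarrow> f * g \<in> ideal_power J (a + b)"
proof (induction a arbitrary: f)
  case 0
  then show ?case using ring_mod.subspace_scale[OF subspace_ideal_power] by simp
next
  case (Suc a)
  from Suc.prems(1) have "f \<in> {f. f * g \<in> ideal_power J (Suc a + b)}"
    unfolding ideal_power.simps
  proof (rule ideal_mult_induct)
    show "ring_mod.subspace {f. f * g \<in> ideal_power J (Suc a + b)}"
      by (rule subspace_colon[OF subspace_ideal_power])
    fix x y assume "x \<in> J" "y \<in> ideal_power J a"
    with Suc have "x * (y * g) \<in> ideal_mult J (ideal_power J (a + b))" by (intro ideal_mult_mem) auto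
    then show "x * y \<in> {f. f * g \<in> ideal_power J (Suc a + b)}" by (simp add: mult.assoc)
  qed
  then show ?case by simp
qed

lemma ideal_power_antimono: "a \<le> b \<Longrightarrow> ideal_power J b \<subseteq> ideal_power J a"
proof (induction b rule: dec_induct)
  case (step b)
  have "ideal_power J (Suc b) \<subseteq> ideal_power J b"
    by (auto elim!: ideal_mult_induct intro: subspace_ideal_power ring_mod.subspace_scale[OF subspace_ideal_power])
  with step show ?case by blast
qed simp

lemma ideal_power_1_mem: "f \<in> J \<Longrightarrow> f \<in> ideal_power J 1"
  using ideal_mult_mem[of f J 1 UNIV] by simp

lemma ideal_power_power_mem: "f \<in> ideal_power J a \<Longrightarrow> f ^ k \<in> ideal_power J (a * k)"
  by (induction k) (auto dest: ideal_power_mult_mem)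

lemma ideal_power_ideal_power: "ideal_power (ideal_power J m) i \<subseteq> ideal_power J (m * i)"
proof (induction i)
  case (Suc i)
  show ?case
  proof
    fix f assume "f \<in> ideal_power (ideal_power J m) (Suc i)"
    then show "f \<in> ideal_power J (m * Suc i)" unfolding ideal_power.simps
    proof (rule ideal_mult_induct)
      fix a b assume "a \<in> ideal_power J m" "b \<in> ideal_power (ideal_power J m) i"
      then show "a * b \<in> ideal_power J (m * Suc i)"
        using ideal_power_mult_mem[of a J m b "m * i"] Suc by (auto simp: add.commute)
    qed (rule subspace_ideal_power)
  qed
qed simp

text \<open>Applied to the filtrations by order of vanishing.\<close>

lemma ideal_power_subset_filtration:
  assumes "\<And>c. ring_mod.subspace (F c)" "F 0 = UNIV" "J \<subseteq> F d"
    and "\<And>a b f g. f \<in> F a \<Longrightarrow> g \<in> F b \<Longrightarrow> f * g \<in> F (a + b)"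
  shows "ideal_power J m \<subseteq> F (m * d :: nat)"
proof (induction m)
  case (Suc m)
  show ?case
  proof
    fix f assume "f \<in> ideal_power J (Suc m)"
    then show "f \<in> F (Suc m * d)" unfolding ideal_power.simps
    proof (rule ideal_mult_induct)
      fix a b assume "a \<in> J" "b \<in> ideal_power J m"
      then show "a * b \<in> F (Suc m * d)" using assms(4)[of a d b "m * d"] assms(3) Suc by auto
    qed (rule assms(1))
  qed
qed (simp add: assms)

lemma ideal_power_stable:
  assumes "stable J" shows "stable (ideal_power J m)"
proof -
  have D: "dirderiv Z f \<in> ideal_power J m" if "\<And>f. f \<in> J \<Longrightarrow> dirderiv Z f \<in> J" "f \<in> ideal_power J m" for Z f
    using that(2)
  proof (induction m arbitrary: f)
    case (Suc m)
    have sub: "ring_mod.subspace {f. f \<in> ideal_mult J (ideal_power J m) \<and> dirderiv Z f \<in> ideal_mult J (ideal_power J m)}"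
    proof (rule ring_mod.subspaceI)
      note S = subspace_ideal_power[of J "Suc m", unfolded ideal_power.simps]
      fix c x assume "x \<in> {f. f \<in> ideal_mult J (ideal_power J m) \<and> dirderiv Z f \<in> ideal_mult J (ideal_power J m)}"
      then show "c * x \<in> {f. f \<in> ideal_mult J (ideal_power J m) \<and> dirderiv Z f \<in> ideal_mult J (ideal_power J m)}"
        using ring_mod.subspace_scale[OF S] ring_mod.subspace_add[OF S]
        by (simp add: dirderiv_mult)
    qed (use subspace_ideal_power[of J "Suc m"] in \<open>auto simp: ring_mod.subspace_0 ring_mod.subspace_add dirderiv_add\<close>)
    have "f \<in> {f. f \<in> ideal_mult J (ideal_power J m) \<and> dirderiv Z f \<in> ideal_mult J (ideal_power J m)}"
      using Suc.prems unfolding ideal_power.simps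
    proof (rule ideal_mult_induct[OF _ sub])
      fix a b assume ab: "a \<in> J" "b \<in> ideal_power J m"
      then show "a * b \<in> {f. f \<in> ideal_mult J (ideal_power J m) \<and> dirderiv Z f \<in> ideal_mult J (ideal_power J m)}"
        using ring_mod.subspace_add[OF subspace_ideal_power[of J "Suc m"]] Suc.IH that(1)
        by (auto simp: dirderiv_mult ideal_mult_mem)
    qed
    then show ?case by simp
  qed simp
  show ?thesis
    by (rule stable_idealI[OF subspace_ideal_power])
      (use assms in \<open>auto simp: rowpol_def colpol_def stable_def intro!: D\<close>)
qed

section \<open>The ideals of Young diagrams\<close>

lemma subspace_inv_ideal: "ring_mod.subspace (inv_ideal \<sigma>)"
  unfolding inv_ideal_def by (rule ring_mod.subspace_Inter) auto

lemma GL_invariant_inv_ideal: "GL_invariant (inv_ideal \<sigma>)"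
  unfolding inv_ideal_def GL_invariant_def by blast

lemma K_diagram_mem_inv_ideal: "K_diagram \<sigma> \<in> inv_ideal \<sigma>"
  unfolding inv_ideal_def by blast

lemma inv_ideal_subset: "ring_mod.subspace J \<Longrightarrow> GL_invariant J \<Longrightarrow> K_diagram \<sigma> \<in> J \<Longrightarrow> inv_ideal \<sigma> \<subseteq> J"
  unfolding inv_ideal_def by blast

lemma subspace_inv_ideal_sum:
  "ring_mod.subspace (inv_ideal_sum \<Sigma> :: ('r::{finite,linorder}, 'n::{finite,linorder}, 'k::field_char_0) matpoly set)"
proof (rule ring_mod.subspaceI)
  show "0 \<in> inv_ideal_sum \<Sigma>" unfolding inv_ideal_sum_def
    using ring_mod.subspace_0[OF subspace_inv_ideal]
    by (auto intro!: exI[of _ "\<lambda>_. 0"])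
next
  fix x y :: "('r, 'n, 'k) matpoly" assume "x \<in> inv_ideal_sum \<Sigma>" "y \<in> inv_ideal_sum \<Sigma>"
  then obtain g h where "x = (\<Sum>\<sigma>\<in>\<Sigma>. g \<sigma>)" "\<forall>\<sigma>\<in>\<Sigma>. g \<sigma> \<in> inv_ideal \<sigma>" "y = (\<Sum>\<sigma>\<in>\<Sigma>. h \<sigma>)" "\<forall>\<sigma>\<in>\<Sigma>. h \<sigma> \<in> inv_ideal \<sigma>"
    unfolding inv_ideal_sum_def by blast
  then show "x + y \<in> inv_ideal_sum \<Sigma>" unfolding inv_ideal_sum_def
    by (auto intro!: exI[of _ "\<lambda>\<sigma>. g \<sigma> + h \<sigma>"] simp: sum.distrib ring_mod.subspace_add[OF subspace_inv_ideal])
next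
  fix c x :: "('r, 'n, 'k) matpoly" assume "x \<in> inv_ideal_sum \<Sigma>"
  then obtain g where "x = (\<Sum>\<sigma>\<in>\<Sigma>. g \<sigma>)" "\<forall>\<sigma>\<in>\<Sigma>. g \<sigma> \<in> inv_ideal \<sigma>"
    unfolding inv_ideal_sum_def by blast
  then show "c * x \<in> inv_ideal_sum \<Sigma>" unfolding inv_ideal_sum_def
    by (auto intro!: exI[of _ "\<lambda>\<sigma>. c * g \<sigma>"] simp: sum_distrib_left ring_mod.subspace_scale[OF subspace_inv_ideal])
qed

lemma stable_inv_ideal_sum:
  "stable (inv_ideal_sum \<Sigma> :: ('r::{finite,linorder}, 'n::{finite,linorder}, 'k::field_char_0) matpoly set)"
proof (rule stable_idealI[OF subspace_inv_ideal_sum])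
  have st: "stable (inv_ideal \<sigma> :: ('r, 'n, 'k) matpoly set)" for \<sigma>
    by (rule GL_invariant_stable[OF subspace_inv_ideal GL_invariant_inv_ideal])
  fix f :: "('r, 'n, 'k) matpoly" assume "f \<in> inv_ideal_sum \<Sigma>"
  then obtain g where g: "f = (\<Sum>\<sigma>\<in>\<Sigma>. g \<sigma>)" "\<forall>\<sigma>\<in>\<Sigma>. g \<sigma> \<in> inv_ideal \<sigma>"
    unfolding inv_ideal_sum_def by blast
  show "rowpol a b f \<in> inv_ideal_sum \<Sigma>" for a b
    unfolding inv_ideal_sum_def g(1) using g(2) stableD(4)[OF st]
    by (auto intro!: exI[of _ "\<lambda>\<sigma>. rowpol a b (g \<sigma>)"] simp: rowpol_def dirderiv_sum)
  show "colpol a b f \<in> inv_ideal_sum \<Sigma>" for a b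
    unfolding inv_ideal_sum_def g(1) using g(2) stableD(5)[OF st]
    by (auto intro!: exI[of _ "\<lambda>\<sigma>. colpol a b (g \<sigma>)"] simp: colpol_def dirderiv_sum)
qed

lemma inv_ideal_subset_sum: "finite \<Sigma> \<Longrightarrow> \<sigma> \<in> \<Sigma> \<Longrightarrow> inv_ideal \<sigma> \<subseteq> inv_ideal_sum \<Sigma>"
proof
  fix f assume "finite \<Sigma>" "\<sigma> \<in> \<Sigma>" "f \<in> inv_ideal \<sigma>"
  then show "f \<in> inv_ideal_sum \<Sigma>" unfolding inv_ideal_sum_def
    using ring_mod.subspace_0[OF subspace_inv_ideal]
    by (auto intro!: exI[of _ "\<lambda>\<tau>. if \<tau> = \<sigma> then f else 0"])
qed

lemma inv_ideal_sum_subset: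
  assumes "ring_mod.subspace J" "\<And>\<sigma>. \<sigma> \<in> \<Sigma> \<Longrightarrow> inv_ideal \<sigma> \<subseteq> J"
  shows "inv_ideal_sum \<Sigma> \<subseteq> J"
  unfolding inv_ideal_sum_def using assms by (auto intro!: ring_mod.subspace_sum)

lemma K_diagram_eq_Kprod:
  fixes \<sigma> :: "nat list"
  assumes "\<sigma> \<in> diagrams CARD('r)"
  shows "(K_diagram \<sigma> :: ('r::{finite,linorder}, 'n::{finite,linorder}, 'k::field_char_0) matpoly) = Kprod (count_list \<sigma>)"
proof -
  have sub: "set \<sigma> \<subseteq> {1..CARD('r)}" using assms unfolding diagrams_def young_diagram_def by (auto simp: Suc_le_eq)
  have "prod_list (map g \<sigma>) = (\<Prod>t\<in>S. g t ^ count_list \<sigma> t)" if "set \<sigma> \<subseteq> S" "finite S" for g :: "nat \<Rightarrow> ('r, 'n, 'k) matpoly" and S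
    using that(1)
  proof (induction \<sigma>)
    case (Cons s \<sigma>)
    have "(\<Prod>t\<in>S. g t ^ count_list (s # \<sigma>) t) = (\<Prod>t\<in>S. (if t = s then g s else 1) * g t ^ count_list \<sigma> t)"
      by (intro prod.cong) auto
    also have "\<dots> = g s * (\<Prod>t\<in>S. g t ^ count_list \<sigma> t)"
      using Cons.prems that(2) by (simp add: prod.distrib)
    finally show ?case using Cons by simp
  qed simp
  from this[OF sub] show ?thesis by (simp add: K_diagram_def Kprod_def)
qed

text \<open>
  The invariant \<open>\<gamma>\<^sub>j\<close> of the diagram with \<open>e t\<close> rows of length \<open>t \<le> r\<close>. Subtraction truncates.
\<close>

definition gamma_exp :: "nat \<Rightarrow> nat \<Rightarrow> (nat \<Rightarrow> nat) \<Rightarrow> nat" where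
  "gamma_exp r j e = (\<Sum>t\<in>{1..r}. e t * (t + 1 - j))"

lemma gamma_diagram_eq_gamma_exp:
  assumes "\<sigma> \<in> diagrams r" shows "gamma_diagram j \<sigma> = gamma_exp r j (count_list \<sigma>)"
proof -
  have sub: "set \<sigma> \<subseteq> {1..r}" using assms unfolding diagrams_def young_diagram_def by (auto simp: Suc_le_eq)
  have "sum_list (map g \<sigma>) = (\<Sum>t\<in>S. count_list \<sigma> t * g t)" if "set \<sigma> \<subseteq> S" "finite S" for g :: "nat \<Rightarrow> nat" and S
    using that(1)
  proof (induction \<sigma>)
    case (Cons s \<sigma>)
    have "(\<Sum>t\<in>S. count_list (s # \<sigma>) t * g t) = (\<Sum>t\<in>S. (if t = s then g s else 0) + count_list \<sigma> t * g t)"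
      by (intro sum.cong) auto
    also have "\<dots> = g s + (\<Sum>t\<in>S. count_list \<sigma> t * g t)"
      using Cons.prems that(2) by (simp add: sum.distrib)
    finally show ?case using Cons by simp
  qed simp
  from this[OF sub] show ?thesis by (simp add: gamma_diagram_def gamma_exp_def)
qed

lemma Kprod_mult: "Kprod e * Kprod e' = Kprod (\<lambda>t. e t + e' t)"
  by (simp add: Kprod_def power_add prod.distrib)

lemma Kprod_power: "Kprod e ^ k = Kprod (\<lambda>t. e t * k)"
  by (simp add: Kprod_def power_mult prod_power_distrib)

section \<open>Order of vanishing along matrices of bounded rank\<close>

text \<open>
  The determinant of \<open>Y Z + x C\<close>, with \<open>Y Z\<close> of rank at most \<open>q\<close>, is that of the block matrix with rows
  \<open>(1, Z)\<close> and \<open>(- Y, x C)\<close>. Multiplying its first \<open>q\<close> rows by \<open>x\<close> gives the same matrix as multiplying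
  the last \<open>t\<close> columns of the block matrix with rows \<open>(x, Z)\<close> and \<open>(- Y, C)\<close> by \<open>x\<close>, so \<open>x\<^sup>q\<close> times the
  determinant is divisible by \<open>x\<^sup>t\<close>.
\<close>

lemma det_rank_pencil:
  fixes Y Z C :: "nat \<Rightarrow> nat \<Rightarrow> 'b::idom" and x :: 'b
  assumes x: "x \<noteq> 0"
  shows "x ^ (t - q) dvd Determinant.det (Matrix.mat t t (\<lambda>(i, j). (\<Sum>a<q. Y i a * Z a j) + x * C i j))"
    (is "_ dvd Determinant.det ?M")
proof (cases "q \<le> t")
  case True
  define Ym where "Ym = Matrix.mat t q (\<lambda>(i, a). - Y i a)"
  define Zm where "Zm = Matrix.mat q t (\<lambda>(a, j). Z a j)"
  define Cm where "Cm = Matrix.mat t t (\<lambda>(i, j). C i j)"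
  have car: "Ym \<in> carrier_mat t q" "Zm \<in> carrier_mat q t" "Cm \<in> carrier_mat t t"
    by (simp_all add: Ym_def Zm_def Cm_def)
  have M: "?M \<in> carrier_mat t t" by simp
  define N where "N = four_block_mat (1\<^sub>m q) Zm Ym (x \<cdot>\<^sub>m Cm)"
  have N: "N \<in> carrier_mat (q + t) (q + t)" unfolding N_def using car by (intro four_block_carrier_mat) auto
  have e: "Ym * Zm + ?M = x \<cdot>\<^sub>m Cm"
    by (rule eq_matI)
      (auto simp: Ym_def Zm_def Cm_def scalar_prod_def sum_negf lessThan_atLeast0)
  have N1: "N = four_block_mat (1\<^sub>m q) (0\<^sub>m q t) Ym (1\<^sub>m t) * four_block_mat (1\<^sub>m q) Zm (0\<^sub>m t q) ?M"
    unfolding N_def using car M e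
    by (subst mult_four_block_mat[of _ q q _ t _ t _ _ q _ t]) auto
  have "Determinant.det N = Determinant.det (four_block_mat (1\<^sub>m q) (0\<^sub>m q t) Ym (1\<^sub>m t))
      * Determinant.det (four_block_mat (1\<^sub>m q) Zm (0\<^sub>m t q) ?M)"
    unfolding N1 using car by (intro det_mult[where n = "q + t"] four_block_carrier_mat) auto
  also have "Determinant.det (four_block_mat (1\<^sub>m q) (0\<^sub>m q t) Ym (1\<^sub>m t)) = 1"
    using car by (subst det_four_block_mat_upper_right_zero[where n = q and m = t]) auto
  also have "Determinant.det (four_block_mat (1\<^sub>m q) Zm (0\<^sub>m t q) ?M) = Determinant.det ?M"
    using car by (subst det_four_block_mat_lower_left_zero[where n = q and m = t]) auto
  finally have detN: "Determinant.det N = Determinant.det ?M" by simp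
  define L where "L = four_block_mat (x \<cdot>\<^sub>m 1\<^sub>m q) (0\<^sub>m q t) (0\<^sub>m t q) (1\<^sub>m t)"
  define P where "P = four_block_mat (x \<cdot>\<^sub>m 1\<^sub>m q) Zm Ym Cm"
  define D where "D = four_block_mat (1\<^sub>m q) (0\<^sub>m q t) (0\<^sub>m t q) (x \<cdot>\<^sub>m 1\<^sub>m t)"
  have LPD: "L \<in> carrier_mat (q + t) (q + t)" "P \<in> carrier_mat (q + t) (q + t)" "D \<in> carrier_mat (q + t) (q + t)"
    unfolding L_def P_def D_def using car by (auto intro!: four_block_carrier_mat)
  have "L * N = four_block_mat (x \<cdot>\<^sub>m 1\<^sub>m q) (x \<cdot>\<^sub>m Zm) Ym (x \<cdot>\<^sub>m Cm)"
  proof -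
    have "x \<cdot>\<^sub>m 1\<^sub>m q * Zm + 0\<^sub>m q t = x \<cdot>\<^sub>m Zm"
      using car(2) by (subst mult_smult_assoc_mat[of _ q q _ t]) auto
    then show ?thesis unfolding L_def N_def using car
      by (subst mult_four_block_mat[of _ q q _ t _ t _ _ q _ t]) auto
  qed
  moreover have "P * D = four_block_mat (x \<cdot>\<^sub>m 1\<^sub>m q) (x \<cdot>\<^sub>m Zm) Ym (x \<cdot>\<^sub>m Cm)"
    unfolding P_def D_def using car
    by (subst mult_four_block_mat[of _ q q _ t _ t _ _ q _ t]) (auto simp: mult_smult_distrib[where n = t])
  ultimately have "Determinant.det L * Determinant.det N = Determinant.det P * Determinant.det D"
    using det_mult[OF LPD(1) N] det_mult[OF LPD(2,3)] by simp
  moreover have "Determinant.det L = x ^ q"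
    unfolding L_def by (subst det_four_block_mat_upper_right_zero[where n = q and m = t]) auto
  moreover have "Determinant.det D = x ^ t"
    unfolding D_def by (subst det_four_block_mat_upper_right_zero[where n = q and m = t]) auto
  ultimately have "x ^ q * Determinant.det ?M = Determinant.det P * x ^ t" using detN by simp
  also have "x ^ t = x ^ q * x ^ (t - q)" using True by (simp add: power_add[symmetric])
  finally have "x ^ q * Determinant.det ?M = x ^ q * (x ^ (t - q) * Determinant.det P)" by (simp add: mult_ac)
  then have "Determinant.det ?M = x ^ (t - q) * Determinant.det P" using x by simp
  then show ?thesis by simp
qed simp

text \<open>
  The line \<open>Y Z + x C\<close> through a matrix of rank at most \<open>q\<close>, as a matrix of polynomials in \<open>x\<close>.
\<close>

definition pencil :: "nat \<Rightarrow> ('r \<Rightarrow> nat \<Rightarrow> 'b::comm_ring_1) \<Rightarrow> (nat \<Rightarrow> 'n \<Rightarrow> 'b) \<Rightarrow> ('r \<Rightarrow> 'n \<Rightarrow> 'b) \<Rightarrow> 'r \<Rightarrow> 'n \<Rightarrow> 'b poly" where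
  "pencil q Y Z C i j = [: \<Sum>a<q. Y i a * Z a j, C i j :]"

text \<open>
  Scalars as constants of \<open>k[\<tau>][x]\<close>; the outer variable is \<open>x\<close>.
\<close>

definition const2 :: "'k::field_char_0 \<Rightarrow> 'k poly poly" where
  "const2 c = [:[:c:]:]"

lemma const2_hom: "comm_ring_hom const2"
  unfolding const2_def by (rule hom_comp[OF pCons_const_hom pCons_const_hom])

text \<open>
  The polynomials vanishing to order at least \<open>c\<close> along the matrices of rank at most \<open>q\<close>, where the order is
  tested along lines. The matrices may depend on a parameter \<open>\<tau>\<close>, which later allows a general matrix of
  rank \<open>q\<close> to be reached by joining two special ones.
\<close>

definition order_ideal :: "nat \<Rightarrow> nat \<Rightarrow> ('r::{finite,linorder}, 'n::{finite,linorder}, 'k::field_char_0) matpoly set" where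
  "order_ideal q c = {f. \<forall>Y Z C. [:0, 1:] ^ c dvd peval const2 (pencil q Y Z C) f}"

lemma subspace_order_ideal: "ring_mod.subspace (order_ideal q c)"
  by (rule ring_mod.subspaceI) (auto simp: order_ideal_def peval_add[OF const2_hom] peval_mult[OF const2_hom])

lemma order_ideal_0: "order_ideal q 0 = UNIV"
  by (simp add: order_ideal_def)

lemma order_ideal_mult: "f \<in> order_ideal q a \<Longrightarrow> g \<in> order_ideal q b \<Longrightarrow> f * g \<in> order_ideal q (a + b)"
  by (auto simp: order_ideal_def peval_mult[OF const2_hom] power_add mult_dvd_mono)

lemma order_ideal_antimono: "a \<le> b \<Longrightarrow> f \<in> order_ideal q b \<Longrightarrow> f \<in> order_ideal q a"
  unfolding order_ideal_def by (auto intro: dvd_trans[OF le_imp_power_dvd])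

lemma order_ideal_rank_mono:
  assumes "q' \<le> q" "f \<in> order_ideal q c" shows "f \<in> order_ideal q' c"
  unfolding order_ideal_def
proof (clarify)
  fix Y :: "'a \<Rightarrow> nat \<Rightarrow> 'c poly" and Z and C
  have *: "(\<Sum>a<q. (if a < q' then Y i a else 0) * Z a j) = (\<Sum>a<q'. Y i a * Z a j)" for i and j :: 'b
    using assms(1) by (intro sum.mono_neutral_cong_right) auto
  have "[:0, 1:] ^ c dvd peval const2 (pencil q (\<lambda>i a. if a < q' then Y i a else 0) Z C) f"
    using assms(2) unfolding order_ideal_def by blast
  also have "pencil q (\<lambda>i a. if a < q' then Y i a else 0) Z C = pencil q' Y Z C"
    by (intro ext) (simp only: pencil_def *)
  finally show "[:0, 1:] ^ c dvd peval const2 (pencil q' Y Z C) f" .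
qed

lemma sum_linear_poly: "(\<Sum>b\<in>A. [:f b, g b:]) = [:\<Sum>b\<in>A. f b, \<Sum>b\<in>A. g b:]"
  by (induction A rule: infinite_finite_induct) auto

text \<open>The group maps a line \<open>Y Z + x C\<close> to another one of the same kind.\<close>

lemma GL_invariant_order_ideal: "GL_invariant (order_ideal q c)"
  unfolding GL_invariant_def
proof (intro allI impI ballI)
  fix A :: "('r::{finite,linorder}, 'r, 'k::field_char_0) matrix" and B :: "('n::{finite,linorder}, 'n, 'k) matrix"
    and f :: "('r, 'n, 'k) matpoly"
  assume f: "f \<in> order_ideal q c"
  define G where "G i a = vec_nth (vec_nth (matrix_inv A) i) a" for i a
  define H where "H b j = vec_nth (vec_nth B b) j" for b j
  show "GL_action A B f \<in> order_ideal q c"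
    unfolding order_ideal_def
  proof clarify
    fix Y :: "'r \<Rightarrow> nat \<Rightarrow> 'k poly" and Z :: "nat \<Rightarrow> 'n \<Rightarrow> 'k poly" and C :: "'r \<Rightarrow> 'n \<Rightarrow> 'k poly"
    define Y' where "Y' i a = (\<Sum>i'\<in>UNIV. [:G i i':] * Y i' a)" for i a
    define Z' where "Z' a j = (\<Sum>b\<in>UNIV. Z a b * [:H b j:])" for a j
    define C' where "C' i j = (\<Sum>b\<in>UNIV. (\<Sum>i'\<in>UNIV. [:G i i':] * C i' b) * [:H b j:])" for i j
    have YZ: "(\<Sum>b\<in>UNIV. (\<Sum>i'\<in>UNIV. [:G i i':] * (\<Sum>a<q. Y i' a * Z a b)) * [:H b j:]) = (\<Sum>a<q. Y' i a * Z' a j)" for i j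
    proof -
      have "(\<Sum>a<q. Y' i a * Z' a j) = (\<Sum>a<q. \<Sum>i'\<in>UNIV. \<Sum>b\<in>UNIV. [:G i i':] * Y i' a * (Z a b * [:H b j:]))"
        unfolding Y'_def Z'_def sum_product ..
      also have "\<dots> = (\<Sum>b\<in>UNIV. \<Sum>i'\<in>UNIV. \<Sum>a<q. [:G i i':] * Y i' a * (Z a b * [:H b j:]))"
        by (subst sum.swap, subst sum.swap[of _ UNIV UNIV], intro sum.cong refl)
          (rule sum.swap)
      also have "\<dots> = (\<Sum>b\<in>UNIV. (\<Sum>i'\<in>UNIV. [:G i i':] * (\<Sum>a<q. Y i' a * Z a b)) * [:H b j:])"
        unfolding sum_distrib_left sum_distrib_right by (simp only: mult.assoc)
      finally show ?thesis by simp
    qed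
    have P: "(\<Sum>b\<in>UNIV. (\<Sum>a\<in>UNIV. const2 (G i a) * pencil q Y Z C a b) * const2 (H b j)) = pencil q Y' Z' C' i j" for i j
    proof -
      have 1: "const2 u * [:v, w:] = [:[:u:] * v, [:u:] * w:]" for u :: 'k and v w by (simp add: const2_def)
      have 2: "[:v, w:] * const2 u = [:v * [:u:], w * [:u:]:]" for u :: 'k and v w by (simp add: const2_def mult.commute)
      show ?thesis unfolding pencil_def 1 sum_linear_poly 2 YZ C'_def ..
    qed
    have "peval const2 (pencil q Y Z C) (GL_action A B f) = peval const2 (pencil q Y' Z' C') f"
    proof -
      interpret p: comm_ring_hom "peval const2 (pencil q Y Z C)" by (rule peval_hom[OF const2_hom])
      show ?thesis
        unfolding GL_action_peval G_def[symmetric] H_def[symmetric]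
        by (subst hom_peval[OF p.comm_ring_hom_axioms const_poly_hom])
          (simp add: p.hom_sum p.hom_mult peval_const[OF const2_hom] peval_var[OF const2_hom] P)
    qed
    then show "[:0, 1:] ^ c dvd peval const2 (pencil q Y Z C) (GL_action A B f)"
      using f unfolding order_ideal_def by simp
  qed
qed

lemma stable_order_ideal: "stable (order_ideal q c)"
  by (rule GL_invariant_stable[OF subspace_order_ideal GL_invariant_order_ideal])

lemma minor_mem_order_ideal:
  assumes "length rs = t" "length cs = t"
  shows "minor rs cs \<in> order_ideal q (t - q)"
  unfolding order_ideal_def
proof clarify
  fix Y :: "'a \<Rightarrow> nat \<Rightarrow> 'c poly" and Z :: "nat \<Rightarrow> 'b \<Rightarrow> 'c poly" and C
  have "peval const2 (pencil q Y Z C) (minor rs cs)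
      = Determinant.det (Matrix.mat t t (\<lambda>(a, b). pencil q Y Z C (rs ! a) (cs ! b)))"
    using assms by (simp add: peval_generic_minor[OF const2_hom])
  also have "(\<lambda>(a, b). pencil q Y Z C (rs ! a) (cs ! b))
     = (\<lambda>(i, j). (\<Sum>a<q. [:Y (rs ! i) a:] * [:Z a (cs ! j):]) + [:0, 1:] * [:C (rs ! i) (cs ! j):])"
  proof -
    have "(\<Sum>a<q. [:Y i a:] * [:Z a j:]) = [:\<Sum>a<q. Y i a * Z a j:]" for i j
      by (induction q) (simp_all add: mult.commute)
    then show ?thesis by (intro ext) (auto simp: pencil_def)
  qed
  finally show "[:0, 1:] ^ (t - q) dvd peval const2 (pencil q Y Z C) (minor rs cs)"
    by (rule ssubst) (rule det_rank_pencil, simp)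
qed

lemma leading_minor_mem_order_ideal:
  assumes "t \<le> CARD('r)" "CARD('r) \<le> CARD('n)"
  shows "(leading_minor t :: ('r::{finite,linorder}, 'n::{finite,linorder}, 'k::field_char_0) matpoly) \<in> order_ideal q (t - q)"
  unfolding leading_minor_def using assms by (intro minor_mem_order_ideal) auto

lemma order_ideal_power: "f \<in> order_ideal q a \<Longrightarrow> f ^ k \<in> order_ideal q (k * a)"
  by (induction k) (auto simp: order_ideal_0 intro: order_ideal_mult)

lemma order_ideal_prod: "(\<And>i. i \<in> A \<Longrightarrow> f i \<in> order_ideal q (a i)) \<Longrightarrow> prod f A \<in> order_ideal q (sum a A)"
  by (induction A rule: infinite_finite_induct) (auto simp: order_ideal_0 intro: order_ideal_mult)

lemma gamma_exp_Suc: "gamma_exp r (Suc q) e = (\<Sum>t\<in>{1..r}. e t * (t - q))"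
  by (simp add: gamma_exp_def)

lemma Kprod_mem_order_ideal:
  assumes "CARD('r) \<le> CARD('n)"
  shows "(Kprod e :: ('r::{finite,linorder}, 'n::{finite,linorder}, 'k::field_char_0) matpoly) \<in> order_ideal q (gamma_exp CARD('r) (Suc q) e)"
  unfolding Kprod_def gamma_exp_Suc using assms
  by (intro order_ideal_prod order_ideal_power leading_minor_mem_order_ideal) auto

lemma map_poly_comm_ring_hom:
  assumes "comm_ring_hom h" shows "comm_ring_hom (map_poly h)"
proof -
  interpret h: comm_ring_hom h by fact
  show ?thesis
    by unfold_locales (auto intro!: poly_eqI simp: coeff_map_poly coeff_mult h.hom_add h.hom_sum h.hom_mult map_poly_1)
qed

lemma order_prod_le:
  fixes g :: "'i \<Rightarrow> 'b::idom poly"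
  assumes "finite S" "\<And>i. i \<in> S \<Longrightarrow> g i \<noteq> 0" "\<And>i. i \<in> S \<Longrightarrow> order 0 (g i) \<le> b i"
  shows "order 0 (\<Prod>i\<in>S. g i ^ e i) \<le> (\<Sum>i\<in>S. e i * b i)"
proof -
  have pw: "order 0 (g i ^ k) \<le> k * b i" if "i \<in> S" for i k
    using assms(2,3)[OF that] by (induction k) (auto simp: order_mult)
  show ?thesis using assms(1) assms(2) pw
  proof (induction S rule: finite_induct)
    case (insert i S)
    have nz: "g i ^ e i * (\<Prod>i\<in>S. g i ^ e i) \<noteq> 0" using insert by simp
    have "order 0 (\<Prod>i\<in>S. g i ^ e i) \<le> (\<Sum>i\<in>S. e i * b i)" by (rule insert.IH) (use insert.prems in auto)
    moreover have "order 0 (g i ^ e i) \<le> e i * b i" using insert.prems by simp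
    ultimately show ?case using insert.hyps nz by (simp add: order_mult)
  qed simp
qed

lemma X_dvd_iff: "[:0, 1 :: 'b::comm_ring_1:] dvd p \<longleftrightarrow> poly p 0 = 0"
  using poly_eq_0_iff_dvd[of p 0] by simp

text \<open>Specializing the parameter is possible as the field is infinite.\<close>

lemma not_in_order_ideal_1_point:
  fixes s :: "('r::{finite,linorder}, 'n::{finite,linorder}, 'k::field_char_0) matpoly"
  assumes "s \<notin> order_ideal q 1"
  obtains y z where "peval (\<lambda>c. c) (\<lambda>i j. \<Sum>a<q. y i a * z a j) s \<noteq> 0"
proof -
  obtain Y Z C where "\<not> [:0, 1:] dvd peval const2 (pencil q Y Z C) s"
    using assms unfolding order_ideal_def by auto
  then have "poly (peval const2 (pencil q Y Z C) s) 0 \<noteq> 0" by (simp only: X_dvd_iff not_False_eq_True)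
  then obtain \<tau> where "poly (poly (peval const2 (pencil q Y Z C) s) 0) \<tau> \<noteq> 0"
    using poly_all_0_iff_0 by blast
  also have "poly (poly (peval const2 (pencil q Y Z C) s) 0) \<tau>
      = peval (\<lambda>c. c) (\<lambda>i j. \<Sum>a<q. poly (Y i a) \<tau> * poly (Z a j) \<tau>) s"
    by (subst hom_peval[OF hom_comp[OF poly_at_hom poly_at_hom] const2_hom])
      (simp add: const2_def pencil_def poly_sum del: mult_pCons_left mult_pCons_right)
  finally show thesis by (rule that)
qed

lemma in_order_ideal_1_vanishes:
  fixes s :: "('r::{finite,linorder}, 'n::{finite,linorder}, 'k::field_char_0) matpoly"
  assumes "s \<in> order_ideal q 1"
  shows "peval (\<lambda>c. c) (\<lambda>i j. \<Sum>a<q. y i a * z a j) s = 0"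
proof -
  have "[:0, 1:] dvd peval const2 (pencil q (\<lambda>i a. [:y i a:]) (\<lambda>a j. [:z a j:]) (\<lambda>_ _. 0)) s"
    using assms unfolding order_ideal_def by auto
  then have "poly (poly (peval const2 (pencil q (\<lambda>i a. [:y i a:]) (\<lambda>a j. [:z a j:]) (\<lambda>_ _. 0)) s) 0) 0 = 0"
    by (simp only: X_dvd_iff poly_0)
  also have "poly (poly (peval const2 (pencil q (\<lambda>i a. [:y i a:]) (\<lambda>a j. [:z a j:]) (\<lambda>_ _. 0)) s) 0) 0
      = peval (\<lambda>c. c) (\<lambda>i j. \<Sum>a<q. y i a * z a j) s"
    by (subst hom_peval[OF hom_comp[OF poly_at_hom poly_at_hom] const2_hom])
      (simp add: const2_def pencil_def poly_sum del: mult_pCons_left mult_pCons_right)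
  finally show ?thesis .
qed

text \<open>
  The matrices of rank at most \<open>q\<close> are connected by the curves \<open>Y(\<tau>) Z(\<tau>)\<close> with \<open>Y\<close> and \<open>Z\<close> linear in
  \<open>\<tau>\<close>. On the curve that joins a point where \<open>f\<close> is nonzero to one where \<open>g\<close> is nonzero, both are nonzero
  polynomials in \<open>\<tau>\<close>.
\<close>

lemma order_ideal_1_prime:
  fixes f g :: "('r::{finite,linorder}, 'n::{finite,linorder}, 'k::field_char_0) matpoly"
  assumes "f \<notin> order_ideal q 1" "g \<notin> order_ideal q 1"
  shows "f * g \<notin> order_ideal q 1"
proof
  assume fg: "f * g \<in> order_ideal q 1"
  have id: "comm_ring_hom (\<lambda>c::'k. c)" by unfold_locales auto
  obtain y z where yz: "peval (\<lambda>c. c) (\<lambda>i j. \<Sum>a<q. y i a * z a j) f \<noteq> 0"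
    using not_in_order_ideal_1_point[OF assms(1)] by blast
  obtain y' z' where yz': "peval (\<lambda>c. c) (\<lambda>i j. \<Sum>a<q. y' i a * z' a j) g \<noteq> 0"
    using not_in_order_ideal_1_point[OF assms(2)] by blast
  \<comment> \<open>the product of two lines, through \<open>Y Z\<close> at \<open>0\<close> and through \<open>Y' Z'\<close> at \<open>1\<close>\<close>
  define L where "L i j = (\<Sum>a<q. [:y i a, y' i a - y i a:] * [:z a j, z' a j - z a j:])" for i j
  have at: "poly (peval (\<lambda>c. [:c:]) L h) \<tau>
      = peval (\<lambda>c. c) (\<lambda>i j. \<Sum>a<q. (y i a + \<tau> * (y' i a - y i a)) * (z a j + \<tau> * (z' a j - z a j))) h" for \<tau> h
    by (subst hom_peval[OF poly_at_hom pCons_const_hom]) (simp add: L_def poly_sum del: mult_pCons_left mult_pCons_right)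
  have "peval (\<lambda>c. [:c:]) L f \<noteq> 0" using at[of f 0] yz by auto
  moreover have "peval (\<lambda>c. [:c:]) L g \<noteq> 0" using at[of g 1] yz' by auto
  ultimately have "peval (\<lambda>c. [:c:]) L (f * g) \<noteq> 0" by (simp add: peval_mult[OF pCons_const_hom])
  then obtain \<tau> where "poly (peval (\<lambda>c. [:c:]) L (f * g)) \<tau> \<noteq> 0" using poly_all_0_iff_0 by blast
  then show False unfolding at in_order_ideal_1_vanishes[OF fg] by simp
qed

text \<open>
  Join a matrix of rank at most \<open>q\<close> at which \<open>s\<close> is nonzero (\<open>\<tau> = 0\<close>) to the diagonal matrix with \<open>q\<close> ones
  (\<open>\<tau> = 1\<close>), and let \<open>C\<close> be the complementary diagonal matrix. Over \<open>k[\<tau>]\<close> the order in \<open>x\<close> of \<open>s\<close> along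
  \<open>Y Z + x C\<close> is \<open>0\<close>, as can be seen at \<open>\<tau> = 0\<close>. The order of \<open>\<Delta>\<^sub>t\<close> can only grow under the specialization
  \<open>\<tau> = 1\<close>, where \<open>\<Delta>\<^sub>t\<close> becomes \<open>x\<^bsup>t - q\<^esup>\<close>. Orders add up in products over a domain.
\<close>

lemma order_ideal_Kprod_bound:
  fixes s :: "('r::{finite,linorder}, 'n::{finite,linorder}, 'k::field_char_0) matpoly"
  assumes rn: "CARD('r) \<le> CARD('n)" and s: "s \<notin> order_ideal q 1" and sK: "s * Kprod e \<in> order_ideal q c"
  shows "c \<le> gamma_exp CARD('r) (Suc q) e"
proof -
  obtain y z where yz: "peval (\<lambda>c. c) (\<lambda>i j. \<Sum>a<q. y i a * z a j) s \<noteq> 0"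
    using not_in_order_ideal_1_point[OF s] by blast
  define Y where "Y i a = [:y i a, (if pos i = a then 1 else 0) - y i a:]" for i :: 'r and a
  define Z where "Z a j = [:z a j, (if pos j = a then 1 else 0) - z a j:]" for j :: 'n and a
  define C where "C i j = [:if pos i = pos j \<and> q \<le> pos i then 1 else 0 :: 'k:]" for i :: 'r and j :: 'n
  define F where "F = peval const2 (pencil q Y Z C)"
  interpret F: comm_ring_hom F unfolding F_def by (rule peval_hom[OF const2_hom])
  \<comment> \<open>evaluation at \<open>x = 0\<close>, then at \<open>\<tau> = 0\<close>\<close>
  have "poly (poly (F s) 0) 0 \<noteq> 0"
    unfolding F_def using yz
    by (subst hom_peval[OF hom_comp[OF poly_at_hom poly_at_hom] const2_hom])
      (simp add: const2_def pencil_def poly_sum Y_def Z_def del: mult_pCons_left mult_pCons_right)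
  then have Fs: "F s \<noteq> 0" "order 0 (F s) = 0" by (auto intro: order_0I)
  have Ft: "F (leading_minor t) \<noteq> 0 \<and> order 0 (F (leading_minor t)) \<le> t - q" if t: "t \<in> {1..CARD('r)}" for t
  proof -
    \<comment> \<open>specialization \<open>\<tau> = 1\<close>\<close>
    define \<psi> where "\<psi> = map_poly (\<lambda>p :: 'k poly. poly p 1)"
    have \<psi>: "comm_ring_hom \<psi>" unfolding \<psi>_def by (rule map_poly_comm_ring_hom[OF poly_at_hom])
    interpret \<psi>: comm_ring_hom \<psi> by fact
    have tr: "t \<le> CARD('r)" using t by simp
    define T where "T = Matrix.mat t t (\<lambda>(i, j). if i = j then if i < q then 1 else [:0, 1::'k:] else 0)"
    have "\<psi> (F (leading_minor t)) = peval (\<lambda>c. \<psi> (const2 c)) (\<lambda>i j. \<psi> (pencil q Y Z C i j)) (leading_minor t)"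
      unfolding F_def by (rule hom_peval[OF \<psi> const2_hom])
    also have "\<dots> = Determinant.det (Matrix.mat t t (\<lambda>(i, j). \<psi> (pencil q Y Z C (nth_elem i) (nth_elem j))))"
      by (rule peval_leading_minor[OF hom_comp[OF \<psi> const2_hom] tr rn])
    also have "Matrix.mat t t (\<lambda>(i, j). \<psi> (pencil q Y Z C (nth_elem i) (nth_elem j))) = T"
    proof (rule eq_matI)
      fix i j assume "i < dim_row T" "j < dim_col T"
      then have ij: "i < t" "j < t" by (simp_all add: T_def)
      then have p: "pos (nth_elem i :: 'r) = i" "pos (nth_elem j :: 'n) = j" using tr rn by (auto intro!: pos_nth_elem)
      have sm: "(\<Sum>a<q. (if i = a then 1 else 0) * (if j = a then 1 else 0 :: 'k)) = (if i = j \<and> i < q then 1 else 0)"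
      proof -
        have "(if i = a then 1 else 0) * (if j = a then 1 else 0 :: 'k) = (if a = i then if i = j then 1 else 0 else 0)" for a by auto
        then show ?thesis by (simp add: sum.delta)
      qed
      have "\<psi> (pencil q Y Z C (nth_elem i) (nth_elem j))
        = [:\<Sum>a<q. (if i = a then 1 else 0) * (if j = a then 1 else 0), if i = j \<and> q \<le> i then 1 else 0:]"
        using p by (simp add: \<psi>_def pencil_def map_poly_pCons poly_sum Y_def Z_def C_def del: mult_pCons_left mult_pCons_right)
      then show "Matrix.mat t t (\<lambda>(i, j). \<psi> (pencil q Y Z C (nth_elem i) (nth_elem j))) $$ (i, j) = T $$ (i, j)"
        using ij unfolding sm by (auto simp: T_def one_pCons)
    qed (simp_all add: T_def)
    also have "Determinant.det T = [:0, 1:] ^ (t - q)"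
    proof -
      have "Determinant.det T = (\<Prod>i = 0..<t. T $$ (i, i))"
        by (subst det_upper_triangular[of T t]) (auto simp: T_def prod_list_diag_prod)
      also have "\<dots> = (\<Prod>i = 0..<t. if i < q then 1 else [:0, 1:])" by (intro prod.cong) (auto simp: T_def)
      also have "\<dots> = (\<Prod>i \<in> {q..<t}. [:0, 1:])" by (intro prod.mono_neutral_cong_right) auto
      finally show ?thesis by simp
    qed
    finally have \<psi>F: "\<psi> (F (leading_minor t)) = [:0, 1:] ^ (t - q)" .
    then have nz: "F (leading_minor t) \<noteq> 0" by auto
    have "[:0, 1:] ^ order 0 (F (leading_minor t)) dvd F (leading_minor t)"
      using order_1[of 0 "F (leading_minor t)"] by simp
    then have "\<psi> ([:0, 1:] ^ order 0 (F (leading_minor t))) dvd \<psi> (F (leading_minor t))"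
      by (elim dvdE) (metis \<psi>.hom_mult dvd_triv_left)
    moreover have "\<psi> [:0, 1:] = [:0, 1:]" by (simp add: \<psi>_def map_poly_pCons)
    ultimately have "[:- 0, 1 :: 'k:] ^ order 0 (F (leading_minor t)) dvd [:- 0, 1:] ^ (t - q)"
      by (simp add: \<psi>F \<psi>.hom_power)
    then have "order 0 (F (leading_minor t)) \<le> t - q"
      unfolding order_divides order_power_n_n by simp
    with nz show ?thesis by simp
  qed
  have FK: "F (Kprod e) = (\<Prod>t\<in>{1..CARD('r)}. F (leading_minor t) ^ e t)"
    by (simp add: Kprod_def F.hom_prod F.hom_power)
  have FK0: "F (Kprod e) \<noteq> 0" unfolding FK using Ft by (subst prod_zero_iff) auto
  have "[:- 0, 1:] ^ c dvd F (s * Kprod e)" using sK unfolding order_ideal_def F_def by simp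
  then have "c \<le> order 0 (F s * F (Kprod e))"
    unfolding order_divides F.hom_mult using Fs FK0 by simp
  also have "\<dots> = order 0 (F (Kprod e))" using Fs FK0 by (simp add: order_mult)
  also have "\<dots> \<le> gamma_exp CARD('r) (Suc q) e"
    unfolding FK gamma_exp_Suc using Ft by (intro order_prod_le) auto
  finally show ?thesis .
qed

section \<open>Determinantal ideals\<close>

lemma minor_eq_det:
  "length rs = t \<Longrightarrow> length cs = t \<Longrightarrow>
    minor rs cs = Determinant.det (Matrix.mat t t (\<lambda>(a, b). var (rs ! a) (cs ! b)))"
  unfolding minor_def by (simp add: generic_matrix_nth)

text \<open>
  Minors of an arbitrary matrix, so that the statements about rows can be used for columns by exchanging
  the two arguments.
\<close>

definition gdet :: "('x \<Rightarrow> 'y \<Rightarrow> 'b::comm_ring_1) \<Rightarrow> 'x list \<Rightarrow> 'y list \<Rightarrow> 'b" where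
  "gdet B rs cs = Determinant.det (Matrix.mat (length rs) (length rs) (\<lambda>(a, b). B (rs ! a) (cs ! b)))"

lemma gdet_swap:
  assumes "length rs = length cs" shows "gdet B rs cs = gdet (\<lambda>j i. B i j) cs rs"
proof -
  have "Matrix.mat (length cs) (length cs) (\<lambda>(a, b). B (rs ! b) (cs ! a))
      = transpose_mat (Matrix.mat (length cs) (length cs) (\<lambda>(a, b). B (rs ! a) (cs ! b)))"
    by (rule eq_matI) auto
  then show ?thesis unfolding gdet_def assms
    by (simp only: det_transpose[OF mat_carrier])
qed

lemma gdet_sort_rows:
  assumes "length rs = length cs"
  shows "gdet B rs cs = 0 \<or> (distinct rs \<and> (\<exists>c. gdet B rs cs = c * gdet B (sort rs) cs))"
proof (cases "distinct rs")
  case False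
  then obtain i j where ij: "i < length rs" "j < length rs" "i \<noteq> j" "rs ! i = rs ! j"
    unfolding distinct_conv_nth by blast
  have "gdet B rs cs = 0" unfolding gdet_def
    by (rule det_identical_rows[of _ "length rs" i j]) (use ij in \<open>auto intro!: eq_vecI\<close>)
  then show ?thesis by simp
next
  case True
  have "mset rs = mset (sort rs)" by simp
  then obtain p where p: "p permutes {..<length (sort rs)}" "permute_list p (sort rs) = rs"
    by (rule mset_eq_permutation)
  then have p': "p permutes {0..<length rs}" by (simp add: lessThan_atLeast0)
  let ?A = "Matrix.mat (length rs) (length rs) (\<lambda>(a, b). B (sort rs ! a) (cs ! b))"
  have "Matrix.mat (length rs) (length rs) (\<lambda>(a, b). B (rs ! a) (cs ! b))
      = Matrix.mat (length rs) (length rs) (\<lambda>(i, j). ?A $$ (p i, j))"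
  proof (rule eq_matI)
    fix i j assume "i < dim_row (Matrix.mat (length rs) (length rs) (\<lambda>(i, j). ?A $$ (p i, j)))"
      "j < dim_col (Matrix.mat (length rs) (length rs) (\<lambda>(i, j). ?A $$ (p i, j)))"
    then have ij: "i < length rs" "j < length rs" by auto
    have "p i < length rs" using permutes_in_image[OF p'] ij by auto
    moreover have "rs ! i = sort rs ! p i"
      using permute_list_nth[OF p(1), of i] ij p(2) by simp
    ultimately show "Matrix.mat (length rs) (length rs) (\<lambda>(a, b). B (rs ! a) (cs ! b)) $$ (i, j)
      = Matrix.mat (length rs) (length rs) (\<lambda>(i, j). ?A $$ (p i, j)) $$ (i, j)" using ij by simp
  qed auto
  then have "gdet B rs cs = signof p * gdet B (sort rs) cs"
    unfolding gdet_def using det_permute_rows[OF _ p', of ?A] by simp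
  with True show ?thesis by blast
qed

text \<open>
  The generators of \<open>det_ideal t\<close> have increasing index lists, while derivatives and expansions of minors
  lead to arbitrary lists: these give \<open>0\<close> if an index is repeated, and otherwise differ from a generator by
  a sign.
\<close>

lemma minor_mem_det_ideal:
  fixes rs :: "'r::{finite,linorder} list" and cs :: "'n::{finite,linorder} list"
  assumes "length rs = t" "length cs = t"
  shows "(minor rs cs :: ('r, 'n, 'k::field_char_0) matpoly) \<in> det_ideal t"
proof -
  let ?v = "var :: 'r \<Rightarrow> 'n \<Rightarrow> ('r, 'n, 'k) matpoly"
  have sub: "ring_mod.subspace (det_ideal t :: ('r, 'n, 'k) matpoly set)" unfolding det_ideal_def by simp
  have m: "minor rs cs = gdet ?v rs cs" if "length rs = t" "length cs = t" for rs :: "'r list" and cs :: "'n list"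
    using minor_eq_det[OF that] that by (simp add: gdet_def)
  have *: "gdet ?v rs cs = 0 \<or> (distinct rs \<and> (\<exists>c. gdet ?v rs cs = c * gdet ?v (sort rs) cs))"
    by (rule gdet_sort_rows) (simp add: assms)
  have **: "gdet (\<lambda>j i. ?v i j) cs (sort rs) = 0 \<or> (distinct cs \<and>
      (\<exists>c. gdet (\<lambda>j i. ?v i j) cs (sort rs) = c * gdet (\<lambda>j i. ?v i j) (sort cs) (sort rs)))"
    by (rule gdet_sort_rows) (simp add: assms)
  have sw: "gdet ?v (sort rs) cs = gdet (\<lambda>j i. ?v i j) cs (sort rs)"
    "gdet ?v (sort rs) (sort cs) = gdet (\<lambda>j i. ?v i j) (sort cs) (sort rs)"
    using assms by (simp_all add: gdet_swap[of "sort rs"])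
  consider "gdet ?v rs cs = 0" | c d where "distinct rs" "distinct cs" "gdet ?v rs cs = c * (d * gdet ?v (sort rs) (sort cs))"
    using * ** unfolding sw by force
  then show ?thesis
  proof cases
    case 1
    then show ?thesis using assms ring_mod.subspace_0[OF sub] by (simp add: m)
  next
    case 2
    have "sorted_wrt (<) (sort rs)" "sorted_wrt (<) (sort cs)" using 2 by (simp_all add: strict_sorted_iff)
    then have "(minor (sort rs) (sort cs) :: ('r, 'n, 'k) matpoly) \<in> det_ideal t"
      unfolding det_ideal_def using assms
      by (intro ring_mod.span_base) (metis (mono_tags, lifting) length_sort mem_Collect_eq)
    then show ?thesis using 2 assms ring_mod.subspace_scale[OF sub] by (simp add: m)
  qed
qed

lemma subspace_det_ideal: "ring_mod.subspace (det_ideal t)"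
  unfolding det_ideal_def by simp

text \<open>Laplace expansion along the first row.\<close>

lemma minor_Suc_mem_det_ideal:
  fixes rs :: "'r::{finite,linorder} list" and cs :: "'n::{finite,linorder} list"
  assumes "length rs = Suc t" "length cs = Suc t"
  shows "(minor rs cs :: ('r, 'n, 'k::field_char_0) matpoly) \<in> det_ideal t"
proof -
  let ?v = "var :: 'r \<Rightarrow> 'n \<Rightarrow> ('r, 'n, 'k) matpoly"
  let ?A = "Matrix.mat (Suc t) (Suc t) (\<lambda>(a, b). ?v (rs ! a) (cs ! b))"
  have A: "?A \<in> carrier_mat (Suc t) (Suc t)" by simp
  have "minor rs cs = (\<Sum>j<Suc t. ?A $$ (0, j) * cofactor ?A 0 j)"
    unfolding minor_eq_det[OF assms] by (rule laplace_expansion_row[OF A]) simp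
  also have "\<dots> \<in> det_ideal t"
  proof (rule ring_mod.subspace_sum[OF subspace_det_ideal])
    fix j assume j: "j \<in> {..<Suc t}"
    have "mat_delete ?A 0 j = Matrix.mat t t (\<lambda>(a, b). ?v (tl rs ! a) ((take j cs @ drop (Suc j) cs) ! b))"
      using assms j by (intro eq_matI) (auto simp: mat_delete_def nth_tl nth_append)
    moreover have "(minor (tl rs) (take j cs @ drop (Suc j) cs) :: ('r, 'n, 'k) matpoly) \<in> det_ideal t"
      using assms j by (intro minor_mem_det_ideal) auto
    moreover have "minor (tl rs) (take j cs @ drop (Suc j) cs)
      = Determinant.det (Matrix.mat t t (\<lambda>(a, b). ?v (tl rs ! a) ((take j cs @ drop (Suc j) cs) ! b)))"
      using assms j by (intro minor_eq_det) auto
    ultimately have "Determinant.det (mat_delete ?A 0 j) \<in> det_ideal t" by simp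
    then show "?A $$ (0, j) * cofactor ?A 0 j \<in> det_ideal t"
      unfolding cofactor_def by (intro ring_mod.subspace_scale[OF subspace_det_ideal])
  qed
  finally show ?thesis .
qed

lemma det_ideal_antimono: "s \<le> t \<Longrightarrow> det_ideal t \<subseteq> det_ideal s"
proof (induction t rule: dec_induct)
  case (step t)
  have "det_ideal (Suc t) \<subseteq> det_ideal t"
    unfolding det_ideal_def[of "Suc t"]
    by (rule ring_mod.span_minimal[OF _ subspace_det_ideal]) (auto intro: minor_Suc_mem_det_ideal)
  with step show ?case by blast
qed simp

text \<open>
  By Laplace expansion along row \<open>k\<close>: the cofactors do not involve that row, so differentiation replaces its
  index by \<open>a\<close>.
\<close>

lemma dirderiv_minor_row:
  fixes rs :: "'r::{finite,linorder} list" and cs :: "'n::{finite,linorder} list"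
    and Z :: "'r \<Rightarrow> 'n \<Rightarrow> ('r, 'n, 'k::field_char_0) matpoly"
  assumes len: "length rs = t" "length cs = t" and k: "k < t"
    and Z: "\<And>i j. i < t \<Longrightarrow> Z (rs ! i) j = (if i = k then var a j else 0)"
  shows "dirderiv Z (minor rs cs) = minor (rs[k := a]) cs"
proof -
  interpret p: comm_ring_hom "\<lambda>c::('r, 'n, 'k) matpoly. [:c:]" by (rule pCons_const_hom)
  let ?M = "Matrix.mat t t (\<lambda>(i, j). [:var (rs ! i) (cs ! j) :: ('r, 'n, 'k) matpoly, Z (rs ! i) (cs ! j):])"
  let ?A = "Matrix.mat t t (\<lambda>(i, j). var (rs[k := a] ! i) (cs ! j) :: ('r, 'n, 'k) matpoly)"
  have "dirshift Z (minor rs cs) = Determinant.det ?M"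
    unfolding dirshift_def using len by (simp add: peval_generic_minor[OF lin_const_hom])
  also have "\<dots> = (\<Sum>j<t. ?M $$ (k, j) * cofactor ?M k j)"
    by (rule laplace_expansion_row) (use k in auto)
  also have "\<dots> = (\<Sum>j<t. [:var (rs ! k) (cs ! j), var a (cs ! j):] * [:cofactor ?A k j:])"
  proof (intro sum.cong refl arg_cong2[where f = "(*)"])
    fix j assume j: "j \<in> {..<t}"
    then show "?M $$ (k, j) = [:var (rs ! k) (cs ! j), var a (cs ! j):]" using k Z by simp
    have "mat_delete ?M k j = map_mat (\<lambda>c. [:c:]) (mat_delete ?A k j)"
      using Z j k len by (intro eq_matI) (auto simp: mat_delete_def)
    then show "cofactor ?M k j = [:cofactor ?A k j:]"
      unfolding cofactor_def by (simp add: p.hom_mult p.hom_power p.hom_uminus)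
  qed
  finally have "dirderiv Z (minor rs cs) = (\<Sum>j<t. var a (cs ! j) * cofactor ?A k j)"
    unfolding dirderiv_def by (simp add: coeff_sum mult.commute)
  also have "\<dots> = (\<Sum>j<t. ?A $$ (k, j) * cofactor ?A k j)"
    using k len by (intro sum.cong) auto
  also have "\<dots> = Determinant.det ?A"
    by (rule laplace_expansion_row[symmetric]) (use k in auto)
  also have "\<dots> = minor (rs[k := a]) cs" using len by (subst minor_eq_det[of _ t]) auto
  finally show ?thesis .
qed

lemma dirderiv_minor_zero:
  fixes rs :: "'r::{finite,linorder} list" and cs :: "'n::{finite,linorder} list"
    and Z :: "'r \<Rightarrow> 'n \<Rightarrow> ('r, 'n, 'k::field_char_0) matpoly"
  assumes len: "length rs = t" "length cs = t"
    and Z: "\<And>i j. i < t \<Longrightarrow> j < t \<Longrightarrow> Z (rs ! i) (cs ! j) = 0"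
  shows "dirderiv Z (minor rs cs) = 0"
proof -
  interpret p: comm_ring_hom "\<lambda>c::('r, 'n, 'k) matpoly. [:c:]" by (rule pCons_const_hom)
  have "dirshift Z (minor rs cs)
    = Determinant.det (Matrix.mat t t (\<lambda>(i, j). [:var (rs ! i) (cs ! j) :: ('r, 'n, 'k) matpoly, Z (rs ! i) (cs ! j):]))"
    unfolding dirshift_def using len by (simp add: peval_generic_minor[OF lin_const_hom])
  also have "Matrix.mat t t (\<lambda>(i, j). [:var (rs ! i) (cs ! j) :: ('r, 'n, 'k) matpoly, Z (rs ! i) (cs ! j):])
      = map_mat (\<lambda>c. [:c:]) (Matrix.mat t t (\<lambda>(i, j). var (rs ! i) (cs ! j)))"
    using Z by (intro eq_matI) auto
  finally show ?thesis unfolding dirderiv_def by simp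
qed

lemma dirderiv_minor_col:
  fixes rs :: "'r::{finite,linorder} list" and cs :: "'n::{finite,linorder} list"
    and Z :: "'r \<Rightarrow> 'n \<Rightarrow> ('r, 'n, 'k::field_char_0) matpoly"
  assumes len: "length rs = t" "length cs = t" and k: "k < t"
    and Z: "\<And>i j. j < t \<Longrightarrow> Z i (cs ! j) = (if j = k then var i a else 0)"
  shows "dirderiv Z (minor rs cs) = minor rs (cs[k := a])"
proof -
  interpret p: comm_ring_hom "\<lambda>c::('r, 'n, 'k) matpoly. [:c:]" by (rule pCons_const_hom)
  let ?M = "Matrix.mat t t (\<lambda>(i, j). [:var (rs ! i) (cs ! j) :: ('r, 'n, 'k) matpoly, Z (rs ! i) (cs ! j):])"
  let ?A = "Matrix.mat t t (\<lambda>(i, j). var (rs ! i) (cs[k := a] ! j) :: ('r, 'n, 'k) matpoly)"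
  have "dirshift Z (minor rs cs) = Determinant.det ?M"
    unfolding dirshift_def using len by (simp add: peval_generic_minor[OF lin_const_hom])
  also have "\<dots> = (\<Sum>i<t. ?M $$ (i, k) * cofactor ?M i k)"
    by (rule laplace_expansion_column) (use k in auto)
  also have "\<dots> = (\<Sum>i<t. [:var (rs ! i) (cs ! k), var (rs ! i) a:] * [:cofactor ?A i k:])"
  proof (intro sum.cong refl arg_cong2[where f = "(*)"])
    fix i assume i: "i \<in> {..<t}"
    then show "?M $$ (i, k) = [:var (rs ! i) (cs ! k), var (rs ! i) a:]" using k Z by simp
    have "mat_delete ?M i k = map_mat (\<lambda>c. [:c:]) (mat_delete ?A i k)"
      using Z i k len by (intro eq_matI) (auto simp: mat_delete_def)
    then show "cofactor ?M i k = [:cofactor ?A i k:]"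
      unfolding cofactor_def by (simp add: p.hom_mult p.hom_power p.hom_uminus)
  qed
  finally have "dirderiv Z (minor rs cs) = (\<Sum>i<t. var (rs ! i) a * cofactor ?A i k)"
    unfolding dirderiv_def by (simp add: coeff_sum mult.commute)
  also have "\<dots> = (\<Sum>i<t. ?A $$ (i, k) * cofactor ?A i k)"
    using k len by (intro sum.cong) auto
  also have "\<dots> = Determinant.det ?A"
    by (rule laplace_expansion_column[symmetric]) (use k in auto)
  also have "\<dots> = minor rs (cs[k := a])" using len by (subst minor_eq_det[of _ t]) auto
  finally show ?thesis .
qed

lemma stable_det_ideal:
  "stable (det_ideal t :: ('r::{finite,linorder}, 'n::{finite,linorder}, 'k::field_char_0) matpoly set)"
proof (rule stable_idealI[OF subspace_det_ideal])
  have D: "dirderiv Z f \<in> det_ideal t"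
    if gen: "\<And>rs cs. length rs = t \<Longrightarrow> length cs = t \<Longrightarrow> sorted_wrt (<) rs \<Longrightarrow> sorted_wrt (<) cs
      \<Longrightarrow> dirderiv Z (minor rs cs) \<in> det_ideal t" and f: "f \<in> det_ideal t" for Z and f :: "('r, 'n, 'k) matpoly"
    using f unfolding det_ideal_def
  proof (induction f rule: ring_mod.span_induct_alt)
    case base
    then show ?case by (simp add: ring_mod.span_zero)
  next
    case (step c x y)
    then obtain rs cs where x: "x = minor rs cs" "length rs = t" "length cs = t" "sorted_wrt (<) rs" "sorted_wrt (<) cs"
      by blast
    have "x \<in> det_ideal t" unfolding det_ideal_def using step(1) by (rule ring_mod.span_base)
    moreover have "dirderiv Z x \<in> det_ideal t" unfolding x(1) by (rule gen) fact+
    moreover have "dirderiv Z y \<in> det_ideal t" using step(2) unfolding det_ideal_def .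
    ultimately have "c * dirderiv Z x + dirderiv Z c * x + dirderiv Z y \<in> det_ideal t"
      by (intro ring_mod.subspace_add[OF subspace_det_ideal] ring_mod.subspace_scale[OF subspace_det_ideal])
    then show ?case unfolding dirderiv_add dirderiv_mult det_ideal_def .
  qed
  fix f :: "('r, 'n, 'k) matpoly" assume f: "f \<in> det_ideal t"
  show "rowpol a b f \<in> det_ideal t" for a b
    unfolding rowpol_def
  proof (rule D[OF _ f])
    fix rs :: "'r list" and cs :: "'n list"
    assume len: "length rs = t" "length cs = t" and "sorted_wrt (<) rs"
    then have dist: "distinct rs" by (simp add: strict_sorted_iff)
    show "dirderiv (\<lambda>i j. if i = b then var a j else 0) (minor rs cs :: ('r, 'n, 'k) matpoly) \<in> det_ideal t"
    proof (cases "b \<in> set rs")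
      case True
      then obtain k where k: "k < t" "rs ! k = b" using len by (auto simp: in_set_conv_nth)
      have "dirderiv (\<lambda>i j. if i = b then var a j else 0) (minor rs cs :: ('r, 'n, 'k) matpoly) = minor (rs[k := a]) cs"
        using dist k len by (intro dirderiv_minor_row[where t = t]) (auto simp: nth_eq_iff_index_eq)
      then show ?thesis using minor_mem_det_ideal[of "rs[k := a]" t cs] len by simp
    next
      case False
      then have "dirderiv (\<lambda>i j. if i = b then var a j else 0) (minor rs cs :: ('r, 'n, 'k) matpoly) = 0"
        using len by (intro dirderiv_minor_zero[where t = t]) auto
      then show ?thesis by (simp add: ring_mod.subspace_0[OF subspace_det_ideal])
    qed
  qed
  show "colpol a b f \<in> det_ideal t" for a b
    unfolding colpol_def
  proof (rule D[OF _ f])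
    fix rs :: "'r list" and cs :: "'n list"
    assume len: "length rs = t" "length cs = t" and "sorted_wrt (<) cs"
    then have dist: "distinct cs" by (simp add: strict_sorted_iff)
    show "dirderiv (\<lambda>i j. if j = b then var i a else 0) (minor rs cs :: ('r, 'n, 'k) matpoly) \<in> det_ideal t"
    proof (cases "b \<in> set cs")
      case True
      then obtain k where k: "k < t" "cs ! k = b" using len by (auto simp: in_set_conv_nth)
      have "dirderiv (\<lambda>i j. if j = b then var i a else 0) (minor rs cs :: ('r, 'n, 'k) matpoly) = minor rs (cs[k := a])"
        using dist k len by (intro dirderiv_minor_col[where t = t]) (auto simp: nth_eq_iff_index_eq)
      then show ?thesis using minor_mem_det_ideal[of rs t "cs[k := a]"] len by simp
    next
      case False
      then have "dirderiv (\<lambda>i j. if j = b then var i a else 0) (minor rs cs :: ('r, 'n, 'k) matpoly) = 0"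
        using len by (intro dirderiv_minor_zero[where t = t]) auto
      then show ?thesis by (simp add: ring_mod.subspace_0[OF subspace_det_ideal])
    qed
  qed
qed

lemma leading_minor_mem_det_ideal:
  assumes "p \<le> t" "t \<le> CARD('r)" "CARD('r) \<le> CARD('n)"
  shows "(leading_minor t :: ('r::{finite,linorder}, 'n::{finite,linorder}, 'k::field_char_0) matpoly) \<in> det_ideal p"
proof -
  have "(leading_minor t :: ('r, 'n, 'k) matpoly) \<in> det_ideal t"
    unfolding leading_minor_def using assms by (intro minor_mem_det_ideal) auto
  then show ?thesis using det_ideal_antimono[OF assms(1)] by blast
qed

lemma one_not_in_order_ideal_1: "(1 :: ('r::{finite,linorder}, 'n::{finite,linorder}, 'k::field_char_0) matpoly) \<notin> order_ideal q 1"
proof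
  let ?Y = "pencil q (\<lambda>_ _. 0) (\<lambda>_ _. 0) (\<lambda>_ _. 0) :: 'r \<Rightarrow> 'n \<Rightarrow> 'k poly poly"
  interpret p: comm_ring_hom "peval const2 ?Y" by (rule peval_hom[OF const2_hom])
  assume "(1 :: ('r, 'n, 'k) matpoly) \<in> order_ideal q 1"
  then have "[:0, 1:] ^ 1 dvd peval const2 ?Y 1" unfolding order_ideal_def by blast
  then show False by (simp only: power_one_right X_dvd_iff p.hom_one poly_1 one_neq_zero)
qed

text \<open>
  The second fundamental theorem of invariant theory for the general linear group: the minors of size \<open>p\<close>
  generate the ideal of all polynomials vanishing on the matrices of rank less than \<open>p\<close>. Both ideals are
  stable, so only products of leading minors have to be compared, and such a product vanishes on these
  matrices only if it has a factor of size at least \<open>p\<close>.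
\<close>

theorem det_ideal_eq_order_ideal:
  assumes rn: "CARD('r) \<le> CARD('n)" and p: "1 \<le> p"
  shows "(det_ideal p :: ('r::{finite,linorder}, 'n::{finite,linorder}, 'k::field_char_0) matpoly set) = order_ideal (p - 1) 1"
proof
  show "(det_ideal p :: ('r, 'n, 'k) matpoly set) \<subseteq> order_ideal (p - 1) 1"
    unfolding det_ideal_def
  proof (rule ring_mod.span_minimal[OF _ subspace_order_ideal], clarify)
    fix rs :: "'r list" and cs :: "'n list" assume "p = length rs" "length cs = length rs"
    then show "(minor rs cs :: ('r, 'n, 'k) matpoly) \<in> order_ideal (length rs - 1) 1"
      using minor_mem_order_ideal[of rs p cs "p - 1"] p by simp
  qed
next
  show "(order_ideal (p - 1) 1 :: ('r, 'n, 'k) matpoly set) \<subseteq> det_ideal p"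
  proof (rule stable_subset_if_Kprods[OF rn stable_order_ideal stable_det_ideal])
    fix e assume "(Kprod e :: ('r, 'n, 'k) matpoly) \<in> order_ideal (p - 1) 1"
    then have "1 * Kprod e \<in> (order_ideal (p - 1) 1 :: ('r, 'n, 'k) matpoly set)" by simp
    then have "1 \<le> gamma_exp CARD('r) (Suc (p - 1)) e" by (rule order_ideal_Kprod_bound[OF rn one_not_in_order_ideal_1])
    then have "gamma_exp CARD('r) p e \<noteq> 0" using p by simp
    then obtain t where t: "t \<in> {1..CARD('r)}" "e t * (t + 1 - p) \<noteq> 0"
      unfolding gamma_exp_def by (meson sum.not_neutral_contains_not_neutral)
    then have "p \<le> t" "e t > 0" by auto
    then have "leading_minor t ^ e t \<in> (det_ideal p :: ('r, 'n, 'k) matpoly set)"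
      using ring_mod.subspace_scale[OF subspace_det_ideal leading_minor_mem_det_ideal[OF \<open>p \<le> t\<close> _ rn], of "leading_minor t ^ (e t - 1)"] t
      by (simp add: power_eq_if mult.commute)
    moreover have "(Kprod e :: ('r, 'n, 'k) matpoly) = (\<Prod>t\<in>{1..CARD('r)} - {t}. leading_minor t ^ e t) * leading_minor t ^ e t"
      unfolding Kprod_def using t by (subst prod.remove[of _ t]) (auto simp: mult.commute)
    ultimately show "(Kprod e :: ('r, 'n, 'k) matpoly) \<in> det_ideal p"
      by (simp add: ring_mod.subspace_scale[OF subspace_det_ideal])
  qed
qed

section \<open>Symbolic powers\<close>

text \<open>
  For a prime \<open>P\<close> the finite sums in the definition of the extension have common denominators outside \<open>P\<close>.
\<close>

lemma symbolic_power_at_iff: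
  fixes P J :: "'a::idom set"
  assumes P: "0 \<in> P" "1 \<notin> P" and prime: "\<And>f g. f \<notin> P \<Longrightarrow> g \<notin> P \<Longrightarrow> f * g \<notin> P"
  shows "f \<in> symbolic_power_at P J m \<longleftrightarrow> (\<exists>s. s \<notin> P \<and> s * f \<in> ideal_power J m)"
proof
  let ?J = "ideal_power J m"
  note S = subspace_ideal_power[of J m]
  assume "f \<in> symbolic_power_at P J m"
  then obtain A c where A: "to_fract f = (\<Sum>a\<in>A. c a * to_fract a)" "finite A" "A \<subseteq> ?J" "c ` A \<subseteq> localization P"
    unfolding symbolic_power_at_def ext_contr_def extension_def by blast
  have "\<exists>s g. s \<notin> P \<and> g \<in> ?J \<and> to_fract s * (\<Sum>a\<in>A. c a * to_fract a) = to_fract g"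
    using A(2-4)
  proof (induction A rule: finite_induct)
    case empty
    then show ?case using P(2) ring_mod.subspace_0[OF S] by (intro exI[of _ 1] exI[of _ 0]) auto
  next
    case (insert a A)
    then obtain s g where sg: "s \<notin> P" "g \<in> ?J" "to_fract s * (\<Sum>a\<in>A. c a * to_fract a) = to_fract g" by auto
    obtain x y where xy: "c a = Fract x y" "y \<notin> P" using insert.prems unfolding localization_def by auto
    then have "y \<noteq> 0" using P(1) by auto
    then have "to_fract y * c a = to_fract x" unfolding xy(1) to_fract_def by (simp add: eq_fract)
    then have "to_fract (y * s) * (c a * to_fract a) = to_fract x * to_fract (s * a)"
      unfolding to_fract_mult by (metis (no_types, opaque_lifting) mult.assoc mult.commute)
    then have h1: "to_fract (y * s) * (c a * to_fract a) = to_fract (x * s * a)"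
      by (simp add: to_fract_mult mult.assoc)
    have h2: "to_fract (y * s) * (\<Sum>a\<in>A. c a * to_fract a) = to_fract (y * g)"
      using sg(3) by (simp add: to_fract_mult mult.assoc)
    have "to_fract (y * s) * (\<Sum>a\<in>insert a A. c a * to_fract a) = to_fract (x * s * a + y * g)"
      by (simp only: sum.insert[OF insert.hyps] distrib_left h1 h2 to_fract_add)
    moreover have "x * s * a + y * g \<in> ?J"
      using insert.prems sg by (intro ring_mod.subspace_add[OF S] ring_mod.subspace_scale[OF S]) auto
    ultimately show ?case using prime[OF xy(2) sg(1)] by blast
  qed
  then obtain s g where sg: "s \<notin> P" "g \<in> ?J" "to_fract (s * f) = to_fract g"
    unfolding A(1)[symmetric] by (auto simp: to_fract_mult)
  then show "\<exists>s. s \<notin> P \<and> s * f \<in> ?J" by (metis to_fract_eq_iff)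
next
  assume "\<exists>s. s \<notin> P \<and> s * f \<in> ideal_power J m"
  then obtain s where s: "s \<notin> P" "s * f \<in> ideal_power J m" by blast
  have "s \<noteq> 0" using s P by auto
  then have "to_fract f = Fract 1 s * to_fract (s * f)"
    by (simp add: to_fract_def eq_fract)
  then have "to_fract f = (\<Sum>a\<in>{s * f}. (\<lambda>_. Fract 1 s) a * to_fract a)" by simp
  then show "f \<in> symbolic_power_at P J m"
    unfolding symbolic_power_at_def ext_contr_def extension_def localization_def
    using s by (intro CollectI exI[of _ "{s * f}"] exI[of _ "\<lambda>_. Fract 1 s"]) auto
qed

lemma det_ideal_prime:
  fixes f g :: "('r::{finite,linorder}, 'n::{finite,linorder}, 'k::field_char_0) matpoly"
  assumes "CARD('r) \<le> CARD('n)" "1 \<le> p" "f \<notin> det_ideal p" "g \<notin> det_ideal p"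
  shows "f * g \<notin> det_ideal p"
  using assms order_ideal_1_prime[of f "p - 1" g] by (simp add: det_ideal_eq_order_ideal)

lemma one_not_in_det_ideal:
  assumes "CARD('r) \<le> CARD('n)" "1 \<le> p"
  shows "(1 :: ('r::{finite,linorder}, 'n::{finite,linorder}, 'k::field_char_0) matpoly) \<notin> det_ideal p"
  using assms one_not_in_order_ideal_1 by (simp add: det_ideal_eq_order_ideal)

lemma symbolic_power_at_det_ideal_iff:
  fixes f :: "('r::{finite,linorder}, 'n::{finite,linorder}, 'k::field_char_0) matpoly"
  assumes "CARD('r) \<le> CARD('n)" "1 \<le> p"
  shows "f \<in> symbolic_power_at (det_ideal p) J m \<longleftrightarrow> (\<exists>s. s \<notin> det_ideal p \<and> s * f \<in> ideal_power J m)"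
  by (rule symbolic_power_at_iff)
    (use assms one_not_in_det_ideal det_ideal_prime ring_mod.subspace_0[OF subspace_det_ideal] in blast)+

text \<open>
  If \<open>s f\<close> is in the power, then so is \<open>s\<^sup>2 E f = s E(s f) - E(s) s f\<close> for every stabilizing derivation \<open>E\<close>.
\<close>

lemma stable_symbolic_power:
  fixes J :: "('r::{finite,linorder}, 'n::{finite,linorder}, 'k::field_char_0) matpoly set"
  assumes rn: "CARD('r) \<le> CARD('n)" "1 \<le> p" and J: "stable J"
  shows "stable (sym_power p J m)"
proof -
  let ?P = "det_ideal p :: ('r, 'n, 'k) matpoly set"
  note iff = symbolic_power_at_det_ideal_iff[OF rn]
  note S = subspace_ideal_power[of J m]
  have sub: "ring_mod.subspace (sym_power p J m)"
  proof (rule ring_mod.subspaceI)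
    show "0 \<in> sym_power p J m" unfolding sym_power_def iff
      using one_not_in_det_ideal[OF rn] ring_mod.subspace_0[OF S] by auto
  next
    fix x y assume "x \<in> sym_power p J m" "y \<in> sym_power p J m"
    then obtain s t where st: "s \<notin> ?P" "s * x \<in> ideal_power J m" "t \<notin> ?P" "t * y \<in> ideal_power J m"
      unfolding sym_power_def iff by blast
    have "(s * t) * (x + y) = t * (s * x) + s * (t * y)" by (simp add: algebra_simps)
    also have "\<dots> \<in> ideal_power J m"
      by (rule ring_mod.subspace_add[OF S ring_mod.subspace_scale[OF S st(2)] ring_mod.subspace_scale[OF S st(4)]])
    finally show "x + y \<in> sym_power p J m" unfolding sym_power_def iff
      using det_ideal_prime[OF rn st(1,3)] by blast
  next
    fix c x assume "x \<in> sym_power p J m"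
    then obtain s where s: "s \<notin> ?P" "s * x \<in> ideal_power J m" unfolding sym_power_def iff by blast
    have "s * (c * x) = c * (s * x)" by (simp add: algebra_simps)
    also have "\<dots> \<in> ideal_power J m" by (rule ring_mod.subspace_scale[OF S s(2)])
    finally have "s * (c * x) \<in> ideal_power J m" .
    then show "c * x \<in> sym_power p J m" unfolding sym_power_def iff using s(1) by blast
  qed
  have D: "dirderiv Z f \<in> sym_power p J m"
    if Z: "\<And>f. f \<in> ideal_power J m \<Longrightarrow> dirderiv Z f \<in> ideal_power J m" and f: "f \<in> sym_power p J m" for Z f
  proof -
    obtain s where s: "s \<notin> ?P" "s * f \<in> ideal_power J m" using f unfolding sym_power_def iff by blast
    have "(s * s) * dirderiv Z f = s * dirderiv Z (s * f) - dirderiv Z s * (s * f)"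
      by (simp add: dirderiv_mult algebra_simps)
    also have "\<dots> \<in> ideal_power J m"
      by (rule ring_mod.subspace_diff[OF S ring_mod.subspace_scale[OF S Z[OF s(2)]] ring_mod.subspace_scale[OF S s(2)]])
    finally show ?thesis unfolding sym_power_def iff using det_ideal_prime[OF rn s(1) s(1)] by blast
  qed
  show ?thesis
    by (rule stable_idealI[OF sub])
      (use stableD(4,5)[OF ideal_power_stable[OF J]] in \<open>auto simp: rowpol_def colpol_def intro!: D\<close>)
qed

section \<open>The valuations on products of leading minors\<close>

lemma mult_uminus_mat:
  fixes A X :: "'b::comm_ring_1 mat"
  assumes "A \<in> carrier_mat n k" "X \<in> carrier_mat k m" shows "A * - X = - (A * X)"
  using assms by (intro eq_matI) (auto simp: scalar_prod_def sum_negf)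

text \<open>
  Schur complements without division: multiply by the block matrix with rows \<open>(1, - adj A B)\<close> and
  \<open>(0, det A)\<close>.
\<close>

lemma det_schur:
  fixes A B C D :: "'b::idom mat"
  assumes car: "A \<in> carrier_mat q q" "B \<in> carrier_mat q m" "C \<in> carrier_mat m q" "D \<in> carrier_mat m m"
  shows "Determinant.det (four_block_mat A B C D) * Determinant.det A ^ m
    = Determinant.det A * Determinant.det (Determinant.det A \<cdot>\<^sub>m D - C * adj_mat A * B)"
proof -
  let ?a = "Determinant.det A"
  note adj = adj_mat[OF car(1)]
  define E where "E = four_block_mat (1\<^sub>m q) (- (adj_mat A * B)) (0\<^sub>m m q) (?a \<cdot>\<^sub>m 1\<^sub>m m)"
  have M: "four_block_mat A B C D \<in> carrier_mat (q + m) (q + m)" using car by auto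
  have E: "E \<in> carrier_mat (q + m) (q + m)" unfolding E_def using car adj by (intro four_block_carrier_mat) auto
  have z: "A * - (adj_mat A * B) + B * (?a \<cdot>\<^sub>m 1\<^sub>m m) = 0\<^sub>m q m"
  proof -
    have "A * - (adj_mat A * B) = - (A * (adj_mat A * B))" using car adj by (intro mult_uminus_mat) auto
    also have "A * (adj_mat A * B) = (A * adj_mat A) * B" using car adj by (intro assoc_mult_mat[symmetric]) auto
    also have "\<dots> = ?a \<cdot>\<^sub>m B" unfolding adj(2) using car by (subst mult_smult_assoc_mat[of _ q q]) auto
    finally have 1: "A * - (adj_mat A * B) = - (?a \<cdot>\<^sub>m B)" .
    have 2: "B * (?a \<cdot>\<^sub>m 1\<^sub>m m) = ?a \<cdot>\<^sub>m B" using car by (subst mult_smult_distrib[of _ q m]) auto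
    show ?thesis unfolding 1 2 using car by (intro eq_matI) auto
  qed
  have s: "C * - (adj_mat A * B) + D * (?a \<cdot>\<^sub>m 1\<^sub>m m) = ?a \<cdot>\<^sub>m D - C * adj_mat A * B"
  proof -
    have "C * - (adj_mat A * B) = - (C * (adj_mat A * B))" using car adj by (intro mult_uminus_mat) auto
    also have "C * (adj_mat A * B) = C * adj_mat A * B" using car adj by (intro assoc_mult_mat[symmetric]) auto
    finally have 1: "C * - (adj_mat A * B) = - (C * adj_mat A * B)" .
    have 2: "D * (?a \<cdot>\<^sub>m 1\<^sub>m m) = ?a \<cdot>\<^sub>m D" using car by (subst mult_smult_distrib[of _ m m]) auto
    show ?thesis unfolding 1 2 using car adj by (intro eq_matI) auto
  qed
  have "four_block_mat A B C D * E = four_block_mat (A * 1\<^sub>m q + B * 0\<^sub>m m q)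
      (A * - (adj_mat A * B) + B * (?a \<cdot>\<^sub>m 1\<^sub>m m)) (C * 1\<^sub>m q + D * 0\<^sub>m m q)
      (C * - (adj_mat A * B) + D * (?a \<cdot>\<^sub>m 1\<^sub>m m))"
    unfolding E_def using car adj by (intro mult_four_block_mat[of _ q q _ m _ m _ _ q _ m]) auto
  also have "\<dots> = four_block_mat A (0\<^sub>m q m) C (?a \<cdot>\<^sub>m D - C * adj_mat A * B)"
    unfolding z s using car by simp
  finally have "Determinant.det (four_block_mat A B C D) * Determinant.det E
      = Determinant.det (four_block_mat A (0\<^sub>m q m) C (?a \<cdot>\<^sub>m D - C * adj_mat A * B))"
    using det_mult[OF M E] by simp
  also have "\<dots> = ?a * Determinant.det (?a \<cdot>\<^sub>m D - C * adj_mat A * B)"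
    using car adj by (intro det_four_block_mat_upper_right_zero) auto
  also have "Determinant.det E = ?a ^ m"
    unfolding E_def using car adj by (subst det_four_block_mat_lower_left_zero[where n = q and m = m]) auto
  finally show ?thesis .
qed

text \<open>
  The entries of the Schur complement are the bordered minors, by the case \<open>m = 1\<close> of the preceding lemma.
\<close>

lemma sylvester_identity:
  fixes A B C D :: "'b::idom mat"
  assumes car: "A \<in> carrier_mat q q" "B \<in> carrier_mat q m" "C \<in> carrier_mat m q" "D \<in> carrier_mat m m"
    and nz: "Determinant.det A \<noteq> 0"
  shows "Determinant.det (four_block_mat A B C D) * Determinant.det A ^ m
    = Determinant.det A * Determinant.det (Matrix.mat m m (\<lambda>(i, j). Determinant.det (four_block_mat A
        (Matrix.mat q 1 (\<lambda>(a, b). B $$ (a, j))) (Matrix.mat 1 q (\<lambda>(a, b). C $$ (i, b))) (Matrix.mat 1 1 (\<lambda>_. D $$ (i, j))))))"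
proof -
  let ?a = "Determinant.det A"
  let ?S = "?a \<cdot>\<^sub>m D - C * adj_mat A * B"
  note adj = adj_mat[OF car(1)]
  have "?S = Matrix.mat m m (\<lambda>(i, j). Determinant.det (four_block_mat A
        (Matrix.mat q 1 (\<lambda>(a, b). B $$ (a, j))) (Matrix.mat 1 q (\<lambda>(a, b). C $$ (i, b))) (Matrix.mat 1 1 (\<lambda>_. D $$ (i, j)))))"
    (is "_ = ?R")
  proof (rule eq_matI)
    fix i j assume "i < dim_row ?R" "j < dim_col ?R"
    then have ij: "i < m" "j < m" by auto
    let ?B = "Matrix.mat q 1 (\<lambda>(a, b). B $$ (a, j))" and ?C = "Matrix.mat 1 q (\<lambda>(a, b). C $$ (i, b))"
      and ?D = "Matrix.mat 1 1 (\<lambda>_. D $$ (i, j))"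
    have "Determinant.det (four_block_mat A ?B ?C ?D) * ?a ^ 1
      = ?a * Determinant.det (?a \<cdot>\<^sub>m ?D - ?C * adj_mat A * ?B)"
      using car by (intro det_schur) auto
    then have "Determinant.det (four_block_mat A ?B ?C ?D) = Determinant.det (?a \<cdot>\<^sub>m ?D - ?C * adj_mat A * ?B)"
      using nz by simp
    also have "\<dots> = (?a \<cdot>\<^sub>m ?D - ?C * adj_mat A * ?B) $$ (0, 0)"
      by (rule det_single) (use adj in auto)
    also have "\<dots> = ?S $$ (i, j)"
    proof -
      have "row (?C * adj_mat A) 0 = row (C * adj_mat A) i"
        using car adj ij by (intro eq_vecI) (auto simp: scalar_prod_def)
      moreover have "col ?B 0 = col B j" using car ij by (intro eq_vecI) auto
      moreover have "(?C * adj_mat A * ?B) $$ (0, 0) = row (?C * adj_mat A) 0 \<bullet> col ?B 0"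
        using car adj by (intro index_mult_mat(1)) auto
      moreover have "(C * adj_mat A * B) $$ (i, j) = row (C * adj_mat A) i \<bullet> col B j"
        using car adj ij by (intro index_mult_mat(1)) auto
      ultimately have "(?C * adj_mat A * ?B) $$ (0, 0) = (C * adj_mat A * B) $$ (i, j)" by simp
      moreover have "(?a \<cdot>\<^sub>m ?D - ?C * adj_mat A * ?B) $$ (0, 0) = ?a * D $$ (i, j) - (?C * adj_mat A * ?B) $$ (0, 0)"
        using car adj by (subst index_minus_mat) auto
      moreover have "?S $$ (i, j) = ?a * D $$ (i, j) - (C * adj_mat A * B) $$ (i, j)"
        using car adj ij by (subst index_minus_mat) auto
      ultimately show ?thesis by simp
    qed
    finally show "?S $$ (i, j) = ?R $$ (i, j)" using ij by simp
  qed (use car adj in auto)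
  then show ?thesis using det_schur[OF car] by simp
qed

lemma prod_mem_ideal_power:
  assumes "finite S" "\<And>i. i \<in> S \<Longrightarrow> f i \<in> J" shows "prod f S \<in> ideal_power J (card S)"
  using assms
proof (induction S rule: finite_induct)
  case (insert i S)
  then show ?case using ideal_mult_mem[of "f i" J "prod f S"] by simp
qed simp

lemma det_mem_ideal_power:
  assumes "\<And>i j. i < m \<Longrightarrow> j < m \<Longrightarrow> g i j \<in> J"
  shows "Determinant.det (Matrix.mat m m (\<lambda>(i, j). g i j)) \<in> ideal_power J m"
proof -
  have "Determinant.det (Matrix.mat m m (\<lambda>(i, j). g i j)) = (\<Sum>p\<in>{p. p permutes {0..<m}}. signof p *
      (\<Prod>i = 0..<m. Matrix.mat m m (\<lambda>(i, j). g i j) $$ (i, p i)))"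
    by (rule det_def') simp
  also have "\<dots> \<in> ideal_power J m"
  proof (intro ring_mod.subspace_sum[OF subspace_ideal_power] ring_mod.subspace_scale[OF subspace_ideal_power])
    fix p assume "p \<in> {p. p permutes {0..<m}}"
    then have "p i < m" if "i < m" for i using that permutes_in_image[of p "{0..<m}" i] by auto
    then have "(\<Prod>i = 0..<m. Matrix.mat m m (\<lambda>(i, j). g i j) $$ (i, p i)) \<in> ideal_power J (card {0..<m})"
      using assms by (intro prod_mem_ideal_power) auto
    then show "(\<Prod>i = 0..<m. Matrix.mat m m (\<lambda>(i, j). g i j) $$ (i, p i)) \<in> ideal_power J m" by simp
  qed
  finally show ?thesis .
qed

lemma leading_minor_eq_Kprod:
  assumes "t \<in> {1..CARD('r)}"
  shows "(leading_minor t :: ('r::{finite,linorder}, 'n::{finite,linorder}, 'k::field_char_0) matpoly)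
    = Kprod (\<lambda>i. if i = t then 1 else 0)"
proof -
  have "Kprod (\<lambda>i. if i = t then 1 else 0) = (\<Prod>i\<in>{1..CARD('r)}. if i = t then leading_minor t else (1 :: ('r, 'n, 'k) matpoly))"
    unfolding Kprod_def by (intro prod.cong) auto
  then show ?thesis using assms by simp
qed

lemma gamma_exp_unit: "t \<in> {1..r} \<Longrightarrow> gamma_exp r j (\<lambda>i. if i = t then 1 else 0) = t + 1 - j"
proof -
  assume t: "t \<in> {1..r}"
  have "gamma_exp r j (\<lambda>i. if i = t then 1 else 0) = (\<Sum>i\<in>{1..r}. if i = t then t + 1 - j else 0)"
    unfolding gamma_exp_def by (intro sum.cong) auto
  then show ?thesis using t by simp
qed

text \<open>
  The leading minor of size \<open>q\<close> is nonzero at some matrix of rank \<open>q\<close>.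
\<close>

lemma leading_minor_not_in_order_ideal_1:
  assumes rn: "CARD('r) \<le> CARD('n)" and "q \<le> CARD('r)"
  shows "(leading_minor q :: ('r::{finite,linorder}, 'n::{finite,linorder}, 'k::field_char_0) matpoly) \<notin> order_ideal q 1"
proof (cases "q = 0")
  case True
  then show ?thesis using one_not_in_order_ideal_1 by simp
next
  case False
  then have q: "q \<in> {1..CARD('r)}" using assms by simp
  show ?thesis
  proof
    assume "(leading_minor q :: ('r, 'n, 'k) matpoly) \<in> order_ideal q 1"
    then have "1 * Kprod (\<lambda>i. if i = q then 1 else 0) \<in> (order_ideal q 1 :: ('r, 'n, 'k) matpoly set)"
      unfolding leading_minor_eq_Kprod[OF q] by simp
    then have "1 \<le> gamma_exp CARD('r) (Suc q) (\<lambda>i. if i = q then 1 else 0)"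
      by (rule order_ideal_Kprod_bound[OF rn one_not_in_order_ideal_1])
    then show False unfolding gamma_exp_unit[OF q] by simp
  qed
qed

text \<open>
  Sylvester's identity writes \<open>\<Delta>\<^sub>q\<^bsup>t - q\<^esup> \<Delta>\<^sub>t\<close> as \<open>\<Delta>\<^sub>q\<close> times a determinant of size \<open>t - q\<close> whose entries are
  minors of size \<open>q + 1\<close>. It shows that \<open>\<Delta>\<^sub>t\<close> lies in the symbolic power \<open>D\<^bsup>(t - q)\<^esup>\<close> of \<open>D = D\<^sub>q\<^sub>+\<^sub>1\<close>.
\<close>

lemma bordered_leading_minors:
  assumes rn: "CARD('r) \<le> CARD('n)" and t: "Suc q \<le> t" "t \<le> CARD('r)"
  shows "\<exists>s. s \<notin> order_ideal q 1 \<and> s * (leading_minor t :: ('r::{finite,linorder}, 'n::{finite,linorder}, 'k::field_char_0) matpoly)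
    \<in> ideal_power (det_ideal (Suc q)) (t - q)"
proof -
  let ?v = "var :: 'r \<Rightarrow> 'n \<Rightarrow> ('r, 'n, 'k) matpoly"
  define m where "m = t - q"
  have qt: "q \<le> t" "q + m = t" "q \<le> CARD('r)" using t by (auto simp: m_def)
  define A where "A = Matrix.mat q q (\<lambda>(a, b). ?v (nth_elem a) (nth_elem b))"
  define B where "B = Matrix.mat q m (\<lambda>(a, b). ?v (nth_elem a) (nth_elem (q + b)))"
  define C where "C = Matrix.mat m q (\<lambda>(a, b). ?v (nth_elem (q + a)) (nth_elem b))"
  define D where "D = Matrix.mat m m (\<lambda>(a, b). ?v (nth_elem (q + a)) (nth_elem (q + b)))"
  have car: "A \<in> carrier_mat q q" "B \<in> carrier_mat q m" "C \<in> carrier_mat m q" "D \<in> carrier_mat m m"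
    by (simp_all add: A_def B_def C_def D_def)
  have lm: "(leading_minor s :: ('r, 'n, 'k) matpoly) = Determinant.det (Matrix.mat s s (\<lambda>(a, b). ?v (nth_elem a) (nth_elem b)))"
    if "s \<le> CARD('r)" for s
    using peval_leading_minor[OF const_poly_hom that rn, of ?v] by (simp only: peval_var_id)
  have detA: "Determinant.det A = leading_minor q" unfolding A_def by (rule lm[symmetric]) fact
  have M: "four_block_mat A B C D = Matrix.mat t t (\<lambda>(a, b). ?v (nth_elem a) (nth_elem b))"
    using qt by (intro eq_matI) (auto simp: A_def B_def C_def D_def)
  have detM: "Determinant.det (four_block_mat A B C D) = leading_minor t" unfolding M by (rule lm[symmetric]) fact
  have nz: "Determinant.det A \<noteq> 0" unfolding detA by (rule leading_minor_nonzero[OF qt(3) rn])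
  let ?g = "\<lambda>i j. Determinant.det (four_block_mat A
        (Matrix.mat q 1 (\<lambda>(a, b). B $$ (a, j))) (Matrix.mat 1 q (\<lambda>(a, b). C $$ (i, b))) (Matrix.mat 1 1 (\<lambda>_. D $$ (i, j))))"
  have g: "?g i j \<in> det_ideal (Suc q)" if ij: "i < m" "j < m" for i j
  proof -
    let ?rs = "map nth_elem ([0..<q] @ [q + i]) :: 'r list" and ?cs = "map nth_elem ([0..<q] @ [q + j]) :: 'n list"
    have "four_block_mat A
        (Matrix.mat q 1 (\<lambda>(a, b). B $$ (a, j))) (Matrix.mat 1 q (\<lambda>(a, b). C $$ (i, b))) (Matrix.mat 1 1 (\<lambda>_. D $$ (i, j)))
      = Matrix.mat (Suc q) (Suc q) (\<lambda>(a, b). ?v (?rs ! a) (?cs ! b))"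
      using ij by (intro eq_matI) (auto simp: A_def B_def C_def D_def nth_append)
    then have "?g i j = minor ?rs ?cs" by (subst minor_eq_det[of _ "Suc q"]) auto
    then show ?thesis using minor_mem_det_ideal[of ?rs "Suc q" ?cs] by simp
  qed
  have "leading_minor q ^ m * leading_minor t
      = leading_minor q * Determinant.det (Matrix.mat m m (\<lambda>(i, j). ?g i j))"
    using sylvester_identity[OF car nz] unfolding detA detM by (simp add: mult.commute)
  also have "\<dots> \<in> ideal_power (det_ideal (Suc q)) m"
    by (intro ring_mod.subspace_scale[OF subspace_ideal_power] det_mem_ideal_power g)
  finally have "leading_minor q ^ m * leading_minor t \<in> ideal_power (det_ideal (Suc q) :: ('r, 'n, 'k) matpoly set) m" .
  moreover have "(leading_minor q :: ('r, 'n, 'k) matpoly) ^ k \<notin> order_ideal q 1" for k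
    by (induction k) (use one_not_in_order_ideal_1 order_ideal_1_prime leading_minor_not_in_order_ideal_1[OF rn qt(3)] in auto)
  ultimately show ?thesis unfolding m_def by blast
qed

lemma ideal_power_det_ideal_subset_order_ideal:
  assumes rn: "CARD('r) \<le> CARD('n)"
  shows "ideal_power (det_ideal (Suc q) :: ('r::{finite,linorder}, 'n::{finite,linorder}, 'k::field_char_0) matpoly set) i \<subseteq> order_ideal q i"
proof -
  have "ideal_power (det_ideal (Suc q) :: ('r, 'n, 'k) matpoly set) i \<subseteq> order_ideal q (i * 1)"
    by (rule ideal_power_subset_filtration)
      (auto simp: subspace_order_ideal order_ideal_0 det_ideal_eq_order_ideal[OF rn] intro: order_ideal_mult)
  then show ?thesis by simp
qed

text \<open>
  The upper bound is the order of vanishing, the lower bound the identity for bordered minors.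
\<close>

lemma gamma_leading_minor:
  assumes rn: "CARD('r) \<le> CARD('n)" and j: "1 \<le> j" and t: "t \<in> {1..CARD('r)}"
  shows "gamma j (leading_minor t :: ('r::{finite,linorder}, 'n::{finite,linorder}, 'k::field_char_0) matpoly) = t + 1 - j"
proof -
  let ?P = "det_ideal j :: ('r, 'n, 'k) matpoly set" and ?f = "leading_minor t :: ('r, 'n, 'k) matpoly"
  obtain q where q: "j = Suc q" using j by (cases j) auto
  have P: "?P = order_ideal q 1" using det_ideal_eq_order_ideal[OF rn j] q by simp
  note iff = symbolic_power_at_det_ideal_iff[OF rn j]
  have "{i. ?f \<in> symbolic_power_at ?P ?P i} = {..t + 1 - j}"
  proof (intro equalityI subsetI)
    fix i assume "i \<in> {i. ?f \<in> symbolic_power_at ?P ?P i}"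
    then obtain s where s: "s \<notin> ?P" "s * ?f \<in> ideal_power ?P i" unfolding mem_Collect_eq iff by blast
    have "s * Kprod (\<lambda>i. if i = t then 1 else 0) \<in> order_ideal q i"
      using s(2) ideal_power_det_ideal_subset_order_ideal[OF rn, of q i] unfolding leading_minor_eq_Kprod[OF t] q by blast
    then have "i \<le> gamma_exp CARD('r) (Suc q) (\<lambda>i. if i = t then 1 else 0)"
      using s(1) unfolding P by (intro order_ideal_Kprod_bound[OF rn, of s q])
    then show "i \<in> {..t + 1 - j}" unfolding gamma_exp_unit[OF t] q by simp
  next
    fix i assume i: "i \<in> {..t + 1 - j}"
    have "\<exists>s. s \<notin> ?P \<and> s * ?f \<in> ideal_power ?P i"
    proof (cases "j \<le> t")
      case True
      then obtain s where s: "s \<notin> order_ideal q 1" "s * ?f \<in> ideal_power ?P (t - q)"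
        using bordered_leading_minors[OF rn, of q t] t q by auto
      have "i \<le> t - q" using i q by simp
      then show ?thesis using s ideal_power_antimono[of i "t - q" ?P] P by blast
    next
      case False
      then have "i = 0" using i by simp
      then show ?thesis using one_not_in_det_ideal[OF rn j] by (intro exI[of _ 1]) simp
    qed
    then show "i \<in> {i. ?f \<in> symbolic_power_at ?P ?P i}" unfolding mem_Collect_eq iff .
  qed
  then have "gamma j ?f = Max {..t + 1 - j}" unfolding gamma_def by simp
  also have "\<dots> = t + 1 - j" by (intro Max_eqI) auto
  finally show ?thesis .
qed

lemma valuation_prod:
  assumes v: "discrete_valuation v" and "\<And>i. i \<in> S \<Longrightarrow> f i \<noteq> 0"
  shows "v (\<Prod>i\<in>S. f i ^ e i) = (\<Sum>i\<in>S. int (e i) * v (f i))"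
proof -
  have mult: "v (x * y) = v x + v y" if "x \<noteq> 0" "y \<noteq> 0" for x y
    using v that unfolding discrete_valuation_def by blast
  have one: "v 1 = 0" using mult[of 1 1] by simp
  have pw: "v (x ^ k) = int k * v x" if "x \<noteq> 0" for x k
    using that by (induction k) (auto simp: one mult algebra_simps)
  show ?thesis using assms(2)
    by (induction S rule: infinite_finite_induct) (auto simp: one mult pw)
qed

lemma gamma_valuation_Kprod:
  fixes v :: "('r::{finite,linorder}, 'n::{finite,linorder}, 'k::field_char_0) matpoly fract \<Rightarrow> int"
  assumes rn: "CARD('r) \<le> CARD('n)" and j: "1 \<le> j" and v: "is_gamma_valuation j v"
  shows "v (to_fract (Kprod e)) = int (gamma_exp CARD('r) j e)"
proof -
  have tf: "to_fract (Kprod e :: ('r, 'n, 'k) matpoly) = (\<Prod>t\<in>{1..CARD('r)}. to_fract (leading_minor t) ^ e t)"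
  proof -
    have pw: "to_fract (x ^ k) = to_fract x ^ k" for x :: "('r, 'n, 'k) matpoly" and k
      by (induction k) (auto simp: to_fract_mult)
    have "to_fract (prod f S) = (\<Prod>i\<in>S. to_fract (f i))" for f :: "nat \<Rightarrow> ('r, 'n, 'k) matpoly" and S
      by (induction S rule: infinite_finite_induct) (auto simp: to_fract_mult)
    then show ?thesis unfolding Kprod_def pw[symmetric] .
  qed
  have "v (to_fract (Kprod e)) = (\<Sum>t\<in>{1..CARD('r)}. int (e t) * v (to_fract (leading_minor t)))"
    unfolding tf using v leading_minor_nonzero[OF _ rn, where 'k = 'k]
    by (intro valuation_prod) (auto simp: is_gamma_valuation_def)
  also have "\<dots> = (\<Sum>t\<in>{1..CARD('r)}. int (e t) * int (t + 1 - j))"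
    using v leading_minor_nonzero[OF _ rn, where 'k = 'k] gamma_leading_minor[OF rn j, where 'k = 'k]
    unfolding is_gamma_valuation_def by (intro sum.cong) auto
  finally show ?thesis by (simp add: gamma_exp_def)
qed

section \<open>Integral closure and powers\<close>

text \<open>
  The equation of integral dependence expresses \<open>f\<^sup>q\<close> for \<open>q \<ge> n\<close> by lower powers with coefficients in powers
  of \<open>J\<close>; the deficit \<open>n\<close> does not grow. The subtraction truncates.
\<close>

lemma integral_closure_powers:
  assumes "f \<in> integral_closure J"
  shows "\<exists>N. \<forall>q. f ^ q \<in> ideal_power J (q - N)"
proof -
  obtain n a where n: "n \<ge> 1" and a: "\<And>i. i \<in> {1..n} \<Longrightarrow> a i \<in> ideal_power J i"
    and eq: "f ^ n + (\<Sum>i=1..n. a i * f ^ (n - i)) = 0"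
    using assms unfolding integral_closure_def by blast
  have "f ^ q \<in> ideal_power J (q - n)" for q
  proof (induction q rule: less_induct)
    case (less q)
    show ?case
    proof (cases "q < n")
      case True
      then show ?thesis by simp
    next
      case False
      have "f ^ n = - (\<Sum>i=1..n. a i * f ^ (n - i))" using eq by (simp add: eq_neg_iff_add_eq_0)
      then have "f ^ q = - (\<Sum>i=1..n. a i * f ^ (n - i)) * f ^ (q - n)"
        using False by (metis le_add_diff_inverse linorder_not_le power_add)
      also have "\<dots> = - (\<Sum>i=1..n. a i * f ^ (q - i))"
        using False unfolding sum_distrib_right mult_minus_left
        by (intro arg_cong[where f = uminus] sum.cong) (auto simp: mult.assoc power_add[symmetric])
      also have "\<dots> \<in> ideal_power J (q - n)"
      proof (intro ring_mod.subspace_neg[OF subspace_ideal_power] ring_mod.subspace_sum[OF subspace_ideal_power])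
        fix i assume i: "i \<in> {1..n}"
        have "a i * f ^ (q - i) \<in> ideal_power J (i + (q - i - n))"
          using a[OF i] less[of "q - i"] i False by (intro ideal_power_mult_mem) auto
        moreover have "q - n \<le> i + (q - i - n)" by simp
        ultimately show "a i * f ^ (q - i) \<in> ideal_power J (q - n)" using ideal_power_antimono by blast
      qed
      finally show ?thesis .
    qed
  qed
  then show ?thesis by blast
qed

section \<open>Finite generation of monoids of exponents\<close>

lemma nat_seq_incseq_subseq:
  fixes g :: "nat \<Rightarrow> nat"
  obtains \<psi> where "strict_mono \<psi>" "incseq (\<lambda>n. g (\<psi> n))"
proof -
  obtain \<phi> where \<phi>: "strict_mono \<phi>" "monoseq (\<lambda>n. g (\<phi> n))" using seq_monosub[of g] by auto
  show thesis
  proof (cases "incseq (\<lambda>n. g (\<phi> n))")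
    case True
    with \<phi>(1) show thesis by (rule that)
  next
    case False
    then have dec: "decseq (\<lambda>n. g (\<phi> n))" using \<phi>(2) by (simp add: monoseq_iff)
    obtain N where N: "\<And>n. g (\<phi> N) \<le> g (\<phi> n)"
      using ex_has_least_nat[of "\<lambda>_. True" 0 "\<lambda>n. g (\<phi> n)"] by auto
    have "g (\<phi> (N + n)) = g (\<phi> N)" for n
      using N[of "N + n"] decseqD[OF dec, of N "N + n"] by simp
    moreover have "strict_mono (\<lambda>n. \<phi> (N + n))" using \<phi>(1) by (auto simp: strict_mono_def)
    ultimately show thesis by (intro that[of "\<lambda>n. \<phi> (N + n)"]) (auto simp: incseq_def)
  qed
qed

text \<open>
  Dickson's lemma in sequential form: pass to a subsequence for one coordinate after the other.
\<close>

lemma dickson_subseq: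
  fixes f :: "nat \<Rightarrow> 'i \<Rightarrow> nat"
  assumes "finite S"
  shows "\<exists>\<phi>. strict_mono \<phi> \<and> (\<forall>i\<in>S. incseq (\<lambda>n. f (\<phi> n) i))"
  using assms
proof (induction S rule: finite_induct)
  case empty
  show ?case by (intro exI[of _ id]) (auto simp: strict_mono_def)
next
  case (insert i S)
  then obtain \<phi> where \<phi>: "strict_mono \<phi>" "\<forall>i\<in>S. incseq (\<lambda>n. f (\<phi> n) i)" by blast
  obtain \<psi> where \<psi>: "strict_mono \<psi>" "incseq (\<lambda>n. f (\<phi> (\<psi> n)) i)"
    using nat_seq_incseq_subseq[of "\<lambda>n. f (\<phi> n) i"] by blast
  have "incseq (\<lambda>n. f (\<phi> (\<psi> n)) k)" if "k \<in> S" for k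
    using \<phi>(2) that \<psi>(1) by (auto simp: incseq_def strict_mono_leD)
  then show ?case using \<phi>(1) \<psi>
    by (intro exI[of _ "\<lambda>n. \<phi> (\<psi> n)"]) (auto simp: strict_mono_def)
qed

lemma finite_antichain:
  fixes M :: "('i \<Rightarrow> nat) set"
  assumes S: "finite S" and supp: "\<And>v i. v \<in> M \<Longrightarrow> i \<notin> S \<Longrightarrow> v i = 0"
    and anti: "\<And>v w. v \<in> M \<Longrightarrow> w \<in> M \<Longrightarrow> v \<le> w \<Longrightarrow> v = w"
  shows "finite M"
proof (rule ccontr)
  assume "infinite M"
  then obtain f :: "nat \<Rightarrow> 'i \<Rightarrow> nat" where f: "inj f" "range f \<subseteq> M"
    using infinite_countable_subset by blast
  obtain \<phi> where \<phi>: "strict_mono \<phi>" "\<forall>i\<in>S. incseq (\<lambda>n. f (\<phi> n) i)" using dickson_subseq[OF S] by blast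
  have mem: "f n \<in> M" for n using f(2) by blast
  have "f (\<phi> 0) \<le> f (\<phi> 1)"
  proof (rule le_funI)
    fix i show "f (\<phi> 0) i \<le> f (\<phi> 1) i"
      using \<phi>(2) supp[OF mem, of i] by (cases "i \<in> S") (auto simp: incseq_def)
  qed
  then have "f (\<phi> 0) = f (\<phi> 1)" by (rule anti[OF mem mem])
  then have "\<phi> 0 = \<phi> 1" using f(1) by (simp add: inj_eq)
  then show False using strict_monoD[OF \<phi>(1), of 0 1] by simp
qed

text \<open>
  Gordan's lemma. The minimal nonzero elements form an antichain, hence a finite set, and subtracting one of
  them from a given element stays in \<open>V\<close> because \<open>V\<close> is closed under differences. The nonnegative solutions
  of a system of homogeneous linear equations have this property.
\<close>

lemma finitely_generated_monoid:
  fixes V :: "('i \<Rightarrow> nat) set"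
  assumes S: "finite S" and supp: "\<And>v i. v \<in> V \<Longrightarrow> i \<notin> S \<Longrightarrow> v i = 0"
    and diff: "\<And>v w. v \<in> V \<Longrightarrow> w \<in> V \<Longrightarrow> w \<le> v \<Longrightarrow> (\<lambda>i. v i - w i) \<in> V"
  shows "\<exists>B. finite B \<and> B \<subseteq> V \<and> (\<forall>v\<in>V. \<exists>c. \<forall>i. v i = (\<Sum>b\<in>B. c b * b i))"
proof -
  define B where "B = {v\<in>V. v \<noteq> (\<lambda>_. 0) \<and> (\<forall>w\<in>V. w \<noteq> (\<lambda>_. 0) \<longrightarrow> w \<le> v \<longrightarrow> w = v)}"
  have fin: "finite B" by (rule finite_antichain[OF S]) (auto simp: B_def supp)
  define size where "size v = (\<Sum>i\<in>S. v i)" for v :: "'i \<Rightarrow> nat"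
  have size0: "size v > 0" if vV: "v \<in> V" and v0: "v \<noteq> (\<lambda>_. 0)" for v
  proof -
    obtain i where "v i \<noteq> 0" using v0 by (auto simp: fun_eq_iff)
    then have "i \<in> S" using supp[OF vV, of i] by metis
    then have "v i \<le> size v" unfolding size_def by (intro member_le_sum) (auto simp: S)
    with \<open>v i \<noteq> 0\<close> show ?thesis by simp
  qed
  have size_diff: "size (\<lambda>i. v i - w i) = size v - size w" if "w \<le> v" for v w
    unfolding size_def using that by (intro sum_subtractf_nat) (auto simp: le_fun_def)
  have size_mono: "size w \<le> size v" if "w \<le> v" for v w
    unfolding size_def using that by (intro sum_mono) (auto simp: le_fun_def)
  have below: "\<exists>b\<in>B. b \<le> v" if "v \<in> V" "v \<noteq> (\<lambda>_. 0)" for v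
    using that
  proof (induction "size v" arbitrary: v rule: less_induct)
    case less
    show ?case
    proof (cases "v \<in> B")
      case False
      then obtain w where w: "w \<in> V" "w \<noteq> (\<lambda>_. 0)" "w \<le> v" "w \<noteq> v" using less.prems unfolding B_def by blast
      have "size w < size v"
      proof (rule ccontr)
        assume "\<not> size w < size v"
        then have "size (\<lambda>i. v i - w i) = 0" using size_diff[OF w(3)] by simp
        then have "(\<lambda>i. v i - w i) = (\<lambda>_. 0)" using size0[OF diff[OF less.prems(1) w(1,3)]] by fastforce
        then have "v i - w i = 0" for i by (rule fun_cong)
        then have "v = w" using w(3) by (intro ext) (simp add: le_fun_def le_antisym)
        with w(4) show False by simp
      qed
      then obtain b where "b \<in> B" "b \<le> w" using less.hyps w by blast
      then show ?thesis using w(3) order_trans by blast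
    qed blast
  qed
  have "\<exists>c. \<forall>i. v i = (\<Sum>b\<in>B. c b * b i)" if "v \<in> V" for v
    using that
  proof (induction "size v" arbitrary: v rule: less_induct)
    case less
    show ?case
    proof (cases "v = (\<lambda>_. 0)")
      case True
      then show ?thesis by (intro exI[of _ "\<lambda>_. 0"]) simp
    next
      case False
      then obtain b where b: "b \<in> B" "b \<le> v" using below less.prems by blast
      have bV: "b \<in> V" "b \<noteq> (\<lambda>_. 0)" using b by (auto simp: B_def)
      have "size (\<lambda>i. v i - b i) < size v"
        using size_diff[OF b(2)] size0[OF bV] size_mono[OF b(2)] by simp
      then obtain c where c: "\<And>i. v i - b i = (\<Sum>b\<in>B. c b * b i)"
        using less.hyps[OF _ diff[OF less.prems bV(1) b(2)]] by blast
      have "v i = (\<Sum>a\<in>B. (c(b := c b + 1)) a * a i)" for i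
      proof -
        have "(\<Sum>a\<in>B. (c(b := c b + 1)) a * a i) = (\<Sum>a\<in>B. c a * a i + (if a = b then b i else 0))"
          by (intro sum.cong) auto
        also have "\<dots> = (v i - b i) + b i" using b(1) fin by (simp add: sum.distrib c)
        also have "\<dots> = v i" using b(2) by (simp add: le_fun_def)
        finally show ?thesis by simp
      qed
      then show ?thesis by blast
    qed
  qed
  then show ?thesis using fin by (intro exI[of _ B]) (auto simp: B_def)
qed

section \<open>Combinatorics of the functions gamma\<close>

text \<open>
  Termwise this says that \<open>(t + 1 - j) / (r + 1 - j)\<close> decreases with \<open>j\<close> for \<open>t \<le> r\<close>.
\<close>

lemma gamma_exp_convex:
  assumes "i \<le> j" "j \<le> r"
  shows "gamma_exp r j e * (r + 1 - i) \<le> gamma_exp r i e * (r + 1 - j)"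
proof -
  have "(t + 1 - j) * (r + 1 - i) \<le> (t + 1 - i) * (r + 1 - j)" if "t \<le> r" for t
  proof (cases "t < j")
    case False
    define a d b where "a = t + 1 - j" and "d = j - i" and "b = r + 1 - j"
    have eqs: "t + 1 - j = a" "r + 1 - i = b + d" "t + 1 - i = a + d" "r + 1 - j = b"
      using False assms that by (auto simp: a_def d_def b_def)
    have "a \<le> b" using that by (simp add: a_def b_def)
    then have "a * d \<le> b * d" by (rule mult_le_mono1)
    then show ?thesis unfolding eqs by (simp add: algebra_simps)
  qed simp
  then have "e t * ((t + 1 - j) * (r + 1 - i)) \<le> e t * ((t + 1 - i) * (r + 1 - j))" if "t \<in> {1..r}" for t
    using that by (intro mult_le_mono2) simp
  then show ?thesis unfolding gamma_exp_def sum_distrib_right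
    by (intro sum_mono) (simp add: mult.assoc)
qed

lemma gamma_diagrams_attained:
  assumes "finite \<Sigma>" "\<Sigma> \<noteq> {}"
  obtains \<sigma> where "\<sigma> \<in> \<Sigma>" "gamma_diagram j \<sigma> = gamma_diagrams j \<Sigma>"
proof -
  have "Min (gamma_diagram j ` \<Sigma>) \<in> gamma_diagram j ` \<Sigma>" using assms by (intro Min_in) auto
  then show thesis using that unfolding gamma_diagrams_def by auto
qed

lemma gamma_diagrams_le: "finite \<Sigma> \<Longrightarrow> \<sigma> \<in> \<Sigma> \<Longrightarrow> gamma_diagrams j \<Sigma> \<le> gamma_diagram j \<sigma>"
  unfolding gamma_diagrams_def by (intro Min_le) auto

lemma gamma_diagrams_convex:
  assumes "finite \<Sigma>" "\<Sigma> \<noteq> {}" "\<Sigma> \<subseteq> diagrams r" "i \<le> j" "j \<le> r"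
  shows "gamma_diagrams j \<Sigma> * (r + 1 - i) \<le> gamma_diagrams i \<Sigma> * (r + 1 - j)"
proof -
  obtain \<sigma> where \<sigma>: "\<sigma> \<in> \<Sigma>" "gamma_diagram i \<sigma> = gamma_diagrams i \<Sigma>"
    using gamma_diagrams_attained[OF assms(1,2)] by blast
  have "gamma_diagrams j \<Sigma> * (r + 1 - i) \<le> gamma_diagram j \<sigma> * (r + 1 - i)"
    using gamma_diagrams_le[OF assms(1) \<sigma>(1)] by (rule mult_le_mono1)
  also have "\<dots> \<le> gamma_diagram i \<sigma> * (r + 1 - j)"
    using \<sigma>(1) assms(3-5) gamma_exp_convex[OF assms(4,5)] by (auto simp: gamma_diagram_eq_gamma_exp)
  finally show ?thesis by (simp add: \<sigma>)
qed

section \<open>Membership of products of leading minors in powers\<close>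

lemma inv_ideal_sum_subset_order_ideal:
  fixes \<Sigma> :: "nat list set"
  assumes rn: "CARD('r) \<le> CARD('n)" and "finite \<Sigma>" "\<Sigma> \<subseteq> diagrams CARD('r)"
  shows "(inv_ideal_sum \<Sigma> :: ('r::{finite,linorder}, 'n::{finite,linorder}, 'k::field_char_0) matpoly set)
    \<subseteq> order_ideal q (gamma_diagrams (Suc q) \<Sigma>)"
proof (rule inv_ideal_sum_subset[OF subspace_order_ideal])
  fix \<sigma> assume \<sigma>: "\<sigma> \<in> \<Sigma>"
  then have d: "\<sigma> \<in> diagrams CARD('r)" using assms by blast
  have "(K_diagram \<sigma> :: ('r, 'n, 'k) matpoly) \<in> order_ideal q (gamma_diagram (Suc q) \<sigma>)"
    unfolding K_diagram_eq_Kprod[OF d] gamma_diagram_eq_gamma_exp[OF d] by (rule Kprod_mem_order_ideal[OF rn])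
  then have "(K_diagram \<sigma> :: ('r, 'n, 'k) matpoly) \<in> order_ideal q (gamma_diagrams (Suc q) \<Sigma>)"
    by (rule order_ideal_antimono[OF gamma_diagrams_le[OF assms(2) \<sigma>]])
  then show "(inv_ideal \<sigma> :: ('r, 'n, 'k) matpoly set) \<subseteq> order_ideal q (gamma_diagrams (Suc q) \<Sigma>)"
    by (rule inv_ideal_subset[OF subspace_order_ideal GL_invariant_order_ideal])
qed

lemma inv_ideal_sum_power_subset_order_ideal:
  fixes \<Sigma> :: "nat list set"
  assumes "CARD('r) \<le> CARD('n)" "finite \<Sigma>" "\<Sigma> \<subseteq> diagrams CARD('r)"
  shows "ideal_power (inv_ideal_sum \<Sigma> :: ('r::{finite,linorder}, 'n::{finite,linorder}, 'k::field_char_0) matpoly set) m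
    \<subseteq> order_ideal q (m * gamma_diagrams (Suc q) \<Sigma>)"
  by (rule ideal_power_subset_filtration)
    (auto simp: subspace_order_ideal order_ideal_0 intro: order_ideal_mult inv_ideal_sum_subset_order_ideal[OF assms, THEN subsetD])

text \<open>
  A multiplier \<open>s\<close> outside \<open>D\<^sub>p\<close> does not vanish on the matrices of rank at most \<open>j - 1\<close> if \<open>j \<ge> p\<close>, so it does
  not affect the order of vanishing along them.
\<close>

lemma Kprod_mem_sym_power_bound:
  assumes rn: "CARD('r) \<le> CARD('n)" and \<Sigma>: "finite \<Sigma>" "\<Sigma> \<subseteq> diagrams CARD('r)" and p: "1 \<le> p" "p \<le> j"
    and K: "(Kprod e :: ('r::{finite,linorder}, 'n::{finite,linorder}, 'k::field_char_0) matpoly) \<in> sym_power p (inv_ideal_sum \<Sigma>) m"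
  shows "m * gamma_diagrams j \<Sigma> \<le> gamma_exp CARD('r) j e"
proof -
  obtain q where q: "j = Suc q" using p by (cases j) auto
  obtain s where s: "s \<notin> (det_ideal p :: ('r, 'n, 'k) matpoly set)" "s * Kprod e \<in> ideal_power (inv_ideal_sum \<Sigma>) m"
    using K unfolding sym_power_def symbolic_power_at_det_ideal_iff[OF rn p(1)] by blast
  have "s \<notin> order_ideal q 1"
  proof -
    have "p - 1 \<le> q" using p q by simp
    then show ?thesis using s(1) order_ideal_rank_mono unfolding det_ideal_eq_order_ideal[OF rn p(1)] by blast
  qed
  moreover have "s * Kprod e \<in> order_ideal q (m * gamma_diagrams (Suc q) \<Sigma>)"
    using s(2) inv_ideal_sum_power_subset_order_ideal[OF rn \<Sigma>] by blast
  ultimately show ?thesis unfolding q by (rule order_ideal_Kprod_bound[OF rn])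
qed

lemma Kprod_mem_power_bound:
  assumes rn: "CARD('r) \<le> CARD('n)" and \<Sigma>: "finite \<Sigma>" "\<Sigma> \<subseteq> diagrams CARD('r)"
    and K: "(Kprod e :: ('r::{finite,linorder}, 'n::{finite,linorder}, 'k::field_char_0) matpoly) \<in> ideal_power (inv_ideal_sum \<Sigma>) m"
  shows "m * gamma_diagrams 1 \<Sigma> \<le> gamma_exp CARD('r) 1 e"
proof -
  have "1 * Kprod e \<in> (order_ideal 0 (m * gamma_diagrams (Suc 0) \<Sigma>) :: ('r, 'n, 'k) matpoly set)"
    using K inv_ideal_sum_power_subset_order_ideal[OF rn \<Sigma>, where q = 0] by auto
  then show ?thesis using order_ideal_Kprod_bound[OF rn one_not_in_order_ideal_1] by simp
qed

text \<open>
  For each Rees valuation \<open>\<gamma>\<^sub>j\<close> choose \<open>\<sigma> \<in> \<Sigma>\<close> with minimal \<open>\<gamma>\<^sub>j(\<sigma>)\<close>. The quotient of \<open>Kprod e\<close> by the \<open>m\<close>-th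
  power of \<open>K\<^sub>\<sigma>\<close> then has nonnegative value.
\<close>

lemma Kprod_mem_integral_closure:
  fixes I :: "('r::{finite,linorder}, 'n::{finite,linorder}, 'k::field_char_0) matpoly set"
  assumes rn: "CARD('r) \<le> CARD('n)" and \<Sigma>: "finite \<Sigma>" "\<Sigma> \<noteq> {}" "\<Sigma> \<subseteq> diagrams CARD('r)"
    and I: "I = inv_ideal_sum \<Sigma>"
    and W: "rees_representation I W" "\<forall>v\<in>W. \<exists>j\<in>{1..CARD('r)}. is_gamma_valuation j v"
    and e: "\<And>j. j \<in> {1..CARD('r)} \<Longrightarrow> m * gamma_diagrams j \<Sigma> \<le> gamma_exp CARD('r) j e"
  shows "Kprod e \<in> integral_closure (ideal_power I m)"
proof -
  have "Kprod e \<in> ext_contr (valuation_ring v) (ideal_power I m)" if v: "v \<in> W" for v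
  proof -
    obtain j where j: "j \<in> {1..CARD('r)}" "is_gamma_valuation j v" using W(2) v by blast
    have dv: "discrete_valuation v" using j(2) by (simp add: is_gamma_valuation_def)
    have mult: "v (x * y) = v x + v y" if "x \<noteq> 0" "y \<noteq> 0" for x y
      using dv that unfolding discrete_valuation_def by blast
    obtain \<sigma> where \<sigma>: "\<sigma> \<in> \<Sigma>" "gamma_diagram j \<sigma> = gamma_diagrams j \<Sigma>"
      using gamma_diagrams_attained[OF \<Sigma>(1,2)] by blast
    then have d: "\<sigma> \<in> diagrams CARD('r)" using \<Sigma>(3) by blast
    define e' where "e' t = count_list \<sigma> t * m" for t
    have "(K_diagram \<sigma> :: ('r, 'n, 'k) matpoly) \<in> I"
      unfolding I using inv_ideal_subset_sum[OF \<Sigma>(1) \<sigma>(1)] K_diagram_mem_inv_ideal by blast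
    then have "(K_diagram \<sigma> :: ('r, 'n, 'k) matpoly) ^ m \<in> ideal_power I (1 * m)"
      by (intro ideal_power_power_mem ideal_power_1_mem)
    then have b: "Kprod e' \<in> ideal_power I m"
      unfolding K_diagram_eq_Kprod[OF d] Kprod_power e'_def by simp
    have "gamma_exp CARD('r) j e' = m * gamma_diagrams j \<Sigma>"
      unfolding \<sigma>(2)[symmetric] gamma_diagram_eq_gamma_exp[OF d] gamma_exp_def e'_def
      by (simp add: sum_distrib_left mult_ac)
    then have le: "gamma_exp CARD('r) j e' \<le> gamma_exp CARD('r) j e" using e[OF j(1)] by simp
    let ?x = "to_fract (Kprod e :: ('r, 'n, 'k) matpoly)" and ?y = "to_fract (Kprod e' :: ('r, 'n, 'k) matpoly)"
    have nz: "?x \<noteq> 0" "?y \<noteq> 0" using Kprod_nonzero[OF rn] by auto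
    have vx: "v ?x = int (gamma_exp CARD('r) j e)" and vy: "v ?y = int (gamma_exp CARD('r) j e')"
      using gamma_valuation_Kprod[OF rn _ j(2)] j(1) by auto
    have "v (?x / ?y * ?y) = v (?x / ?y) + v ?y" using nz by (intro mult) auto
    then have "v (?x / ?y) \<ge> 0" using nz vx vy le by simp
    then have "?x / ?y \<in> valuation_ring v" by (simp add: valuation_ring_def)
    moreover have "?x = (\<Sum>a\<in>{Kprod e'}. (\<lambda>_. ?x / ?y) a * to_fract a)" using nz by simp
    ultimately show ?thesis unfolding ext_contr_def extension_def using b
      by (intro CollectI exI[of _ "{Kprod e'}"] exI[of _ "\<lambda>_. ?x / ?y"]) auto
  qed
  then show ?thesis using W(1) unfolding rees_representation_def by blast
qed

lemma Kprod_sum: "finite B \<Longrightarrow> (\<Prod>b\<in>B. Kprod b ^ c b) = Kprod (\<lambda>i. \<Sum>b\<in>B. c b * b i)"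
proof (induction B rule: finite_induct)
  case empty
  then show ?case by (simp add: Kprod_def)
next
  case (insert b B)
  then show ?case by (simp add: Kprod_power Kprod_mult mult.commute)
qed

lemma Kprod_cong: "(\<And>t. t \<in> {1..CARD('r)} \<Longrightarrow> e t = e' t) \<Longrightarrow>
    (Kprod e :: ('r::{finite,linorder}, 'n::{finite,linorder}, 'k::field_char_0) matpoly) = Kprod e'"
  unfolding Kprod_def by (intro prod.cong) auto

lemma prod_mem_ideal_power_sum:
  assumes "finite B" "\<And>b. b \<in> B \<Longrightarrow> f b \<in> ideal_power J (a b)"
  shows "prod f B \<in> ideal_power J (sum a B)"
  using assms by (induction B rule: finite_induct) (auto intro: ideal_power_mult_mem)

text \<open>
  The pairs \<open>(e, m)\<close> that satisfy the inequalities are turned into solutions of linear equations by slack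
  variables, so they are sums of finitely many of them. For each generator \<open>b\<close> a large power of \<open>Kprod b\<close>
  misses the expected power of \<open>I\<close> by a fixed amount, and the total loss \<open>C\<close> does not depend on the
  multiplicities of the generators.
\<close>

lemma Kprod_mem_power:
  fixes I :: "('r::{finite,linorder}, 'n::{finite,linorder}, 'k::field_char_0) matpoly set"
  assumes rn: "CARD('r) \<le> CARD('n)" and \<Sigma>: "finite \<Sigma>" "\<Sigma> \<noteq> {}" "\<Sigma> \<subseteq> diagrams CARD('r)"
    and I: "I = inv_ideal_sum \<Sigma>"
    and W: "rees_representation I W" "\<forall>v\<in>W. \<exists>j\<in>{1..CARD('r)}. is_gamma_valuation j v"
  shows "\<exists>c. \<forall>e m. (\<forall>j\<in>{1..CARD('r)}. m * gamma_diagrams j \<Sigma> \<le> gamma_exp CARD('r) j e) \<longrightarrow> Kprod e \<in> ideal_power I (m - c)"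
proof -
  let ?r = "CARD('r)"
  let ?g = "\<lambda>j. gamma_diagrams j \<Sigma>"
  \<comment> \<open>the entry \<open>0\<close> holds \<open>m\<close>, the entries \<open>1, \<dots>, r\<close> hold \<open>e\<close>, and the entry \<open>r + j\<close> is the slack variable
    of the inequality for \<open>j\<close>\<close>
  define V where "V = {v :: nat \<Rightarrow> nat. (\<forall>i. i \<notin> {..2 * ?r} \<longrightarrow> v i = 0) \<and>
    (\<forall>j\<in>{1..?r}. gamma_exp ?r j v = v 0 * ?g j + v (?r + j))}"
  have "\<exists>B. finite B \<and> B \<subseteq> V \<and> (\<forall>v\<in>V. \<exists>c. \<forall>i. v i = (\<Sum>b\<in>B. c b * b i))"
  proof (rule finitely_generated_monoid[of "{..2 * ?r}"])
    fix v w assume vw: "v \<in> V" "w \<in> V" "w \<le> v"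
    have le: "w i \<le> v i" for i using vw(3) by (simp add: le_fun_def)
    have "gamma_exp ?r j (\<lambda>i. v i - w i) = gamma_exp ?r j v - gamma_exp ?r j w" for j
      unfolding gamma_exp_def diff_mult_distrib using le by (intro sum_subtractf_nat) (simp add: mult_le_mono1)
    moreover have "gamma_exp ?r j v - gamma_exp ?r j w = (v 0 - w 0) * ?g j + (v (?r + j) - w (?r + j))" if "j \<in> {1..?r}" for j
    proof -
      have "w 0 * ?g j \<le> v 0 * ?g j" "w (?r + j) \<le> v (?r + j)" using le by (auto intro: mult_le_mono1)
      then show ?thesis using vw(1,2) that by (simp add: V_def diff_mult_distrib)
    qed
    ultimately show "(\<lambda>i. v i - w i) \<in> V" using vw(1,2) by (simp add: V_def)
  qed (auto simp: V_def)
  then obtain B where B: "finite B" "B \<subseteq> V" "\<And>v. v \<in> V \<Longrightarrow> \<exists>c. \<forall>i. v i = (\<Sum>b\<in>B. c b * b i)" by blast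
  have "\<exists>N. \<forall>q. (Kprod b :: ('r, 'n, 'k) matpoly) ^ q \<in> ideal_power (ideal_power I (b 0)) (q - N)" if "b \<in> B" for b
  proof (rule integral_closure_powers, rule Kprod_mem_integral_closure[OF rn \<Sigma> I W])
    fix j assume "j \<in> {1..?r}"
    then show "b 0 * gamma_diagrams j \<Sigma> \<le> gamma_exp ?r j b" using that B(2) by (auto simp: V_def)
  qed
  then obtain N where N: "\<And>b q. b \<in> B \<Longrightarrow> (Kprod b :: ('r, 'n, 'k) matpoly) ^ q \<in> ideal_power (ideal_power I (b 0)) (q - N b)"
    by metis
  define C where "C = (\<Sum>b\<in>B. b 0 * N b)"
  have "Kprod e \<in> ideal_power I (m - C)" if e: "\<forall>j\<in>{1..?r}. m * ?g j \<le> gamma_exp ?r j e" for e m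
  proof -
    define v where "v i = (if i = 0 then m else if i \<le> ?r then e i else if i \<le> 2 * ?r then gamma_exp ?r (i - ?r) e - m * ?g (i - ?r) else 0)" for i
    have "gamma_exp ?r j v = gamma_exp ?r j e" for j unfolding gamma_exp_def by (intro sum.cong) (auto simp: v_def)
    then have "v \<in> V" using e by (auto simp: V_def v_def)
    then obtain c where c: "\<And>i. v i = (\<Sum>b\<in>B. c b * b i)" using B(3) by blast
    have "(Kprod e :: ('r, 'n, 'k) matpoly) = Kprod v" by (rule Kprod_cong) (auto simp: v_def)
    also have "v = (\<lambda>i. \<Sum>b\<in>B. c b * b i)" using c by (intro ext)
    also have "Kprod \<dots> = (\<Prod>b\<in>B. Kprod b ^ c b)" by (rule Kprod_sum[OF B(1), symmetric])
    finally have K: "(Kprod e :: ('r, 'n, 'k) matpoly) = (\<Prod>b\<in>B. Kprod b ^ c b)" .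
    have "(\<Prod>b\<in>B. Kprod b ^ c b :: ('r, 'n, 'k) matpoly) \<in> ideal_power I (\<Sum>b\<in>B. b 0 * (c b - N b))"
      using N ideal_power_ideal_power by (intro prod_mem_ideal_power_sum B(1)) blast
    moreover have "m - C \<le> (\<Sum>b\<in>B. b 0 * (c b - N b))"
    proof -
      have "m = (\<Sum>b\<in>B. b 0 * c b)" using c[of 0] by (simp add: v_def mult.commute)
      also have "\<dots> \<le> (\<Sum>b\<in>B. b 0 * (c b - N b) + b 0 * N b)"
      proof (intro sum_mono)
        fix b :: "nat \<Rightarrow> nat"
        have "b 0 * c b \<le> b 0 * (c b - N b + N b)" by (intro mult_le_mono2) simp
        then show "b 0 * c b \<le> b 0 * (c b - N b) + b 0 * N b" by (simp only: distrib_left)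
      qed
      finally show ?thesis by (simp add: sum.distrib C_def)
    qed
    ultimately show ?thesis unfolding K using ideal_power_antimono by blast
  qed
  then show ?thesis by blast
qed

section \<open>Initial degrees and resurgence\<close>

lemma gamma_exp_1: "gamma_exp r 1 e = (\<Sum>t\<in>{1..r}. e t * t)"
  by (simp add: gamma_exp_def)

text \<open>
  Multiplication by a power of \<open>\<Delta>\<^sub>p\<^sub>-\<^sub>1\<close>, which is not in \<open>D\<^sub>p\<close>, raises all \<open>\<gamma>\<^sub>j\<close> with \<open>j < p\<close> as much as needed. For
  \<open>j \<ge> p\<close> the inequality for \<open>p\<close> implies the one for \<open>j\<close> by convexity. Hence the product of the two powers
  lies in \<open>I\<^sup>m\<close>; the constant \<open>c\<close> is compensated by starting from \<open>m + c\<close>.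
\<close>

lemma maximal_minor_power_mem_sym_power:
  fixes I :: "('r::{finite,linorder}, 'n::{finite,linorder}, 'k::field_char_0) matpoly set"
  assumes rn: "CARD('r) \<le> CARD('n)" and \<Sigma>: "finite \<Sigma>" "\<Sigma> \<noteq> {}" "\<Sigma> \<subseteq> diagrams CARD('r)"
    and p: "1 \<le> p" "p \<le> CARD('r)"
    and c: "\<And>e m. (\<forall>j\<in>{1..CARD('r)}. m * gamma_diagrams j \<Sigma> \<le> gamma_exp CARD('r) j e) \<Longrightarrow> Kprod e \<in> ideal_power I (m - c)"
    and a: "(m + c) * gamma_diagrams p \<Sigma> \<le> a * (CARD('r) + 1 - p)"
  shows "Kprod (\<lambda>t. if t = CARD('r) then a else 0) \<in> sym_power p I m"
proof -
  let ?r = "CARD('r)"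
  let ?g = "\<lambda>j. gamma_diagrams j \<Sigma>"
  define N where "N = (m + c) * (\<Sum>j\<in>{1..?r}. ?g j)"
  define e1 where "e1 t = (if t = ?r then a else 0)" for t
  \<comment> \<open>for \<open>p = 1\<close> the index \<open>p - 1\<close> is outside the range of the product, and \<open>Kprod e2 = 1\<close>\<close>
  define e2 where "e2 t = (if t = p - 1 then N else 0)" for t
  have "(m + c) * ?g j \<le> gamma_exp ?r j (\<lambda>t. e2 t + e1 t)" if j: "j \<in> {1..?r}" for j
  proof (cases "p \<le> j")
    case True
    have "(m + c) * ?g j * (?r + 1 - p) \<le> (m + c) * (?g p * (?r + 1 - j))"
      using gamma_diagrams_convex[OF \<Sigma> True] j by (simp add: mult.assoc)
    also have "\<dots> \<le> a * (?r + 1 - p) * (?r + 1 - j)"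
      using mult_le_mono1[OF a, of "?r + 1 - j"] by (simp add: mult.assoc)
    finally have "(?r + 1 - p) * ((m + c) * ?g j) \<le> (?r + 1 - p) * (a * (?r + 1 - j))" by (simp add: mult_ac)
    then have "(m + c) * ?g j \<le> a * (?r + 1 - j)" using p by (subst (asm) mult_le_cancel1) auto
    also have "\<dots> = e1 ?r * (?r + 1 - j)" by (simp add: e1_def)
    also have "\<dots> \<le> (e2 ?r + e1 ?r) * (?r + 1 - j)" by (intro mult_le_mono1) simp
    also have "\<dots> \<le> gamma_exp ?r j (\<lambda>t. e2 t + e1 t)"
      unfolding gamma_exp_def using j by (intro member_le_sum) auto
    finally show ?thesis .
  next
    case False
    then have p1: "p - 1 \<in> {1..?r}" "1 \<le> p - 1 + 1 - j" using j p by auto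
    have "?g j \<le> (\<Sum>j\<in>{1..?r}. ?g j)" using j by (intro member_le_sum) auto
    then have "(m + c) * ?g j \<le> N" unfolding N_def by (rule mult_le_mono2)
    also have "\<dots> = e2 (p - 1) * 1" by (simp add: e2_def)
    also have "\<dots> \<le> (e2 (p - 1) + e1 (p - 1)) * (p - 1 + 1 - j)" using p1(2) by (intro mult_le_mono) auto
    also have "\<dots> \<le> gamma_exp ?r j (\<lambda>t. e2 t + e1 t)"
      unfolding gamma_exp_def using p1(1) by (intro member_le_sum) auto
    finally show ?thesis .
  qed
  then have "Kprod (\<lambda>t. e2 t + e1 t) \<in> ideal_power I (m + c - c)" by (intro c ballI)
  then have "Kprod e2 * Kprod e1 \<in> ideal_power I m" by (simp add: Kprod_mult)
  moreover have "(Kprod e2 :: ('r, 'n, 'k) matpoly) \<notin> det_ideal p"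
  proof
    assume "(Kprod e2 :: ('r, 'n, 'k) matpoly) \<in> det_ideal p"
    then have "1 * Kprod e2 \<in> (order_ideal (p - 1) 1 :: ('r, 'n, 'k) matpoly set)" by (simp add: det_ideal_eq_order_ideal[OF rn p(1)])
    then have "1 \<le> gamma_exp ?r (Suc (p - 1)) e2" by (rule order_ideal_Kprod_bound[OF rn one_not_in_order_ideal_1])
    moreover have "gamma_exp ?r (Suc (p - 1)) e2 = 0" unfolding gamma_exp_Suc by (intro sum.neutral) (auto simp: e2_def)
    ultimately show False by simp
  qed
  ultimately show ?thesis unfolding sym_power_def symbolic_power_at_det_ideal_iff[OF rn p(1)] e1_def by blast
qed

lemma gamma_exp_maximal_minor_power: "1 \<le> r \<Longrightarrow> gamma_exp r 1 (\<lambda>t. if t = r then a else 0) = r * a"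
proof -
  assume r: "1 \<le> r"
  have "gamma_exp r 1 (\<lambda>t. if t = r then a else 0) = (\<Sum>t\<in>{1..r}. if t = r then a * r else 0)"
    unfolding gamma_exp_1 by (intro sum.cong) auto
  then show ?thesis using r by (simp add: mult.commute)
qed

lemma initial_degree_inv_ideal_sum:
  fixes \<Sigma> :: "nat list set"
  assumes rn: "CARD('r) \<le> CARD('n)" and \<Sigma>: "finite \<Sigma>" "\<Sigma> \<noteq> {}" "\<Sigma> \<subseteq> diagrams CARD('r)"
  shows "initial_degree (inv_ideal_sum \<Sigma> :: ('r::{finite,linorder}, 'n::{finite,linorder}, 'k::field_char_0) matpoly set)
    = gamma_diagrams 1 \<Sigma>"
  unfolding initial_degree_def
proof (rule Least_equality)
  obtain \<sigma> where \<sigma>: "\<sigma> \<in> \<Sigma>" "gamma_diagram 1 \<sigma> = gamma_diagrams 1 \<Sigma>"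
    using gamma_diagrams_attained[OF \<Sigma>(1,2)] by blast
  then have d: "\<sigma> \<in> diagrams CARD('r)" using \<Sigma>(3) by blast
  have "(K_diagram \<sigma> :: ('r, 'n, 'k) matpoly) \<in> inv_ideal_sum \<Sigma>"
    using inv_ideal_subset_sum[OF \<Sigma>(1) \<sigma>(1)] K_diagram_mem_inv_ideal by blast
  then show "\<exists>f\<in>inv_ideal_sum \<Sigma> :: ('r, 'n, 'k) matpoly set. f \<noteq> 0 \<and> homogeneous (gamma_diagrams 1 \<Sigma>) f"
    unfolding \<sigma>(2)[symmetric] gamma_diagram_eq_gamma_exp[OF d] gamma_exp_1
    using Kprod_nonzero[OF rn, where 'k = 'k] homogeneous_Kprod[OF rn, where 'k = 'k]
    by (auto simp: K_diagram_eq_Kprod[OF d])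
next
  fix d assume "\<exists>f\<in>inv_ideal_sum \<Sigma> :: ('r, 'n, 'k) matpoly set. f \<noteq> 0 \<and> homogeneous d f"
  then obtain f where f: "f \<in> (inv_ideal_sum \<Sigma> :: ('r, 'n, 'k) matpoly set)" "f \<noteq> 0" "homogeneous d f" by blast
  obtain e where e: "(Kprod e :: ('r, 'n, 'k) matpoly) \<in> inv_ideal_sum \<Sigma>" "(\<Sum>t\<in>{1..CARD('r)}. e t * t) = d"
    using stable_homogeneous_Kprod[OF rn stable_inv_ideal_sum f] by blast
  have "1 * gamma_diagrams 1 \<Sigma> \<le> gamma_exp CARD('r) 1 e"
    by (rule Kprod_mem_power_bound[OF rn \<Sigma>(1,3) ideal_power_1_mem[OF e(1)]])
  then show "gamma_diagrams 1 \<Sigma> \<le> d" by (simp only: gamma_exp_1 e(2) mult_1)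
qed

text \<open>
  The constant \<open>c\<close> is that of the comparison between \<open>\<gamma>\<close>-inequalities and powers of \<open>I\<close>; both bounds meet up to
  an error that is bounded in \<open>m\<close>.
\<close>

lemma initial_degree_sym_power_bounds:
  fixes I :: "('r::{finite,linorder}, 'n::{finite,linorder}, 'k::field_char_0) matpoly set"
  assumes rn: "CARD('r) \<le> CARD('n)" and \<Sigma>: "finite \<Sigma>" "\<Sigma> \<noteq> {}" "\<Sigma> \<subseteq> diagrams CARD('r)"
    and I: "I = inv_ideal_sum \<Sigma>" and p: "1 \<le> p" "p \<le> CARD('r)"
    and c: "\<And>e m. (\<forall>j\<in>{1..CARD('r)}. m * gamma_diagrams j \<Sigma> \<le> gamma_exp CARD('r) j e) \<Longrightarrow> Kprod e \<in> ideal_power I (m - c)"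
  shows "m * gamma_diagrams p \<Sigma> * CARD('r) \<le> initial_degree (sym_power p I m) * (CARD('r) + 1 - p)"
    and "(m + c) * gamma_diagrams p \<Sigma> \<le> a * (CARD('r) + 1 - p) \<Longrightarrow> initial_degree (sym_power p I m) \<le> CARD('r) * a"
proof -
  let ?r = "CARD('r)"
  let ?E = "\<lambda>d. \<exists>f\<in>sym_power p I m. f \<noteq> 0 \<and> homogeneous d f"
  have upper: "?E (?r * a)" if "(m + c) * gamma_diagrams p \<Sigma> \<le> a * (?r + 1 - p)" for a
  proof -
    let ?e = "\<lambda>t. if t = ?r then a else 0"
    have "Kprod ?e \<in> sym_power p I m"
      by (rule maximal_minor_power_mem_sym_power[OF rn \<Sigma> p c that])
    moreover have "homogeneous (?r * a) (Kprod ?e :: ('r, 'n, 'k) matpoly)"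
      using homogeneous_Kprod[OF rn, of ?e, where 'k = 'k] gamma_exp_maximal_minor_power[of ?r a] p unfolding gamma_exp_1 by simp
    ultimately show ?thesis using Kprod_nonzero[OF rn, of ?e, where 'k = 'k] by blast
  qed
  show "initial_degree (sym_power p I m) \<le> ?r * a" if "(m + c) * gamma_diagrams p \<Sigma> \<le> a * (?r + 1 - p)"
    unfolding initial_degree_def by (rule Least_le[where P = ?E, OF upper[OF that]])
  have "1 \<le> ?r + 1 - p" using p by linarith
  then have "(m + c) * gamma_diagrams p \<Sigma> \<le> ((m + c) * gamma_diagrams p \<Sigma>) * (?r + 1 - p)"
    by (cases "?r + 1 - p") auto
  from upper[OF this] have "?E (initial_degree (sym_power p I m))" unfolding initial_degree_def by (rule LeastI)
  then obtain f where f: "f \<in> sym_power p I m" "f \<noteq> 0" "homogeneous (initial_degree (sym_power p I m)) f" by blast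
  have "stable (sym_power p I m)" unfolding I by (rule stable_symbolic_power[OF rn p(1) stable_inv_ideal_sum])
  then obtain e where e: "(Kprod e :: ('r, 'n, 'k) matpoly) \<in> sym_power p I m"
    "(\<Sum>t\<in>{1..?r}. e t * t) = initial_degree (sym_power p I m)"
    using stable_homogeneous_Kprod[OF rn _ f] by blast
  have "m * gamma_diagrams p \<Sigma> * ?r \<le> gamma_exp ?r p e * ?r"
    using Kprod_mem_sym_power_bound[OF rn \<Sigma>(1,3) p(1) order_refl e(1)[unfolded I]] by (rule mult_le_mono1)
  also have "\<dots> \<le> gamma_exp ?r 1 e * (?r + 1 - p)" using gamma_exp_convex[of 1 p ?r e] p by simp
  finally show "m * gamma_diagrams p \<Sigma> * ?r \<le> initial_degree (sym_power p I m) * (?r + 1 - p)"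
    unfolding gamma_exp_1 e(2) .
qed

lemma asymptotic_initial_degree_eq:
  fixes I :: "('r::{finite,linorder}, 'n::{finite,linorder}, 'k::field_char_0) matpoly set"
  assumes rn: "CARD('r) \<le> CARD('n)" and \<Sigma>: "finite \<Sigma>" "\<Sigma> \<noteq> {}" "\<Sigma> \<subseteq> diagrams CARD('r)"
    and I: "I = inv_ideal_sum \<Sigma>" and p: "1 \<le> p" "p \<le> CARD('r)"
    and c: "\<And>e m. (\<forall>j\<in>{1..CARD('r)}. m * gamma_diagrams j \<Sigma> \<le> gamma_exp CARD('r) j e) \<Longrightarrow> Kprod e \<in> ideal_power I (m - c)"
  shows "asymptotic_initial_degree p I = real CARD('r) * real (gamma_diagrams p \<Sigma>) / real (CARD('r) + 1 - p)"
proof -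
  let ?r = "CARD('r)"
  define \<alpha> where "\<alpha> m = initial_degree (sym_power p I m)" for m
  define d where "d = ?r + 1 - p"
  define G where "G = gamma_diagrams p \<Sigma>"
  define L where "L = real ?r * real G / real d"
  have d: "d > 0" using p by (simp add: d_def)
  note bounds = initial_degree_sym_power_bounds[OF rn \<Sigma> I p c]
  have low: "L * real m \<le> real (\<alpha> m)" for m
  proof -
    have "real (m * G * ?r) \<le> real (\<alpha> m * d)"
      using bounds(1)[of m] unfolding \<alpha>_def d_def G_def by (rule of_nat_mono)
    then show ?thesis using d by (simp add: L_def field_simps)
  qed
  have up: "real (\<alpha> m) \<le> L * real m + (L * real c + real ?r)" for m
  proof -
    \<comment> \<open>rounding \<open>(m + c) G / d\<close> up costs at most \<open>1\<close>\<close>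
    define a where "a = (m + c) * G div d + 1"
    have "(m + c) * G \<le> a * d" unfolding a_def using d
      by (metis Suc_eq_plus1 dividend_less_div_times add.commute less_imp_le mult_Suc)
    then have "\<alpha> m \<le> ?r * a" using bounds(2)[of m a] unfolding \<alpha>_def d_def G_def by blast
    then have "real (\<alpha> m) \<le> real ?r * real a" by (metis of_nat_mono of_nat_mult)
    also have "real a \<le> real ((m + c) * G) / real d + 1"
      unfolding a_def using of_nat_div_le_of_nat[of "(m + c) * G" d, where 'a = real] by simp
    then have "real ?r * real a \<le> real ?r * (real ((m + c) * G) / real d + 1)" by (intro mult_left_mono) auto
    also have "\<dots> = L * real m + (L * real c + real ?r)"
      using d by (simp add: L_def field_simps)
    finally show ?thesis .
  qed
  have "(\<lambda>m. real (\<alpha> m) / real m) \<longlonglongrightarrow> L"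
  proof (rule tendsto_sandwich)
    show "\<forall>\<^sub>F m in sequentially. L \<le> real (\<alpha> m) / real m"
      using eventually_gt_at_top[of 0] by eventually_elim (use low in \<open>simp add: field_simps\<close>)
    show "\<forall>\<^sub>F m in sequentially. real (\<alpha> m) / real m \<le> L + (L * real c + real ?r) / real m"
      using eventually_gt_at_top[of 0] by eventually_elim (use up in \<open>simp add: field_simps\<close>)
    show "(\<lambda>m. L + (L * real c + real ?r) / real m) \<longlonglongrightarrow> L"
      using tendsto_add[OF tendsto_const lim_const_over_n[of "L * real c + real ?r"], of L] by simp
  qed simp
  then show ?thesis unfolding asymptotic_initial_degree_def \<alpha>_def L_def G_def d_def by (rule limI)
qed

text \<open>
  A power of \<open>\<Delta>\<^sub>r\<close> in the symbolic power has smaller degree than every nonzero element of the ordinary one.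
\<close>

lemma sym_power_eventually_not_subset:
  fixes I :: "('r::{finite,linorder}, 'n::{finite,linorder}, 'k::field_char_0) matpoly set"
  assumes rn: "CARD('r) \<le> CARD('n)" and \<Sigma>: "finite \<Sigma>" "\<Sigma> \<noteq> {}" "\<Sigma> \<subseteq> diagrams CARD('r)"
    and I: "I = inv_ideal_sum \<Sigma>" and p: "1 \<le> p" "p \<le> CARD('r)"
    and c: "\<And>e m. (\<forall>j\<in>{1..CARD('r)}. m * gamma_diagrams j \<Sigma> \<le> gamma_exp CARD('r) j e) \<Longrightarrow> Kprod e \<in> ideal_power I (m - c)"
    and uv: "u * gamma_diagrams p \<Sigma> * CARD('r) < v * gamma_diagrams 1 \<Sigma> * (CARD('r) + 1 - p)"
  shows "\<forall>\<^sub>F k in sequentially. \<not> sym_power p I (u * k) \<subseteq> ideal_power I (v * k)"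
proof -
  let ?r = "CARD('r)"
  define d where "d = ?r + 1 - p"
  define G where "G = gamma_diagrams p \<Sigma>"
  define G1 where "G1 = gamma_diagrams 1 \<Sigma>"
  have d: "d > 0" using p by (simp add: d_def)
  have "\<not> sym_power p I (u * k) \<subseteq> ideal_power I (v * k)" if k: "k > ?r * (c * G + d)" for k
  proof
    assume sub: "sym_power p I (u * k) \<subseteq> ideal_power I (v * k)"
    define a where "a = (u * k + c) * G div d + 1"
    have "(u * k + c) * G \<le> a * d" unfolding a_def using d
      by (metis Suc_eq_plus1 dividend_less_div_times add.commute less_imp_le mult_Suc)
    then have a: "(u * k + c) * gamma_diagrams p \<Sigma> \<le> a * (?r + 1 - p)" by (simp only: d_def G_def)
    have "Kprod (\<lambda>t. if t = ?r then a else 0) \<in> sym_power p I (u * k)"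
      by (rule maximal_minor_power_mem_sym_power[OF rn \<Sigma> p c a])
    then have "Kprod (\<lambda>t. if t = ?r then a else 0) \<in> ideal_power (inv_ideal_sum \<Sigma> :: ('r, 'n, 'k) matpoly set) (v * k)"
      using sub I by blast
    then have "v * k * G1 \<le> ?r * a"
      using Kprod_mem_power_bound[OF rn \<Sigma>(1,3)] gamma_exp_maximal_minor_power[of ?r a] p unfolding G1_def by fastforce
    then have "v * k * G1 * d \<le> ?r * (a * d)" by (metis mult.assoc mult_le_mono1)
    also have "a * d \<le> (u * k + c) * G + d" unfolding a_def by (simp add: div_times_less_eq_dividend)
    then have "?r * (a * d) \<le> ?r * ((u * k + c) * G + d)" by (rule mult_le_mono2)
    finally have "k * (v * G1 * d) \<le> k * (u * G * ?r) + ?r * (c * G + d)" by (simp add: algebra_simps)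
    moreover have "k * (u * G * ?r + 1) \<le> k * (v * G1 * d)"
      using uv unfolding d_def G_def G1_def by (intro mult_le_mono2) simp
    ultimately have "k \<le> ?r * (c * G + d)" by (simp add: algebra_simps)
    with k show False by simp
  qed
  then show ?thesis by (rule eventually_mono[OF eventually_gt_at_top[of "?r * (c * G + d)"]])
qed

text \<open>
  For \<open>j \<ge> p\<close> the needed inequality follows from \<open>v k + c \<le> u k\<close>, and for \<open>j < p\<close> by convexity from the one for
  \<open>p\<close> and from \<open>\<gamma>\<^sub>j(\<Sigma>) r \<le> \<gamma>\<^sub>1(\<Sigma>) (r - j + 1)\<close>.
\<close>

lemma sym_power_frequently_subset:
  fixes I :: "('r::{finite,linorder}, 'n::{finite,linorder}, 'k::field_char_0) matpoly set"
  assumes rn: "CARD('r) \<le> CARD('n)" and \<Sigma>: "finite \<Sigma>" "\<Sigma> \<noteq> {}" "\<Sigma> \<subseteq> diagrams CARD('r)"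
    and I: "I = inv_ideal_sum \<Sigma>" and p: "1 \<le> p" "p \<le> CARD('r)" and pos: "gamma_diagrams p \<Sigma> > 0"
    and c: "\<And>e m. (\<forall>j\<in>{1..CARD('r)}. m * gamma_diagrams j \<Sigma> \<le> gamma_exp CARD('r) j e) \<Longrightarrow> Kprod e \<in> ideal_power I (m - c)"
    and uv: "v * gamma_diagrams 1 \<Sigma> * (CARD('r) + 1 - p) < u * gamma_diagrams p \<Sigma> * CARD('r)"
    and k: "k \<ge> c * gamma_diagrams 1 \<Sigma> * (CARD('r) + 1 - p)"
  shows "sym_power p I (u * k) \<subseteq> ideal_power I (v * k)"
proof (rule stable_subset_if_Kprods[OF rn])
  let ?r = "CARD('r)"
  let ?g = "\<lambda>j. gamma_diagrams j \<Sigma>"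
  define d where "d = ?r + 1 - p"
  have d: "d > 0" using p by (simp add: d_def)
  show "stable (sym_power p I (u * k))" unfolding I by (rule stable_symbolic_power[OF rn p(1) stable_inv_ideal_sum])
  show "stable (ideal_power I (v * k))" unfolding I by (rule ideal_power_stable[OF stable_inv_ideal_sum])
  have g1: "?g p * ?r \<le> ?g 1 * d" using gamma_diagrams_convex[OF \<Sigma> p] by (simp add: d_def)
  then have "?g 1 > 0" using pos d by (cases "?g 1 = 0") auto
  have star: "(v * k + c) * (?g 1 * d) \<le> u * k * (?g p * ?r)"
  proof -
    have "(v * k + c) * (?g 1 * d) = k * (v * ?g 1 * d) + c * ?g 1 * d" by (simp add: algebra_simps)
    also have "\<dots> \<le> k * (v * ?g 1 * d) + k * 1" using k by (simp add: d_def)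
    also have "\<dots> = k * (v * ?g 1 * d + 1)" by simp
    also have "\<dots> \<le> k * (u * ?g p * ?r)" using uv by (intro mult_le_mono2) (simp add: d_def)
    finally show ?thesis by (simp add: mult_ac)
  qed
  have "u * k * (?g p * ?r) \<le> u * k * (?g 1 * d)" using g1 by (rule mult_le_mono2)
  with star have "(v * k + c) * (?g 1 * d) \<le> u * k * (?g 1 * d)" by (rule order_trans)
  then have ukv: "v * k + c \<le> u * k" using \<open>?g 1 > 0\<close> d by (subst (asm) mult_le_cancel2) auto
  fix e assume K: "(Kprod e :: ('r, 'n, 'k) matpoly) \<in> sym_power p I (u * k)"
  have ge: "u * k * ?g j \<le> gamma_exp ?r j e" if "p \<le> j" for j
    by (rule Kprod_mem_sym_power_bound[OF rn \<Sigma>(1,3) p(1) that K[unfolded I]])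
  have "(v * k + c) * ?g j \<le> gamma_exp ?r j e" if j: "j \<in> {1..?r}" for j
  proof (cases "p \<le> j")
    case True
    have "(v * k + c) * ?g j \<le> u * k * ?g j" using ukv by (rule mult_le_mono1)
    also have "\<dots> \<le> gamma_exp ?r j e" by (rule ge[OF True])
    finally show ?thesis .
  next
    case False
    define b where "b = ?r + 1 - j"
    have b: "b > 0" using j by (simp add: b_def)
    have "?g j * ?r \<le> ?g 1 * b" using gamma_diagrams_convex[OF \<Sigma>, of 1 j] j by (simp add: b_def)
    then have "(v * k + c) * ?g j * (?r * d) \<le> (v * k + c) * (?g 1 * d) * b"
      using mult_le_mono2[of "?g j * ?r" "?g 1 * b" "(v * k + c) * d"] by (simp add: mult_ac)
    also have "\<dots> \<le> u * k * (?g p * ?r) * b" using star by (rule mult_le_mono1)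
    also have "\<dots> = (u * k * ?g p) * (b * ?r)" by (simp add: mult_ac)
    also have "\<dots> \<le> gamma_exp ?r p e * (b * ?r)" by (rule mult_le_mono1[OF ge[OF order_refl]])
    also have "\<dots> = gamma_exp ?r p e * b * ?r" by simp
    also have "\<dots> \<le> gamma_exp ?r j e * d * ?r"
      using gamma_exp_convex[of j p ?r e] False p unfolding b_def d_def by (intro mult_le_mono1) simp
    finally have "((v * k + c) * ?g j) * (?r * d) \<le> gamma_exp ?r j e * (?r * d)" by (simp add: mult_ac)
    then show ?thesis using d p by (subst (asm) mult_le_cancel2) auto
  qed
  then have "Kprod e \<in> ideal_power I (v * k + c - c)" by (intro c ballI)
  then show "Kprod e \<in> ideal_power I (v * k)" by simp
qed

lemma Sup_fractions_eq:
  fixes \<rho> :: real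
  assumes "\<rho> > 0"
    and below: "\<And>u v. 0 < u \<Longrightarrow> 0 < v \<Longrightarrow> real u / real v < \<rho> \<Longrightarrow> P u v"
    and above: "\<And>u v. 0 < u \<Longrightarrow> 0 < v \<Longrightarrow> real u / real v > \<rho> \<Longrightarrow> \<not> P u v"
  shows "Sup {ereal (real u / real v) | u v. 0 < u \<and> 0 < v \<and> P u v} = ereal \<rho>" (is "Sup ?S = _")
proof (rule antisym)
  show "Sup ?S \<le> ereal \<rho>"
    by (rule Sup_least) (use above in \<open>force simp: not_less[symmetric]\<close>)
  show "ereal \<rho> \<le> Sup ?S"
  proof (rule ccontr)
    assume "\<not> ereal \<rho> \<le> Sup ?S"
    then have "Sup ?S < ereal \<rho>" by simp
    then obtain y where y: "Sup ?S < ereal y" "ereal y < ereal \<rho>" using ereal_dense2 by blast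
    then have "max y 0 < \<rho>" using assms(1) by simp
    then obtain q where q: "q \<in> \<rat>" "max y 0 < q" "q < \<rho>" using Rats_dense_in_real by blast
    then obtain u v :: nat where uv: "v \<noteq> 0" "\<bar>q\<bar> = real u / real v" by (auto elim: Rats_abs_nat_div_natE)
    have qeq: "q = real u / real v" using uv(2) q(2) by simp
    then have "u > 0" using q(2) by (cases "u = 0") auto
    then have "P u v" using below[of u v] uv(1) q(3) qeq by simp
    then have "ereal q \<in> ?S" using \<open>u > 0\<close> uv(1) qeq by auto
    then have "ereal q \<le> Sup ?S" by (rule Sup_upper)
    with y(1) q(2) show False by (meson ereal_less_eq(3) leD le_less_trans less_imp_le max.strict_boundedE)
  qed
qed

theorem theorem4p3:
  fixes \<Sigma> :: "nat list set"
    and p :: nat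
    and I :: "('r::{finite,linorder}, 'n::{finite,linorder}, 'k::field_char_0) matpoly set"
    and W :: "(('r, 'n, 'k) matpoly fract \<Rightarrow> int) set"
  assumes "CARD('r) \<le> CARD('n)"
    and "finite \<Sigma>" and "\<Sigma> \<noteq> {}" and "\<Sigma> \<subseteq> diagrams CARD('r)"
    and "\<forall>\<sigma>\<in>\<Sigma>. \<forall>\<tau>\<in>\<Sigma>. diagram_le \<sigma> \<tau> \<longrightarrow> \<sigma> = \<tau>"
    and "I = inv_ideal_sum \<Sigma>"
    and "1 \<le> p" and "p \<le> CARD('r)" and "gamma_diagrams p \<Sigma> > 0"
    and "is_rees_valuations I W"
    and "\<forall>v\<in>W. \<exists>j\<in>{1..CARD('r)}. is_gamma_valuation j v"
  shows "asymptotic_resurgence (sym_power p I) (ideal_power I)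
           = ereal (real (initial_degree I) / asymptotic_initial_degree p I)
       \<and> real (initial_degree I) / asymptotic_initial_degree p I
           = (real CARD('r) - real p + 1) * real (gamma_diagrams 1 \<Sigma>)
               / (real CARD('r) * real (gamma_diagrams p \<Sigma>))"
proof -
  let ?r = "CARD('r)"
  note rn = assms(1) and \<Sigma> = assms(2-4) and I = assms(6) and p = assms(7,8) and pos = assms(9)
  have "rees_representation I W" using assms(10) by (simp add: is_rees_valuations_def)
  from Kprod_mem_power[OF rn \<Sigma> I this assms(11)] obtain c where
    c: "\<And>e m. (\<forall>j\<in>{1..?r}. m * gamma_diagrams j \<Sigma> \<le> gamma_exp ?r j e) \<Longrightarrow> Kprod e \<in> ideal_power I (m - c)" by blast
  define d G G1 where "d = ?r + 1 - p" and "G = gamma_diagrams p \<Sigma>" and "G1 = gamma_diagrams 1 \<Sigma>"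
  define \<rho> where "\<rho> = real d * real G1 / (real ?r * real G)"
  have d: "d > 0" "real ?r - real p + 1 = real d" using p by (auto simp: d_def of_nat_diff)
  have G: "G > 0" and r: "?r > 0" using pos by (auto simp: G_def)
  have "G * ?r \<le> G1 * d" using gamma_diagrams_convex[OF \<Sigma> p] by (simp add: d_def G_def G1_def)
  then have G1: "G1 > 0" using G r by (cases "G1 = 0") auto
  have ratio: "real (initial_degree I) / asymptotic_initial_degree p I = \<rho>"
  proof -
    have "initial_degree I = G1" unfolding I G1_def by (rule initial_degree_inv_ideal_sum[OF rn \<Sigma>])
    moreover have "asymptotic_initial_degree p I = real ?r * real G / real d"
      unfolding d_def G_def by (rule asymptotic_initial_degree_eq[OF rn \<Sigma> I p c])
    ultimately show ?thesis using d(1) by (simp add: \<rho>_def)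
  qed
  have cmp: "real u / real v < \<rho> \<longleftrightarrow> u * G * ?r < v * G1 * d" "\<rho> < real u / real v \<longleftrightarrow> v * G1 * d < u * G * ?r"
    if "v > 0" for u v
  proof -
    have "real u / real v < \<rho> \<longleftrightarrow> real u * (real ?r * real G) < real d * real G1 * real v"
      unfolding \<rho>_def using that G r by (simp add: divide_less_eq less_divide_eq mult_ac)
    also have "\<dots> \<longleftrightarrow> real (u * G * ?r) < real (v * G1 * d)" by (simp add: mult_ac)
    finally show "real u / real v < \<rho> \<longleftrightarrow> u * G * ?r < v * G1 * d" by (simp only: of_nat_less_iff)
    have "\<rho> < real u / real v \<longleftrightarrow> real d * real G1 * real v < real u * (real ?r * real G)"
      unfolding \<rho>_def using that G r by (simp add: divide_less_eq less_divide_eq mult_ac)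
    also have "\<dots> \<longleftrightarrow> real (v * G1 * d) < real (u * G * ?r)" by (simp add: mult_ac)
    finally show "\<rho> < real u / real v \<longleftrightarrow> v * G1 * d < u * G * ?r" by (simp only: of_nat_less_iff)
  qed
  have "asymptotic_resurgence (sym_power p I) (ideal_power I) = ereal \<rho>"
    unfolding asymptotic_resurgence_def
  proof (rule Sup_fractions_eq)
    show "\<rho> > 0" unfolding \<rho>_def using d G G1 r by simp
  next
    fix u v :: nat assume "0 < v" "real u / real v < \<rho>"
    then show "\<forall>\<^sub>F k in sequentially. \<not> sym_power p I (u * k) \<subseteq> ideal_power I (v * k)"
      using sym_power_eventually_not_subset[OF rn \<Sigma> I p c] cmp(1)[of v u] unfolding d_def G_def G1_def by blast
  next
    fix u v :: nat assume "0 < v" "real u / real v > \<rho>"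
    then have "sym_power p I (u * k) \<subseteq> ideal_power I (v * k)" if "k \<ge> c * G1 * d" for k
      using sym_power_frequently_subset[OF rn \<Sigma> I p pos c, of v u k] cmp(2)[of v u] that
      unfolding d_def G_def G1_def by blast
    then show "\<not> (\<forall>\<^sub>F k in sequentially. \<not> sym_power p I (u * k) \<subseteq> ideal_power I (v * k))"
      unfolding eventually_sequentially by (meson nat_le_linear)
  qed
  then show ?thesis unfolding ratio by (simp add: \<rho>_def d(2)[symmetric] G_def G1_def)
qed

end
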